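(* Let $\lambda=(\lambda_1,\dots,\lambda_n)\in\mathbb Z^n$ with $\lambda_1\ge\cdots\ge\lambda_n\ge0$. Then in $\widetilde H_{\mathrm{loc}}$ \begin{align*} \chi^+(T_{w_0})\varepsilon_+ &= \chi^+(T_{w_\lambda})\Big(\sum_{z\in W^\lambda}\kappa^+_{v_\lambda z}\,\eta_z\,\kappa^Y_z\Big)\varepsilon^+_\lambda,\\ \chi^+(T_{w_0})\varepsilon_\pm &= \chi^+(T_{w_{\lambda+\omega}})\Big(\sum_{z\in W^{\lambda+\omega}}(-1)^{\ell_d(z)}\kappa^\pm_{v_{\lambda+\omega}z}\,\eta_z\,\kappa^Y_z\Big)\varepsilon^+_{\lambda+\omega},\\ \chi^+(T_{w_0})\varepsilon_\mp &= \chi^+(T_{w_{\lambda+\pi}})\Big(\sum_{z\in W^{\lambda+\pi}}(-1)^{\ell_s(z)}\kappa^\mp_{v_{\lambda+\pi}z}\,\eta_z\,\kappa^Y_z\Big)\varepsilon^+_{\lambda+\pi},\\ \chi^+(T_{w_0})\varepsilon_- &= \chi^+(T_{w_{\lambda+\rho}})\Big(\sum_{z\in W^{\lambda+\rho}}(-1)^{\ell(z)}\kappa^-_{v_{\lambda+\rho}z}\,\eta_z\,\kappa^Y_z\Big)\varepsilon^+_{\lambda+\rho}, \end{align*} where $\rho=(n,n-1,\dots,2,1)$, $\omega=(1,1,\dots,1)$, $\pi=(n-1,\dots,2,1,0)$.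
   Context: Let $n\ge 1$ and $\mathbb K=\mathbb C(q^{1/2},t^{1/2},t_0^{1/2},u_0^{1/2},t_n^{1/2},u_n^{1/2})$, with independent parameters. **Lattices and reflections.** Let $Q=\mathbb Z\text{-span}\{\varepsilon_1,\dots,\varepsilon_n,\tfrac12\delta\}$ and $Q^\vee=\mathbb Z\text{-span}\{\varepsilon_1^\vee,\dots,\varepsilon_n^\vee,\tfrac12K\}$. On $Q$: $s_i$ ($1\le i\le n-1$) swaps $\varepsilon_i,\varepsilon_{i+1}$; $s_n$ sends $\varepsilon_n\mapsto-\varepsilon_n$; $s_0$ sends $\varepsilon_1\mapsto-\varepsilon_1+\delta$; all other basis elements are fixed. The same formulas with $\varepsilon_i^\vee,K$ in place of $\varepsilon_i,\delta$ define the action on $Q^\vee$. $W_{\mathrm{fin}}$ is the group generated by $s_1,\dots,s_n$; it also acts on $\mathbb Z^n$, $s_i$ ($i<n$) swapping the $i$th and $(i+1)$st entries and $s_n$ negating the last entry. $w_0$ is its longest element. For $w\in W_{\mathrm{fin}}$, $\ell_s(w)$ (resp. $\ell_d(w)$) is the number of factors $s_i$ with $i<n$ (resp. factors $s_n$) in a reduced word of $w$, and $\ell=\ell_s+\ell_d$. Simple roots: $\alpha_0=-\varepsilon_1+\tfrac12\delta$, $\alpha_i=\varepsilon_i-\varepsilon_{i+1}$ ($1\le i<n$), $\alpha_n=\varepsilon_n$; simple coroots: $\alpha_0^\vee=-\varepsilon_1^\vee+\tfrac12K$, $\alpha_i^\vee=\varepsilon_i^\vee-\varepsilon_{i+1}^\vee$,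 $\alpha_n^\vee=\varepsilon_n^\vee$. Parameters: $t_{\alpha_0}=t_0,u_{\alpha_0}=u_0$; $t_{\alpha_n}=t_n,u_{\alpha_n}=u_n$; $t_{\alpha_0^\vee}=u_n,u_{\alpha_0^\vee}=u_0$; $t_{\alpha_n^\vee}=t_n,u_{\alpha_n^\vee}=t_0$; and $t_{\alpha_i}=u_{\alpha_i}=t_{\alpha_i^\vee}=u_{\alpha_i^\vee}=t$ for $1\le i<n$. **Variables.** $\mathbb K(X)=\mathbb K(X_1,\dots,X_n)$ with $X^{\varepsilon_i}=X_i$, $X^{\delta/2}=q^{1/2}$; $\mathbb K(Y)=\mathbb K(Y_1,\dots,Y_n)$ with $Y^{\varepsilon_i^\vee}=Y_i$, $Y^{K/2}=q^{-1/2}$. Set $$c^Y_{\alpha^\vee}=t_{\alpha^\vee}^{-1/2}\frac{(1-t_{\alpha^\vee}^{1/2}u_{\alpha^\vee}^{1/2}Y^{\alpha^\vee})(1+t_{\alpha^\vee}^{1/2}u_{\alpha^\vee}^{-1/2}Y^{\alpha^\vee})}{1-Y^{2\alpha^\vee}},\qquad c^{X^{-1}}_{\alpha}=t_\alpha^{-1/2}\frac{(1-t_\alpha^{1/2}u_\alpha^{1/2}X^{-\alpha})(1+t_\alpha^{1/2}u_\alpha^{-1/2}X^{-\alpha})}{1-X^{-2\alpha}} .$$ **The algebra $\widetilde H_{\mathrm{loc}}$** is the $\mathbb K$-algebra generated by $\mathbb K(X)$, $\mathbb K(Y)$, $\xi_{s_i}$, $\eta_{s_i}$, $T_{\alpha_i}$,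 $T_{\alpha_i^\vee}$ ($0\le i\le n$), with relations: the $\xi_{s_i}$, and likewise the $\eta_{s_i}$, are involutions satisfying the braid relations of the affine Coxeter diagram of type $C_n$ (nodes $0,1,\dots,n$ in a line, double bonds at both ends); $\xi_{s_i}X^\mu=X^{s_i\mu}\xi_{s_i}$; $\eta_{s_i}Y^{\lambda^\vee}=Y^{s_i\lambda^\vee}\eta_{s_i}$; $T_{\alpha_i^\vee}+t_{\alpha_i^\vee}^{-1/2}=(1+\eta_{s_i})c^Y_{\alpha_i^\vee}$ and $T_{\alpha_i}+t_{\alpha_i}^{-1/2}=(1+\xi_{s_i})c^{X^{-1}}_{\alpha_i}$ for $0\le i\le n$; $T_j:=T_{\alpha_j}=T_{\alpha_j^\vee}$ for $1\le j\le n$; and, with $T_{s_{\varepsilon_1}}=T_1\cdots T_{n-1}T_nT_{n-1}\cdots T_1$: $Y_1=T_{\alpha_0}T_{s_{\varepsilon_1}}$, $X_1=T_{\alpha_0^\vee}^{-1}T_{s_{\varepsilon_1}}^{-1}$, $Y_{j+1}=T_j^{-1}Y_jT_j^{-1}$, $X_{j+1}=T_jX_jT_j$ ($1\le j<n$), and $Y_1^{-1}X_1=q^{1/2}(u_0^{1/2}-u_0^{-1/2})T_{s_{\varepsilon_1}}^{-1}+qT_{s_{\varepsilon_1}}^{-1}X_1^{-1}Y_1T_{s_{\varepsilon_1}}^{-1}$. **Hecke symmetrizers.** For a reduced word $w=s_{i_1}\cdots s_{i_k}$ in $W_{\mathrm{fin}}$ put $T_w=T_{i_1}\cdots T_{i_k}$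 and $\eta_w=\eta_{s_{i_1}}\cdots\eta_{s_{i_k}}$. The four one-dimensional characters $\chi^\Xi$, $\Xi\in\{+,\pm,\mp,-\}$, of the finite Hecke algebra generated by $T_1,\dots,T_n$ are: for $i<n$, $\chi^+(T_i)=\chi^\pm(T_i)=t^{1/2}$ and $\chi^\mp(T_i)=\chi^-(T_i)=-t^{-1/2}$; $\chi^+(T_n)=\chi^\mp(T_n)=t_n^{1/2}$ and $\chi^\pm(T_n)=\chi^-(T_n)=-t_n^{-1/2}$. Then $\varepsilon_\Xi=\frac1{\chi^\Xi(T_{w_0})}\sum_{w\in W_{\mathrm{fin}}}\chi^\Xi(T_w)T_w$ (so the coefficient of $T_{w_0}$ in $\varepsilon_\Xi$ is $1$). **Stabilizers.** For $\nu\in\mathbb Z^n$ with $\nu_1\ge\cdots\ge\nu_n\ge0$: $W_\nu$ is the stabilizer of $\nu$ in $W_{\mathrm{fin}}$, $W^\nu$ is the set of minimal length representatives of the cosets in $W_{\mathrm{fin}}/W_\nu$, $w_\nu$ is the longest element of $W_\nu$, $v_\nu$ is the maximal (longest) element of $W^\nu$, and $\varepsilon^+_\nu=\frac1{\chi^+(T_{w_\nu})}\sum_{w\in W_\nu}\chi^+(T_w)T_w$. **$\kappa$-functions.** For $w\in W_{\mathrm{fin}}$ with reduced word $w=s_{i_1}\cdots s_{i_\ell}$, $\mathrm{Inv}(w)=\{s_{i_\ell}\cdots s_{i_{k+1}}\alpha_{i_k}^\vee\mid 1\le k\le\ell\}$ (the positive coroots among $\varepsilon_i^\vee$, $\varepsilon_i^\vee\pm\varepsilon_j^\vee$,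 $i<j$, made negative by $w$); $\mathrm{Inv}_d(w)=\mathrm{Inv}(w)\cap\{\varepsilon_1^\vee,\dots,\varepsilon_n^\vee\}$ and $\mathrm{Inv}_s(w)=\mathrm{Inv}(w)\cap\{\varepsilon_i^\vee\pm\varepsilon_j^\vee\mid i<j\}$. Set $$\kappa^Y_{\varepsilon_i^\vee}=\frac{(1-t_n^{1/2}t_0^{1/2}Y_i)(1+t_n^{1/2}t_0^{-1/2}Y_i)}{1-Y_i^2},\qquad \kappa^Y_\beta=\frac{1-tY^\beta}{1-Y^\beta}\ \text{ for }\beta=\varepsilon_i^\vee\pm\varepsilon_j^\vee,$$ let $\kappa^{Y^{-1}}_\beta$ be obtained from $\kappa^Y_\beta$ by replacing all $Y_i$ by $Y_i^{-1}$, let $\kappa^Y_w=\prod_{\beta\in\mathrm{Inv}(w)}\kappa^Y_\beta$, and \begin{align*} \kappa^+_w&=\prod_{\beta\in\mathrm{Inv}_s(w)}\kappa^Y_\beta\prod_{\beta\in\mathrm{Inv}_d(w)}\kappa^Y_\beta, & \kappa^\pm_w&=\prod_{\beta\in\mathrm{Inv}_s(w)}\kappa^Y_\beta\prod_{\beta\in\mathrm{Inv}_d(w)}\kappa^{Y^{-1}}_\beta,\\ \kappa^-_w&=\prod_{\beta\in\mathrm{Inv}_s(w)}\kappa^{Y^{-1}}_\beta\prod_{\beta\in\mathrm{Inv}_d(w)}\kappa^{Y^{-1}}_\beta, & \kappa^\mp_w&=\prod_{\beta\in\mathrm{Inv}_s(w)}\kappa^{Y^{-1}}_\beta\prod_{\beta\in\mathrm{Inv}_d(w)}\kappa^{Y}_\beta.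 \end{align*}
   Formalization: The printed identities fail (for n=1 the right side of the ± line is minus the left). Proved instead: v_ν z is replaced by v_ν z^{-1} in all four lines, and the right sides of the ± and − lines carry overall factors (-1)^{ℓ_d(w_0)} and (-1)^{ℓ(w_0)}. *)

theory Defs
  imports
    "HOL-Library.Poly_Mapping"
    "HOL-Computational_Algebra.Fraction_Field"
    Complex_Main
begin

section \<open>The coefficient field and the rational function fields\<close>

datatype param = Pq | Pt | Pt0 | Pu0 | Ptn | Pun

text \<open>Any linear order will do: it only serves to make polynomial rings integral domains,
  through the instances for \<^type>\<open>poly_mapping\<close>.\<close>

instantiation param :: linorder
begin

primrec param_index :: "param \<Rightarrow> nat" where
  "param_index Pq = 0"
| "param_index Pt = 1"
| "param_index Pt0 = 2"
| "param_index Pu0 = 3"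
| "param_index Ptn = 4"
| "param_index Pun = 5"

definition less_eq_param :: "param \<Rightarrow> param \<Rightarrow> bool" where
  "x \<le> y \<longleftrightarrow> param_index x \<le> param_index y"

definition less_param :: "param \<Rightarrow> param \<Rightarrow> bool" where
  "x < y \<longleftrightarrow> param_index x < param_index y"

instance
proof
  fix x y z :: param
  have inj: "param_index x = param_index y \<Longrightarrow> x = y"
    by (cases x; cases y) simp_all
  show "(x < y) = (x \<le> y \<and> \<not> y \<le> x)" by (auto simp: less_eq_param_def less_param_def)
  show "x \<le> x" by (simp add: less_eq_param_def)
  show "x \<le> y \<Longrightarrow> y \<le> z \<Longrightarrow> x \<le> z" by (simp add: less_eq_param_def)
  show "x \<le> y \<Longrightarrow> y \<le> x \<Longrightarrow> x = y" unfolding less_eq_param_def by (intro inj order.antisym)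
  show "x \<le> y \<or> y \<le> x" by (auto simp: less_eq_param_def)
qed

end

type_synonym K = "((param \<Rightarrow>\<^sub>0 nat) \<Rightarrow>\<^sub>0 complex) fract"

text \<open>The variables of \<^typ>\<open>K\<close> are the square roots of the parameters:
  \<open>half Pq\<close> is $q^{1/2}$, and so on.\<close>

definition half :: "param \<Rightarrow> K" where
  "half p = Fraction_Field.Fract (Poly_Mapping.single (Poly_Mapping.single p 1) 1) 1"

text \<open>Throughout, \<open>'n\<close> is a finite linearly ordered type and $n$ is its cardinality; its elements,
  in increasing order, play the role of the indices $1,\dots,n$. The field
  \<open>'n ratfun\<close> serves both as $\mathbb K(X)$ and as $\mathbb K(Y)$.\<close>

type_synonym 'n ratfun = "(('n \<Rightarrow>\<^sub>0 nat) \<Rightarrow>\<^sub>0 K) fract"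

definition const :: "K \<Rightarrow> ('n::{finite,linorder}) ratfun" where
  "const c = Fraction_Field.Fract (Poly_Mapping.single 0 c) 1"

definition var :: "'n \<Rightarrow> ('n::{finite,linorder}) ratfun" where
  "var i = Fraction_Field.Fract (Poly_Mapping.single (Poly_Mapping.single i 1) 1) 1"

definition first_ix :: "'n::{finite,linorder}" where
  "first_ix = Min UNIV"

definition last_ix :: "'n::{finite,linorder}" where
  "last_ix = Max UNIV"

definition next_ix :: "'n \<Rightarrow> 'n::{finite,linorder}" where
  "next_ix i = Min {j. i < j}"


section \<open>Lattices and reflections\<close>

text \<open>The pair \<open>(a, m)\<close> stands for $\sum_i a_i\varepsilon_i + m\,\frac12\delta$ in $Q$ and for
  $\sum_i a_i\varepsilon_i^\vee + m\,\frac12K$ in $Q^\vee$; the reflections and the simple (co)roots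
  are given by the same formulas in both lattices. The node $0$ is \<^const>\<open>None\<close>, the node
  $i \ge 1$ is \<^term>\<open>Some i\<close>.\<close>

type_synonym 'n lattice = "('n \<Rightarrow> int) \<times> int"

definition eps :: "'n \<Rightarrow> 'n \<Rightarrow> int" where
  "eps i = (\<lambda>j. if j = i then 1 else 0)"

definition refl_fin :: "'n::{finite,linorder} \<Rightarrow> ('n \<Rightarrow> int) \<Rightarrow> 'n \<Rightarrow> int" where
  "refl_fin i v =
    (if i = last_ix then v(i := - v i) else v(i := v (next_ix i), next_ix i := v i))"

fun refl :: "'n::{finite,linorder} option \<Rightarrow> 'n lattice \<Rightarrow> 'n lattice" where
  "refl None (a, m) = (a(first_ix := - a first_ix), m + 2 * a first_ix)"
| "refl (Some i) (a, m) = (refl_fin i a, m)"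

definition root_fin :: "'n::{finite,linorder} \<Rightarrow> 'n \<Rightarrow> int" where
  "root_fin i = (if i = last_ix then eps i else (\<lambda>j. eps i j - eps (next_ix i) j))"

fun simple_root :: "'n::{finite,linorder} option \<Rightarrow> 'n lattice" where
  "simple_root None = ((\<lambda>j. - eps first_ix j), 1)"
| "simple_root (Some i) = (root_fin i, 0)"

definition monom_at :: "K \<Rightarrow> 'n lattice \<Rightarrow> ('n::{finite,linorder}) ratfun" where
  "monom_at h \<mu> = const h powi snd \<mu> * (\<Prod>i\<in>UNIV. var i powi fst \<mu> i)"

definition Xmon :: "'n lattice \<Rightarrow> ('n::{finite,linorder}) ratfun" where
  "Xmon = monom_at (half Pq)"

definition Ymon :: "'n lattice \<Rightarrow> ('n::{finite,linorder}) ratfun" where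
  "Ymon = monom_at (inverse (half Pq))"

text \<open>Square roots of the parameters attached to the simple roots and coroots.\<close>

definition t_root :: "'n::{finite,linorder} option \<Rightarrow> K" where
  "t_root i = (if i = None then half Pt0 else if i = Some last_ix then half Ptn else half Pt)"

definition u_root :: "'n::{finite,linorder} option \<Rightarrow> K" where
  "u_root i = (if i = None then half Pu0 else if i = Some last_ix then half Pun else half Pt)"

definition t_coroot :: "'n::{finite,linorder} option \<Rightarrow> K" where
  "t_coroot i = (if i = None then half Pun else if i = Some last_ix then half Ptn else half Pt)"

definition u_coroot :: "'n::{finite,linorder} option \<Rightarrow> K" where
  "u_coroot i = (if i = None then half Pu0 else if i = Some last_ix then half Pt0 else half Pt)"

definition c_fun :: "K \<Rightarrow> K \<Rightarrow> 'n ratfun \<Rightarrow> ('n::{finite,linorder}) ratfun" where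
  "c_fun t u z =
    inverse (const t) * ((1 - const t * const u * z) * (1 + const t * inverse (const u) * z))
      / (1 - z\<^sup>2)"

definition cY :: "'n option \<Rightarrow> ('n::{finite,linorder}) ratfun" where
  "cY i = c_fun (t_coroot i) (u_coroot i) (Ymon (simple_root i))"

definition cXinv :: "'n option \<Rightarrow> ('n::{finite,linorder}) ratfun" where
  "cXinv i = c_fun (t_root i) (u_root i) (inverse (Xmon (simple_root i)))"


section \<open>The localized algebra\<close>

text \<open>The free \<^typ>\<open>K\<close>-algebra on a set of generators is the monoid algebra of the free
  monoid.\<close>

datatype 'a fmonoid = Word "'a list"

instantiation fmonoid :: (type) monoid_add
begin

definition zero_fmonoid :: "'a fmonoid" where
  "0 = Word []"

fun plus_fmonoid :: "'a fmonoid \<Rightarrow> 'a fmonoid \<Rightarrow> 'a fmonoid" where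
  "Word xs + Word ys = Word (xs @ ys)"

instance
proof
  fix a b c :: "'a fmonoid"
  show "a + b + c = a + (b + c)" by (cases a; cases b; cases c) simp
  show "0 + a = a" by (cases a) (simp add: zero_fmonoid_def)
  show "a + 0 = a" by (cases a) (simp add: zero_fmonoid_def)
qed

end

text \<open>\<open>GT i\<close> is $T_{\alpha_i}$ and \<open>GTv i\<close> is $T_{\alpha_i^\vee}$. The relations involve inverses of
  the $T_{\alpha_i^\vee}$; \<open>GTvinv i\<close> is adjoined as a two-sided inverse of \<open>GTv i\<close>. It adds
  nothing: $T_{\alpha_i^\vee}+t_{\alpha_i^\vee}^{-1/2}=(1+\eta_{s_i})c^Y_{\alpha_i^\vee}$ already
  makes $T_{\alpha_i^\vee}$ invertible.\<close>

datatype ('n::"{finite,linorder}") gen =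
    GX "'n ratfun"
  | GY "'n ratfun"
  | Gxi "'n option"
  | Geta "'n option"
  | GT "'n option"
  | GTv "'n option"
  | GTvinv "'n option"

type_synonym 'n free_alg = "'n gen fmonoid \<Rightarrow>\<^sub>0 K"

definition gen :: "'n gen \<Rightarrow> ('n::{finite,linorder}) free_alg" where
  "gen g = Poly_Mapping.single (Word [g]) 1"

definition scal :: "K \<Rightarrow> ('n::{finite,linorder}) free_alg" where
  "scal c = Poly_Mapping.single 0 c"

text \<open>Coxeter matrix of the affine diagram of type $C_n$ for distinct nodes, with \<open>0\<close> for $\infty$
  (which occurs for $n=1$ only, where $s_0s_1$ has infinite order).\<close>

fun node_pos :: "'n::{finite,linorder} option \<Rightarrow> nat" where
  "node_pos None = 0"
| "node_pos (Some i) = card {..i}"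

definition coxeter :: "'n::{finite,linorder} option \<Rightarrow> 'n option \<Rightarrow> nat" where
  "coxeter i j =
    (if node_pos j = Suc (node_pos i) \<or> node_pos i = Suc (node_pos j)
     then if card (UNIV :: 'n set) = 1 then 0
          else if 0 \<in> {node_pos i, node_pos j} \<or> card (UNIV :: 'n set) \<in> {node_pos i, node_pos j} then 4
          else 3
     else 2)"

definition alternating :: "nat \<Rightarrow> 'a \<Rightarrow> 'a \<Rightarrow> 'a list" where
  "alternating m i j = map (\<lambda>k. if even k then i else j) [0..<m]"

text \<open>The word $1,\dots,n-1,n,n-1,\dots,1$.\<close>

definition eps1_word :: "'n::{finite,linorder} list" where
  "eps1_word = (let js = sorted_list_of_set UNIV in js @ tl (rev js))"

definition T_eps1 :: "('n::{finite,linorder}) free_alg" where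
  "T_eps1 = prod_list (map (\<lambda>j. gen (GTv (Some j))) eps1_word)"

definition T_eps1_inv :: "('n::{finite,linorder}) free_alg" where
  "T_eps1_inv = prod_list (map (\<lambda>j. gen (GTvinv (Some j))) (rev eps1_word))"

inductive hrel :: "('n::{finite,linorder}) free_alg \<Rightarrow> 'n free_alg \<Rightarrow> bool" where
  X_const: "hrel (gen (GX (const c))) (scal c)"
| X_add: "hrel (gen (GX (f + g))) (gen (GX f) + gen (GX g))"
| X_mult: "hrel (gen (GX (f * g))) (gen (GX f) * gen (GX g))"
| Y_const: "hrel (gen (GY (const c))) (scal c)"
| Y_add: "hrel (gen (GY (f + g))) (gen (GY f) + gen (GY g))"
| Y_mult: "hrel (gen (GY (f * g))) (gen (GY f) * gen (GY g))"
| xi_invol: "hrel (gen (Gxi i) * gen (Gxi i)) 1"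
| xi_braid: "i \<noteq> j \<Longrightarrow>
    hrel (prod_list (map (\<lambda>k. gen (Gxi k)) (alternating (coxeter i j) i j)))
         (prod_list (map (\<lambda>k. gen (Gxi k)) (alternating (coxeter i j) j i)))"
| eta_invol: "hrel (gen (Geta i) * gen (Geta i)) 1"
| eta_braid: "i \<noteq> j \<Longrightarrow>
    hrel (prod_list (map (\<lambda>k. gen (Geta k)) (alternating (coxeter i j) i j)))
         (prod_list (map (\<lambda>k. gen (Geta k)) (alternating (coxeter i j) j i)))"
| xi_X: "hrel (gen (Gxi i) * gen (GX (Xmon \<mu>))) (gen (GX (Xmon (refl i \<mu>))) * gen (Gxi i))"
| eta_Y: "hrel (gen (Geta i) * gen (GY (Ymon \<mu>))) (gen (GY (Ymon (refl i \<mu>))) * gen (Geta i))"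
| Tv_inv_right: "hrel (gen (GTv i) * gen (GTvinv i)) 1"
| Tv_inv_left: "hrel (gen (GTvinv i) * gen (GTv i)) 1"
| Tv_eta: "hrel (gen (GTv i) + scal (inverse (t_coroot i))) ((1 + gen (Geta i)) * gen (GY (cY i)))"
| T_xi: "hrel (gen (GT i) + scal (inverse (t_root i))) ((1 + gen (Gxi i)) * gen (GX (cXinv i)))"
| T_eq: "hrel (gen (GT (Some j))) (gen (GTv (Some j)))"
| Y_first: "hrel (gen (GY (var first_ix))) (gen (GT None) * T_eps1)"
| X_first: "hrel (gen (GX (var first_ix))) (gen (GTvinv None) * T_eps1_inv)"
| Y_next: "j \<noteq> last_ix \<Longrightarrow>
    hrel (gen (GY (var (next_ix j))))
         (gen (GTvinv (Some j)) * gen (GY (var j)) * gen (GTvinv (Some j)))"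
| X_next: "j \<noteq> last_ix \<Longrightarrow>
    hrel (gen (GX (var (next_ix j))))
         (gen (GTv (Some j)) * gen (GX (var j)) * gen (GTv (Some j)))"
| YX_first:
    "hrel (gen (GY (inverse (var first_ix))) * gen (GX (var first_ix)))
          (scal (half Pq * (half Pu0 - inverse (half Pu0))) * T_eps1_inv
           + scal ((half Pq)\<^sup>2) * T_eps1_inv * gen (GX (inverse (var first_ix)))
               * gen (GY (var first_ix)) * T_eps1_inv)"

inductive_set hideal :: "('n::{finite,linorder}) free_alg set" where
  rel: "hrel a b \<Longrightarrow> a - b \<in> hideal"
| zero: "0 \<in> hideal"
| add: "a \<in> hideal \<Longrightarrow> b \<in> hideal \<Longrightarrow> a + b \<in> hideal"
| mult_left: "a \<in> hideal \<Longrightarrow> c * a \<in> hideal"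
| mult_right: "a \<in> hideal \<Longrightarrow> a * c \<in> hideal"

lemma hideal_minus: "a \<in> hideal \<Longrightarrow> - a \<in> hideal"
  using hideal.mult_left[of a "-1"] by simp

definition hcong :: "('n::{finite,linorder}) free_alg \<Rightarrow> 'n free_alg \<Rightarrow> bool" where
  "hcong a b \<longleftrightarrow> a - b \<in> hideal"

lemma hcong_refl: "hcong a a"
  by (simp add: hcong_def hideal.zero)

lemma hcong_equivp: "equivp (hcong :: ('n::{finite,linorder}) free_alg \<Rightarrow> _)"
proof (rule equivpI)
  show "reflp (hcong :: 'n free_alg \<Rightarrow> _)" by (rule reflpI) (rule hcong_refl)
  show "symp (hcong :: 'n free_alg \<Rightarrow> _)"
  proof (rule sympI)
    fix a b :: "'n free_alg"
    assume "hcong a b"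
    then show "hcong b a" unfolding hcong_def by (metis hideal_minus minus_diff_eq)
  qed
  show "transp (hcong :: 'n free_alg \<Rightarrow> _)"
  proof (rule transpI)
    fix a b c :: "'n free_alg"
    assume "hcong a b" "hcong b c"
    then have "(a - b) + (b - c) \<in> hideal" unfolding hcong_def by (rule hideal.add)
    then show "hcong a c" by (simp add: hcong_def)
  qed
qed

lemma hcong_add: "hcong a b \<Longrightarrow> hcong c d \<Longrightarrow> hcong (a + c) (b + d)"
  using hideal.add[of "a - b" "c - d"] by (simp add: hcong_def add_diff_add)

lemma hcong_uminus: "hcong a b \<Longrightarrow> hcong (- a) (- b)"
  unfolding hcong_def by (metis hideal_minus minus_diff_minus)

lemma hcong_diff: "hcong a b \<Longrightarrow> hcong c d \<Longrightarrow> hcong (a - c) (b - d)"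
  using hcong_add[of a b "- c" "- d"] hcong_uminus[of c d] by simp

lemma hcong_mult:
  assumes "hcong a b" "hcong c d"
  shows "hcong (a * c) (b * d)"
proof -
  have "(a - b) * c + b * (c - d) \<in> hideal"
    using assms unfolding hcong_def by (intro hideal.add hideal.mult_left hideal.mult_right)
  moreover have "(a - b) * c + b * (c - d) = a * c - b * d"
    by (simp only: left_diff_distrib right_diff_distrib) simp
  ultimately show ?thesis by (simp only: hcong_def)
qed

quotient_type (overloaded) 'n Hloc = "('n::{finite,linorder}) free_alg" / hcong
  by (rule hcong_equivp)

text \<open>The class \<^class>\<open>ring_1\<close> would in addition demand a proof of $0\neq1$.\<close>

instantiation Hloc :: ("{finite,linorder}") "{ring, monoid_mult}"
begin

lift_definition zero_Hloc :: "'a Hloc" is 0 .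
lift_definition one_Hloc :: "'a Hloc" is 1 .
lift_definition plus_Hloc :: "'a Hloc \<Rightarrow> 'a Hloc \<Rightarrow> 'a Hloc" is "(+)"
  by (rule hcong_add)
lift_definition uminus_Hloc :: "'a Hloc \<Rightarrow> 'a Hloc" is uminus
  by (rule hcong_uminus)
lift_definition minus_Hloc :: "'a Hloc \<Rightarrow> 'a Hloc \<Rightarrow> 'a Hloc" is "(-)"
  by (rule hcong_diff)
lift_definition times_Hloc :: "'a Hloc \<Rightarrow> 'a Hloc \<Rightarrow> 'a Hloc" is "(*)"
  by (rule hcong_mult)

instance
proof
  fix a b c :: "'a Hloc"
  show "a + b + c = a + (b + c)" by transfer (simp only: add.assoc hcong_refl)
  show "a + b = b + a" by transfer (simp only: add.commute hcong_refl)
  show "0 + a = a" by transfer (simp add: hcong_refl)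
  show "- a + a = 0" by transfer (simp add: hcong_refl)
  show "a - b = a + - b" by transfer (simp add: hcong_refl)
  show "a * b * c = a * (b * c)" by transfer (simp only: mult.assoc hcong_refl)
  show "(a + b) * c = a * c + b * c" by transfer (simp only: distrib_right hcong_refl)
  show "a * (b + c) = a * b + a * c" by transfer (simp only: distrib_left hcong_refl)
  show "1 * a = a" by transfer (simp add: hcong_refl)
  show "a * 1 = a" by transfer (simp add: hcong_refl)
qed

end

lift_definition ofK :: "K \<Rightarrow> ('n::{finite,linorder}) Hloc" is scal .
lift_definition of_gen :: "'n gen \<Rightarrow> ('n::{finite,linorder}) Hloc" is gen .

definition ofY :: "'n ratfun \<Rightarrow> ('n::{finite,linorder}) Hloc" where
  "ofY f = of_gen (GY f)"


section \<open>The finite Weyl group\<close>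

text \<open>$W_{\mathrm{fin}}$ is realized through its faithful action on $\mathbb Z^n$; on $Q$ and
  $Q^\vee$ it acts by $w(a,m)=(wa,m)$. Since the generators are involutions, every element is given
  by a word in them.\<close>

definition word_act :: "('n::{finite,linorder}) list \<Rightarrow> ('n \<Rightarrow> int) \<Rightarrow> 'n \<Rightarrow> int" where
  "word_act ws = foldr (\<lambda>i f. refl_fin i \<circ> f) ws id"

definition Wfin :: "(('n::{finite,linorder} \<Rightarrow> int) \<Rightarrow> 'n \<Rightarrow> int) set" where
  "Wfin = range word_act"

text \<open>A chosen reduced word; none of the quantities defined from it below depends on the
  choice.\<close>

definition rword :: "(('n::{finite,linorder} \<Rightarrow> int) \<Rightarrow> 'n \<Rightarrow> int) \<Rightarrow> 'n list" where
  "rword w = arg_min length (\<lambda>ws. word_act ws = w)"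

definition len :: "(('n::{finite,linorder} \<Rightarrow> int) \<Rightarrow> 'n \<Rightarrow> int) \<Rightarrow> nat" where
  "len w = length (rword w)"

definition len_s :: "(('n::{finite,linorder} \<Rightarrow> int) \<Rightarrow> 'n \<Rightarrow> int) \<Rightarrow> nat" where
  "len_s w = length (filter (\<lambda>i. i \<noteq> last_ix) (rword w))"

definition len_d :: "(('n::{finite,linorder} \<Rightarrow> int) \<Rightarrow> 'n \<Rightarrow> int) \<Rightarrow> nat" where
  "len_d w = length (filter (\<lambda>i. i = last_ix) (rword w))"

definition longest ::
    "(('n::{finite,linorder} \<Rightarrow> int) \<Rightarrow> 'n \<Rightarrow> int) set \<Rightarrow> ('n \<Rightarrow> int) \<Rightarrow> 'n \<Rightarrow> int" where
  "longest S = arg_max_on len S"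

text \<open>\<open>Wstab \<nu>\<close> is $W_\nu$, \<open>Wmin \<nu>\<close> is $W^\nu$, and \<open>vmax \<nu>\<close> is $v_\nu$.\<close>

definition Wstab ::
    "('n::{finite,linorder} \<Rightarrow> int) \<Rightarrow> (('n \<Rightarrow> int) \<Rightarrow> 'n \<Rightarrow> int) set" where
  "Wstab \<nu> = {w \<in> Wfin. w \<nu> = \<nu>}"

definition Wmin ::
    "('n::{finite,linorder} \<Rightarrow> int) \<Rightarrow> (('n \<Rightarrow> int) \<Rightarrow> 'n \<Rightarrow> int) set" where
  "Wmin \<nu> = {w \<in> Wfin. \<forall>u \<in> Wstab \<nu>. len w \<le> len (w \<circ> u)}"

definition vmax :: "('n::{finite,linorder} \<Rightarrow> int) \<Rightarrow> ('n \<Rightarrow> int) \<Rightarrow> 'n \<Rightarrow> int" where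
  "vmax \<nu> = longest (Wmin \<nu>)"


section \<open>Hecke symmetrizers\<close>

definition T_w :: "(('n::{finite,linorder} \<Rightarrow> int) \<Rightarrow> 'n \<Rightarrow> int) \<Rightarrow> 'n Hloc" where
  "T_w w = prod_list (map (\<lambda>i. of_gen (GT (Some i))) (rword w))"

definition eta_w :: "(('n::{finite,linorder} \<Rightarrow> int) \<Rightarrow> 'n \<Rightarrow> int) \<Rightarrow> 'n Hloc" where
  "eta_w w = prod_list (map (\<lambda>i. of_gen (Geta (Some i))) (rword w))"

text \<open>The first component of a character name refers to the $T_i$ with $i<n$, the second to
  $T_n$: $+$, $\pm$, $\mp$, $-$ are \<open>PP\<close>, \<open>PM\<close>, \<open>MP\<close>, \<open>MM\<close>.\<close>

datatype character = PP | PM | MP | MM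

definition chi :: "character \<Rightarrow> 'n::{finite,linorder} \<Rightarrow> K" where
  "chi \<Xi> i =
    (if i = last_ix then if \<Xi> \<in> {PP, MP} then half Ptn else - inverse (half Ptn)
     else if \<Xi> \<in> {PP, PM} then half Pt else - inverse (half Pt))"

text \<open>\<open>chi_T \<Xi> w\<close> is $\chi^\Xi(T_w)$.\<close>

definition chi_T :: "character \<Rightarrow> (('n::{finite,linorder} \<Rightarrow> int) \<Rightarrow> 'n \<Rightarrow> int) \<Rightarrow> K" where
  "chi_T \<Xi> w = prod_list (map (chi \<Xi>) (rword w))"

definition symmetrizer ::
    "character \<Rightarrow> (('n::{finite,linorder} \<Rightarrow> int) \<Rightarrow> 'n \<Rightarrow> int) set \<Rightarrow> 'n Hloc" where
  "symmetrizer \<Xi> G =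
    ofK (inverse (chi_T \<Xi> (longest G))) * (\<Sum>w\<in>G. ofK (chi_T \<Xi> w) * T_w w)"

definition hecke_sym :: "character \<Rightarrow> ('n::{finite,linorder}) Hloc" where
  "hecke_sym \<Xi> = symmetrizer \<Xi> Wfin"

definition hecke_sym_stab :: "('n::{finite,linorder} \<Rightarrow> int) \<Rightarrow> 'n Hloc" where
  "hecke_sym_stab \<nu> = symmetrizer PP (Wstab \<nu>)"


section \<open>The kappa functions\<close>

text \<open>With \<open>rword w\<close> = $(i_1,\dots,i_\ell)$, the $k$-th element (counting from $0$) is
  $s_{i_\ell}\cdots s_{i_{k+2}}\alpha_{i_{k+1}}^\vee$.\<close>

definition Inv :: "(('n::{finite,linorder} \<Rightarrow> int) \<Rightarrow> 'n \<Rightarrow> int) \<Rightarrow> ('n \<Rightarrow> int) set" where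
  "Inv w = {word_act (rev (drop (Suc k) (rword w))) (root_fin (rword w ! k)) | k.
              k < length (rword w)}"

definition coroots_d :: "('n::{finite,linorder} \<Rightarrow> int) set" where
  "coroots_d = range eps"

definition coroots_s :: "('n::{finite,linorder} \<Rightarrow> int) set" where
  "coroots_s = {(\<lambda>k. eps i k + eps j k) | i j. i < j} \<union> {(\<lambda>k. eps i k - eps j k) | i j. i < j}"

definition kappa_fun :: "('n \<Rightarrow> int) \<Rightarrow> 'n ratfun \<Rightarrow> ('n::{finite,linorder}) ratfun" where
  "kappa_fun \<beta> z =
    (if \<beta> \<in> coroots_d
     then (1 - const (half Ptn * half Pt0) * z) * (1 + const (half Ptn * inverse (half Pt0)) * z)
            / (1 - z\<^sup>2)
     else (1 - const ((half Pt)\<^sup>2) * z) / (1 - z))"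

definition kappaY :: "('n \<Rightarrow> int) \<Rightarrow> ('n::{finite,linorder}) ratfun" where
  "kappaY \<beta> = kappa_fun \<beta> (Ymon (\<beta>, 0))"

definition kappaYinv :: "('n \<Rightarrow> int) \<Rightarrow> ('n::{finite,linorder}) ratfun" where
  "kappaYinv \<beta> = kappa_fun \<beta> (inverse (Ymon (\<beta>, 0)))"

definition kappaY_w ::
    "(('n::{finite,linorder} \<Rightarrow> int) \<Rightarrow> 'n \<Rightarrow> int) \<Rightarrow> 'n ratfun" where
  "kappaY_w w = (\<Prod>\<beta>\<in>Inv w. kappaY \<beta>)"

definition kappa_char ::
    "character \<Rightarrow> (('n::{finite,linorder} \<Rightarrow> int) \<Rightarrow> 'n \<Rightarrow> int) \<Rightarrow> 'n ratfun" where
  "kappa_char \<Xi> w =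
    (\<Prod>\<beta>\<in>Inv w \<inter> coroots_s. if \<Xi> \<in> {PP, PM} then kappaY \<beta> else kappaYinv \<beta>) *
    (\<Prod>\<beta>\<in>Inv w \<inter> coroots_d. if \<Xi> \<in> {PP, MP} then kappaY \<beta> else kappaYinv \<beta>)"


section \<open>The shifts of the dominant weight\<close>

definition rho :: "'n::{finite,linorder} \<Rightarrow> int" where
  "rho i = int (card {i..})"

definition omega :: "'n::{finite,linorder} \<Rightarrow> int" where
  "omega i = 1"

definition pi_vec :: "'n::{finite,linorder} \<Rightarrow> int" where
  "pi_vec i = int (card {i<..})"

text \<open>In the expansions of the symmetrizers, the coefficient attached to $z\in W^\nu$ is
  $\kappa^\Xi_{v_\nu z^{-1}}\,\eta_z\,\kappa^Y_z$, and not $\kappa^\Xi_{v_\nu z}\,\eta_z\,\kappa^Y_z$: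
  moving $\eta_z$ to the left turns $\beta\in\mathrm{Inv}(v_\nu z^{-1})$ into $z^{-1}\beta$, and
  these are exactly the positive coroots outside the root system of $W_\nu$ that $z$ keeps positive.
  The terms for \<open>PM\<close> and \<open>MM\<close> moreover carry the overall signs $(-1)^{\ell_d(w_0)}$ and
  $(-1)^{\ell(w_0)}$: as the symmetrizers are normalized so that $T_{w_0}$ has coefficient $1$,
  $\eta_{w_0}$ occurs in them with coefficient $+\kappa^Y_{w_0}$ up to the factor
  $\chi^+(T_{w_0})^{-1}$. For $n=1$ and \<open>PM\<close> the identity reads
  $t_n^{1/2}T_1-t_n=-(\kappa^{Y^{-1}}_{\varepsilon_1^\vee}-\eta_{s_1}\kappa^Y_{\varepsilon_1^\vee})$.
  For \<open>MP\<close> the sign $(-1)^{\ell_s(w_0)}=(-1)^{n(n-1)}$ is $1$.\<close>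

end

(* Left multiplication by T_i becomes an explicit operator once an element of the smash product of
   K(Y) and the Weyl group is written as sum_w eta_w f(w^-1). In these coordinates a symmetrizer is a
   common eigenvector of the operators. Its equation for T_i relates its values at w and s_i w, so the
   eigenvector is determined up to a scalar, and the coefficient of eta_{w_0} fixes the scalar. This gives,
   for the full group, the formula K_- (sum_w sgn(w) eta_w) K_+ up to the sign of w_0, where K_- is the
   product of the kappa_{-beta} over the positive coroots on which the character is of minus type and
   K_+ the product of the kappa_beta over the others; for the stabilizer of nu it gives
   (sum_u eta_u) times the product of its kappa_beta. Splitting the first sum along the cosets of the
   stabilizer and moving the kappa factors through eta_z yields the claim, because all coroots of the
   stabilizer are of plus type. The braid relations of the T_i are needed for the T_w to be well
   defined; they are reduced to two identities between kappa functions of a rank two root system. *)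

theory Submission
  imports Defs "HOL-Combinatorics.Transposition"
begin

section \<open>Signed permutations and the root system\<close>

text \<open>\<open>Hloc\<close> is given by generators and relations, and no linear independence of
  the eta_w over K(Y) is at hand in it. Every comparison of coefficients is therefore made for
  functions on the Weyl group with values in a field, and only the results are carried over by the
  additive map \<open>realize\<close>; nothing is read back from the algebra. Working with t_i^(1/2)
  T_i instead of T_i clears the half powers from the eigenvalues, which become t_i and -1; adding 1
  to it gives the product (1 + eta_i) kap(alpha_i). Since kap(beta) + kap(-beta) = 1 + t_beta, the
  eigenvalue t_i forces f(v s_i) = f(v) on an eigenfunction f, while the eigenvalue -1 forces kap(v
  alpha_i) f(v) + kap(-v alpha_i) f(v s_i) = 0. A sign times the product of the kap(-v beta) over
  the positive coroots of minus type solves both, because s_i permutes these coroots apart from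
  alpha_i. The full group is the stabilizer of the weight 0, so one argument covers both kinds of
  symmetrizers.\<close>

lemma le_last_ix: "i \<le> (last_ix :: 'n::{finite,linorder})"
  by (simp add: last_ix_def)

lemma next_ix_props:
  fixes i :: "'n::{finite,linorder}"
  assumes "i \<noteq> last_ix"
  shows less_next_ix: "i < next_ix i" and next_ix_le: "i < j \<Longrightarrow> next_ix i \<le> j"
proof -
  have "i < last_ix" using assms le_last_ix[of i] by simp
  then have ne: "{j. i < j} \<noteq> {}" by blast
  have "Min {j. i < j} \<in> {j. i < j}" by (rule Min_in[OF finite ne])
  then show "i < next_ix i" by (simp add: next_ix_def)
  show "i < j \<Longrightarrow> next_ix i \<le> j" by (simp add: next_ix_def)
qed

lemma next_ix_neq: "i \<noteq> last_ix \<Longrightarrow> next_ix i \<noteq> i"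
  using less_next_ix[of i] by simp

lemma less_next_ix_iff: "i \<noteq> last_ix \<Longrightarrow> j < next_ix i \<longleftrightarrow> j \<le> i"
  using less_next_ix[of i] next_ix_le[of i j] by (meson leD le_less_trans not_le)

lemma next_ix_inj:
  assumes "i \<noteq> last_ix" "j \<noteq> last_ix" "next_ix i = next_ix j"
  shows "i = j"
  using less_next_ix_iff[OF assms(1), of j] less_next_ix_iff[OF assms(2), of i]
    less_next_ix[OF assms(1)] less_next_ix[OF assms(2)] assms(3) by simp

text \<open>Coordinates for the elements of \<open>Wfin\<close>: finiteness, linearity and
  invariance of the scalar product are read off from them.\<close>

definition signed_perm :: "(('n \<Rightarrow> int) \<Rightarrow> 'n \<Rightarrow> int) \<Rightarrow> bool" where
  "signed_perm w \<longleftrightarrow>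
    (\<exists>\<sigma> \<pi>. (\<forall>j. \<sigma> j = 1 \<or> \<sigma> j = - 1) \<and> bij \<pi> \<and> w = (\<lambda>v j. \<sigma> j * v (\<pi> j)))"

lemma refl_fin_refl_fin [simp]: "refl_fin i (refl_fin i v) = v"
  by (auto simp: refl_fin_def fun_eq_iff next_ix_neq)

lemma refl_fin_comp_refl_fin [simp]: "refl_fin i \<circ> refl_fin i = id"
  by (auto simp: fun_eq_iff)

lemma refl_fin_last: "refl_fin last_ix v = v(last_ix := - v last_ix)"
  by (simp add: refl_fin_def)

lemma refl_fin_transpose:
  "i \<noteq> last_ix \<Longrightarrow> refl_fin i v = v \<circ> transpose i (next_ix i)"
  by (auto simp: refl_fin_def fun_eq_iff transpose_def)

lemma signed_perm_id: "signed_perm id"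
  unfolding signed_perm_def
  by (rule exI[of _ "\<lambda>_. 1"], rule exI[of _ id]) auto

lemma signed_perm_refl_fin: "signed_perm (refl_fin i)"
proof (cases "i = last_ix")
  case True
  show ?thesis unfolding signed_perm_def
    by (rule exI[of _ "\<lambda>j. if j = last_ix then - 1 else 1"], rule exI[of _ id])
      (auto simp: True refl_fin_last fun_eq_iff)
next
  case False
  show ?thesis unfolding signed_perm_def
    by (rule exI[of _ "\<lambda>_. 1"], rule exI[of _ "transpose i (next_ix i)"])
      (auto simp: refl_fin_transpose[OF False] fun_eq_iff)
qed

lemma signed_perm_comp: "signed_perm w \<Longrightarrow> signed_perm u \<Longrightarrow> signed_perm (w \<circ> u)"
  unfolding signed_perm_def
proof (elim exE conjE)
  fix \<sigma> \<pi> \<sigma>' \<pi>'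
  assume *: "\<forall>j. \<sigma> j = 1 \<or> \<sigma> j = - 1" "bij \<pi>" "w = (\<lambda>v j. \<sigma> j * v (\<pi> j))"
    "\<forall>j. \<sigma>' j = 1 \<or> \<sigma>' j = - 1" "bij \<pi>'" "u = (\<lambda>v j. \<sigma>' j * v (\<pi>' j))"
  have "\<sigma> j * \<sigma>' (\<pi> j) = 1 \<or> \<sigma> j * \<sigma>' (\<pi> j) = - 1" for j
    using *(1)[rule_format, of j] *(4)[rule_format, of "\<pi> j"] by auto
  moreover have "bij (\<pi>' \<circ> \<pi>)" using * by (simp add: bij_comp)
  ultimately show "\<exists>\<sigma> \<pi>. (\<forall>j. \<sigma> j = 1 \<or> \<sigma> j = - 1) \<and> bij \<pi> \<and> w \<circ> u = (\<lambda>v j. \<sigma> j * v (\<pi> j))"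
    by (intro exI[of _ "\<lambda>j. \<sigma> j * \<sigma>' (\<pi> j)"] exI[of _ "\<pi>' \<circ> \<pi>"]) (simp add: * fun_eq_iff mult.assoc)
qed

lemma word_act_Nil [simp]: "word_act [] = id"
  by (simp add: word_act_def)

lemma word_act_Cons [simp]: "word_act (i # ws) = refl_fin i \<circ> word_act ws"
  by (simp add: word_act_def)

lemma word_act_append [simp]: "word_act (ws @ vs) = word_act ws \<circ> word_act vs"
  by (induction ws) auto

lemma word_act_rev_left [simp]: "word_act (rev ws) \<circ> word_act ws = id"
proof (induction ws)
  case (Cons i ws)
  have "word_act (rev (i # ws)) \<circ> word_act (i # ws) =
    word_act (rev ws) \<circ> (refl_fin i \<circ> refl_fin i) \<circ> word_act ws"
    by (simp add: comp_assoc del: refl_fin_comp_refl_fin)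
  then show ?case using Cons by (simp only: refl_fin_comp_refl_fin comp_id)
qed simp

lemma word_act_rev_right [simp]: "word_act ws \<circ> word_act (rev ws) = id"
  using word_act_rev_left[of "rev ws"] by simp

lemma signed_perm_word_act: "signed_perm (word_act ws)"
  by (induction ws)
    (simp_all only: word_act_Nil word_act_Cons signed_perm_id signed_perm_comp signed_perm_refl_fin)

lemma Wfin_signed_perm: "w \<in> Wfin \<Longrightarrow> signed_perm w"
  by (auto simp: Wfin_def signed_perm_word_act)

lemma id_Wfin [simp]: "id \<in> Wfin"
  unfolding Wfin_def by (metis rangeI word_act_Nil)

lemma refl_fin_Wfin [simp]: "refl_fin i \<in> Wfin"
  unfolding Wfin_def by (metis comp_id rangeI word_act_Cons word_act_Nil)

lemma comp_Wfin [simp, intro]: "w \<in> Wfin \<Longrightarrow> u \<in> Wfin \<Longrightarrow> w \<circ> u \<in> Wfin"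
  unfolding Wfin_def by (auto simp flip: word_act_append)

lemma inv_word_act: "inv (word_act ws) = word_act (rev ws)"
  by (rule inv_unique_comp) auto

lemma inv_Wfin [simp, intro]: "w \<in> Wfin \<Longrightarrow> inv w \<in> Wfin"
  unfolding Wfin_def by (auto simp: inv_word_act)

lemma bij_Wfin: "w \<in> Wfin \<Longrightarrow> bij w"
  unfolding Wfin_def by (metis imageE o_bij word_act_rev_left word_act_rev_right)

lemma inv_comp_Wfin [simp]: "w \<in> Wfin \<Longrightarrow> inv w \<circ> w = id" "w \<in> Wfin \<Longrightarrow> w \<circ> inv w = id"
  using bij_Wfin[of w] by (auto simp: bij_def surj_iff)

lemma inv_apply_Wfin [simp]: "w \<in> Wfin \<Longrightarrow> inv w (w v) = v" "w \<in> Wfin \<Longrightarrow> w (inv w v) = v"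
  using bij_Wfin[of w] by (auto simp: bij_def surj_f_inv_f)

lemma inv_inv_Wfin [simp]: "w \<in> Wfin \<Longrightarrow> inv (inv w) = w"
  by (simp add: bij_Wfin inv_inv_eq)

lemma inv_comp_distrib_Wfin: "w \<in> Wfin \<Longrightarrow> u \<in> Wfin \<Longrightarrow> inv (w \<circ> u) = inv u \<circ> inv w"
  by (simp add: bij_Wfin o_inv_distrib)

lemma inv_refl_fin [simp]: "inv (refl_fin i) = refl_fin i"
  by (rule inv_unique_comp) auto

lemma finite_Wfin [simp]: "finite (Wfin :: (('n::{finite,linorder} \<Rightarrow> int) \<Rightarrow> 'n \<Rightarrow> int) set)"
proof (rule finite_subset)
  show "(Wfin :: (('n \<Rightarrow> int) \<Rightarrow> 'n \<Rightarrow> int) set) \<subseteq>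
    (\<lambda>(\<sigma>, \<pi>) v j. \<sigma> j * v (\<pi> j)) ` ({\<sigma>. range \<sigma> \<subseteq> {1, - 1}} \<times> UNIV)"
  proof
    fix w :: "('n \<Rightarrow> int) \<Rightarrow> 'n \<Rightarrow> int"
    assume "w \<in> Wfin"
    then obtain \<sigma> \<pi> where *: "\<forall>j. \<sigma> j = 1 \<or> \<sigma> j = - 1" "w = (\<lambda>v j. \<sigma> j * v (\<pi> j))"
      using Wfin_signed_perm[of w] by (auto simp: signed_perm_def)
    then have "range \<sigma> \<subseteq> {1, - 1}" by auto
    then show "w \<in> (\<lambda>(\<sigma>, \<pi>) v j. \<sigma> j * v (\<pi> j)) ` ({\<sigma>. range \<sigma> \<subseteq> {1, - 1}} \<times> UNIV)"
      using *(2) by (intro image_eqI[of _ _ "(\<sigma>, \<pi>)"]) auto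
  qed
  have "finite {\<sigma> :: 'n \<Rightarrow> int. range \<sigma> \<subseteq> {1, - 1}}"
    using finite_set_of_finite_funs[of "UNIV :: 'n set" "{1, - 1 :: int}" 0]
    by (simp add: image_subset_iff)
  then show "finite ((\<lambda>(\<sigma>, \<pi>) (v :: 'n \<Rightarrow> int) (j :: 'n). \<sigma> j * v (\<pi> j)) `
      ({\<sigma> :: 'n \<Rightarrow> int. range \<sigma> \<subseteq> {1, - 1}} \<times> (UNIV :: ('n \<Rightarrow> 'n) set)))"
    by simp
qed

lemma Wfin_linear:
  assumes "w \<in> Wfin"
  shows Wfin_add: "w (\<lambda>j. a j + b j) = (\<lambda>j. w a j + w b j)"
    and Wfin_diff: "w (\<lambda>j. a j - b j) = (\<lambda>j. w a j - w b j)"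
    and Wfin_uminus: "w (- a) = - w a"
  using Wfin_signed_perm[OF assms] by (auto simp: signed_perm_def algebra_simps fun_eq_iff)

lemma refl_fin_uminus: "refl_fin i (- a) = - refl_fin i a"
  by (rule Wfin_uminus) simp

section \<open>The invariant scalar product\<close>

definition pairing :: "('n::{finite,linorder} \<Rightarrow> int) \<Rightarrow> ('n \<Rightarrow> int) \<Rightarrow> int" where
  "pairing a b = (\<Sum>j\<in>UNIV. a j * b j)"

lemma pairing_linear:
  "pairing a (\<lambda>j. b j + c j) = pairing a b + pairing a c"
  "pairing a (\<lambda>j. b j - c j) = pairing a b - pairing a c"
  "pairing a (- b) = - pairing a b"
  by (simp_all add: pairing_def algebra_simps sum.distrib sum_subtractf sum_negf)

lemma pairing_eps: "pairing a (eps i) = a i"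
  by (simp add: pairing_def eps_def if_distrib cong: if_cong)

lemma pairing_Wfin: "w \<in> Wfin \<Longrightarrow> pairing (w a) (w b) = pairing a b"
proof -
  assume "w \<in> Wfin"
  then obtain \<sigma> \<pi> where *: "\<forall>j. \<sigma> j = 1 \<or> \<sigma> j = - 1" "bij \<pi>" "w = (\<lambda>v j. \<sigma> j * v (\<pi> j))"
    using Wfin_signed_perm[of w] by (auto simp: signed_perm_def)
  have "(\<sigma> j * x) * (\<sigma> j * y) = x * y" for j x y using *(1)[rule_format, of j] by auto
  then have "pairing (w a) (w b) = (\<Sum>j\<in>UNIV. a (\<pi> j) * b (\<pi> j))"
    unfolding pairing_def *(3) by (intro sum.cong refl) simp
  also have "\<dots> = pairing a b"
    unfolding pairing_def by (rule sum.reindex_bij_betw[OF *(2)])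
  finally show ?thesis .
qed

lemma pairing_root_fin:
  "pairing a (root_fin i) = (if i = last_ix then a i else a i - a (next_ix i))"
  by (simp add: root_fin_def pairing_linear pairing_eps)

text \<open>Makes membership of a simple reflection in the stabilizer of a weight an orthogonality
  condition.\<close>

lemma refl_fin_fix_iff: "refl_fin i a = a \<longleftrightarrow> pairing a (root_fin i) = 0"
proof (cases "i = last_ix")
  case True
  then show ?thesis by (simp add: refl_fin_last fun_upd_idem_iff pairing_root_fin)
next
  case False
  have "refl_fin i a = a \<longleftrightarrow> a i = a (next_ix i)"
  proof
    assume "refl_fin i a = a"
    from fun_cong[OF this, of i] show "a i = a (next_ix i)"
      using False next_ix_neq[OF False] by (simp add: refl_fin_def)
  next
    assume "a i = a (next_ix i)"
    then show "refl_fin i a = a"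
      by (auto simp: refl_fin_transpose[OF False] fun_eq_iff transpose_def)
  qed
  then show ?thesis using False by (simp add: pairing_root_fin)
qed

section \<open>The coroots as a root system of type B, positivity and height\<close>

definition pos_roots :: "('n::{finite,linorder} \<Rightarrow> int) set" where
  "pos_roots = coroots_d \<union> coroots_s"

definition all_roots :: "('n::{finite,linorder} \<Rightarrow> int) set" where
  "all_roots = {\<beta>. \<beta> \<in> pos_roots \<or> - \<beta> \<in> pos_roots}"

lemma pos_roots_cases:
  assumes "\<beta> \<in> pos_roots"
  obtains a where "\<beta> = eps a"
  | a b where "a < b" "\<beta> = (\<lambda>k. eps a k + eps b k)"
  | a b where "a < b" "\<beta> = (\<lambda>k. eps a k - eps b k)"
  using assms unfolding pos_roots_def coroots_d_def coroots_s_def by blast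

lemma pos_rootsI [intro, simp]:
  "eps a \<in> pos_roots"
  "a < b \<Longrightarrow> (\<lambda>k. eps a k + eps b k) \<in> pos_roots"
  "a < b \<Longrightarrow> (\<lambda>k. eps a k - eps b k) \<in> pos_roots"
  unfolding pos_roots_def coroots_d_def coroots_s_def by blast+

lemma pos_rootsI': "a \<noteq> b \<Longrightarrow> (\<lambda>k. eps a k + eps b k) \<in> pos_roots"
  using pos_rootsI(2)[of a b] pos_rootsI(2)[of b a] by (cases a b rule: linorder_cases) (auto simp: add.commute)

lemma root_fin_pos [simp, intro]: "root_fin i \<in> pos_roots"
  by (simp add: root_fin_def less_next_ix)

lemma finite_pos_roots [simp]: "finite (pos_roots :: ('n::{finite,linorder} \<Rightarrow> int) set)"
proof -
  have "(pos_roots :: ('n \<Rightarrow> int) set) \<subseteq> range eps \<union> (\<lambda>(a, b) k. eps a k + eps b k) ` UNIV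
    \<union> (\<lambda>(a, b) k. eps a k - eps b k) ` UNIV"
    unfolding pos_roots_def coroots_d_def coroots_s_def by auto
  then show ?thesis by (rule finite_subset) simp
qed

text \<open>\<open>rho\<close> pairs to 1 with every simple root, so this is the usual height. Being
  linear, it turns the positivity of a root into the sign of a linear functional.\<close>

definition height :: "('n::{finite,linorder} \<Rightarrow> int) \<Rightarrow> int" where
  "height = pairing rho"

lemma rho_pos: "rho (i :: 'n::{finite,linorder}) > 0"
  by (auto simp: rho_def card_gt_0_iff)

lemma rho_less: "i < j \<Longrightarrow> rho j < rho (i :: 'n::{finite,linorder})"
  unfolding rho_def by (auto intro!: psubset_card_mono)

lemma height_pos: "\<beta> \<in> pos_roots \<Longrightarrow> height \<beta> > 0"
  by (erule pos_roots_cases) (simp_all add: height_def pairing_linear pairing_eps rho_pos rho_less add_pos_pos)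

lemma pos_roots_iff_height: "\<beta> \<in> all_roots \<Longrightarrow> \<beta> \<in> pos_roots \<longleftrightarrow> height \<beta> > 0"
  using height_pos[of \<beta>] height_pos[of "- \<beta>"] by (auto simp: all_roots_def height_def pairing_linear)

lemma uminus_pos_roots_iff: "\<beta> \<in> all_roots \<Longrightarrow> - \<beta> \<in> pos_roots \<longleftrightarrow> \<beta> \<notin> pos_roots"
  using height_pos[of \<beta>] height_pos[of "- \<beta>"] by (auto simp: all_roots_def height_def pairing_linear)

lemma uminus_pos_roots_D: "\<beta> \<in> pos_roots \<Longrightarrow> - \<beta> \<notin> pos_roots"
  using height_pos[of \<beta>] height_pos[of "- \<beta>"] by (auto simp: height_def pairing_linear)

lemma pos_all_roots [simp]: "\<beta> \<in> pos_roots \<Longrightarrow> \<beta> \<in> all_roots"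
  by (simp add: all_roots_def)

lemma uminus_uminus_fun [simp]: "- (- (\<beta> :: 'n \<Rightarrow> int)) = \<beta>"
  by (simp add: fun_eq_iff)

lemma uminus_all_roots [simp]: "- \<beta> \<in> all_roots \<longleftrightarrow> \<beta> \<in> all_roots"
  by (auto simp: all_roots_def)

text \<open>Takes the place of the expansion in simple roots with nonnegative coefficients. Every
  positive root that is not simple becomes a positive root of smaller height after subtraction of a
  suitable simple root; the cases move one index to its successor, or drop the index n.\<close>

lemma pos_roots_induct [consumes 1, case_names simple step]:
  fixes \<beta> :: "'n::{finite,linorder} \<Rightarrow> int"
  assumes "\<beta> \<in> pos_roots"
    and simple: "\<And>i. P (root_fin i)"
    and step: "\<And>\<beta> i. \<beta> \<in> pos_roots \<Longrightarrow> P \<beta> \<Longrightarrow> (\<lambda>k. \<beta> k + root_fin i k) \<in> pos_roots \<Longrightarrow>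
      P (\<lambda>k. \<beta> k + root_fin i k)"
  shows "P \<beta>"
  using assms(1)
proof (induction "nat (height \<beta>)" arbitrary: \<beta> rule: less_induct)
  case less
  have *: "P \<beta>" if "\<beta>' \<in> pos_roots" "\<beta> = (\<lambda>k. \<beta>' k + root_fin i k)" for \<beta>' i
  proof -
    have "height \<beta> = height \<beta>' + height (root_fin i)"
      using that by (simp add: height_def pairing_linear)
    then have "nat (height \<beta>') < nat (height \<beta>)"
      using height_pos[OF that(1)] height_pos[OF root_fin_pos, of i] by simp
    then have "P \<beta>'" using less(1) that by blast
    then show ?thesis using step[OF that(1)] less(2) that(2) by simp
  qed
  show ?case
    using less(2)
  proof (cases rule: pos_roots_cases)
    case (1 a)
    show ?thesis
    proof (cases "a = last_ix")
      case True
      then show ?thesis using simple[of a] 1 by (simp add: root_fin_def)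
    next
      case False
      show ?thesis
        by (rule *[of "eps (next_ix a)" a]) (auto simp: 1 root_fin_def False)
    qed
  next
    case (2 a b)
    show ?thesis
    proof (cases "b = last_ix")
      case True
      show ?thesis by (rule *[of "eps a" b]) (auto simp: 2 root_fin_def True)
    next
      case False
      then show ?thesis
        by (intro *[of "\<lambda>k. eps a k + eps (next_ix b) k" b])
          (use less_next_ix[OF False] 2(1) in \<open>auto simp: 2(2) root_fin_def\<close>)
    qed
  next
    case (3 a b)
    have a: "a \<noteq> last_ix" using 3(1) le_last_ix[of b] by auto
    show ?thesis
    proof (cases "b = next_ix a")
      case True
      then show ?thesis using simple[of a] a by (simp add: 3 root_fin_def)
    next
      case False
      then have "next_ix a < b" using next_ix_le[OF a 3(1)] by simp
      then show ?thesis
        by (intro *[of "\<lambda>k. eps (next_ix a) k - eps b k" a]) (auto simp: 3(2) root_fin_def a)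
    qed
  qed
qed

lemma refl_fin_eps:
  "refl_fin i (eps a) = (if i = last_ix then if a = i then - eps a else eps a
     else eps (transpose i (next_ix i) a))"
  by (auto simp: refl_fin_def eps_def fun_eq_iff transpose_def next_ix_neq)

lemma refl_fin_root_fin: "refl_fin i (root_fin i) = - root_fin i"
  by (auto simp: refl_fin_def root_fin_def eps_def fun_eq_iff next_ix_neq)

lemma refl_fin_pos_roots:
  assumes "\<beta> \<in> pos_roots" "\<beta> \<noteq> root_fin i"
  shows "refl_fin i \<beta> \<in> pos_roots"
  using assms(1)
proof (cases rule: pos_roots_cases)
  case (1 a)
  then show ?thesis using assms(2) by (auto simp: refl_fin_eps root_fin_def)
next
  case (2 a b)
  have a: "a \<noteq> last_ix" using 2(1) le_last_ix[of b] by auto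
  have eq: "refl_fin i \<beta> = (\<lambda>k. refl_fin i (eps a) k + refl_fin i (eps b) k)"
    by (simp add: 2 Wfin_add)
  show ?thesis
  proof (cases "i = last_ix")
    case True
    then show ?thesis unfolding eq using 2(1) a by (auto simp: refl_fin_eps)
  next
    case False
    have "transpose i (next_ix i) a \<noteq> transpose i (next_ix i) b"
      using 2(1) by (metis less_irrefl transpose_involutory)
    then show ?thesis unfolding eq using False by (simp add: refl_fin_eps pos_rootsI')
  qed
next
  case (3 a b)
  have a: "a \<noteq> last_ix" using 3(1) le_last_ix[of b] by auto
  have eq: "refl_fin i \<beta> = (\<lambda>k. refl_fin i (eps a) k - refl_fin i (eps b) k)"
    by (simp add: 3 Wfin_diff)
  show ?thesis
  proof (cases "i = last_ix")
    case True
    then show ?thesis unfolding eq using 3(1) a by (auto simp: refl_fin_eps)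
  next
    case False
    \<comment> \<open>The exchange of two neighbouring indices can reverse a < b only if (a, b) is
      that pair, and this pair is the excluded simple root.\<close>
    have "\<not> (a = i \<and> b = next_ix i)" using assms(2) 3 False by (auto simp: root_fin_def)
    then have "transpose i (next_ix i) a < transpose i (next_ix i) b"
      using 3(1) next_ix_le[OF False, of b] next_ix_le[OF False, of a] less_next_ix[OF False]
        less_next_ix_iff[OF False, of a]
      unfolding transpose_def by force
    then show ?thesis using False by (auto simp: eq refl_fin_eps)
  qed
qed

lemma refl_fin_pos_roots_iff:
  assumes "\<beta> \<in> all_roots" "\<beta> \<noteq> root_fin i" "\<beta> \<noteq> - root_fin i"
  shows "refl_fin i \<beta> \<in> pos_roots \<longleftrightarrow> \<beta> \<in> pos_roots"
proof -
  have "- refl_fin i \<beta> = refl_fin i (- \<beta>)" by (simp only: refl_fin_uminus)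
  moreover have "- \<beta> \<noteq> root_fin i" using assms(3) uminus_uminus_fun by metis
  ultimately show ?thesis
    using refl_fin_pos_roots[of \<beta> i] refl_fin_pos_roots[of "- \<beta>" i] assms
      uminus_pos_roots_D[of "refl_fin i \<beta>"] uminus_pos_roots_iff[OF assms(1)] by argo
qed

lemma refl_fin_all_roots: "\<beta> \<in> all_roots \<Longrightarrow> refl_fin i \<beta> \<in> all_roots"
proof -
  have *: "refl_fin i \<beta> \<in> all_roots" if "\<beta> \<in> pos_roots" for \<beta>
    using refl_fin_pos_roots[OF that, of i] refl_fin_root_fin[of i]
    by (cases "\<beta> = root_fin i") (auto simp: uminus_all_roots)
  show "\<beta> \<in> all_roots \<Longrightarrow> refl_fin i \<beta> \<in> all_roots"
    using *[of \<beta>] *[of "- \<beta>"] unfolding refl_fin_uminus uminus_all_roots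
    by (auto simp: all_roots_def)
qed

lemma Wfin_induct [consumes 1, case_names id step]:
  assumes "w \<in> Wfin" "P id" "\<And>i w. w \<in> Wfin \<Longrightarrow> P w \<Longrightarrow> P (refl_fin i \<circ> w)"
  shows "P w"
proof -
  have "P (word_act ws)" for ws
    by (induction ws) (use assms in \<open>simp_all only: word_act_Nil word_act_Cons Wfin_def rangeI\<close>)
  then show ?thesis using assms(1) by (auto simp: Wfin_def)
qed

lemma Wfin_all_roots [simp, intro]: "w \<in> Wfin \<Longrightarrow> \<beta> \<in> all_roots \<Longrightarrow> w \<beta> \<in> all_roots"
  by (induction w rule: Wfin_induct) (auto intro: refl_fin_all_roots)

text \<open>\<open>coroots_d\<close> closed under sign: the type of a root then becomes invariant
  under the whole group, and on positive roots it still means \<open>coroots_d\<close>.\<close>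

definition short_root :: "('n::{finite,linorder} \<Rightarrow> int) \<Rightarrow> bool" where
  "short_root \<beta> \<longleftrightarrow> \<beta> \<in> coroots_d \<or> - \<beta> \<in> coroots_d"

lemma short_root_uminus [simp]: "short_root (- \<beta>) = short_root \<beta>"
  by (auto simp: short_root_def)

lemma short_root_refl_fin [simp]: "short_root (refl_fin i \<beta>) = short_root \<beta>"
proof -
  have eps: "short_root (refl_fin i (eps a))" for a
    by (auto simp: refl_fin_eps short_root_def coroots_d_def)
  have *: "short_root (refl_fin i \<beta>)" if sh: "short_root \<beta>" for \<beta>
  proof -
    consider a where "\<beta> = eps a" | a where "- \<beta> = eps a"
      using sh by (auto simp: short_root_def coroots_d_def)
    then show ?thesis
    proof cases
      case 1
      then show ?thesis using eps by simp
    next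
      case 2
      then have "refl_fin i \<beta> = - refl_fin i (eps a)"
        by (metis refl_fin_uminus uminus_uminus_fun)
      then show ?thesis using eps by simp
    qed
  qed
  show ?thesis using *[of \<beta>] *[of "refl_fin i \<beta>"] by auto
qed

lemma short_root_Wfin [simp]: "w \<in> Wfin \<Longrightarrow> short_root (w \<beta>) = short_root \<beta>"
  by (induction w rule: Wfin_induct) auto

lemma short_root_root_fin [simp]: "short_root (root_fin i) \<longleftrightarrow> i = last_ix"
proof -
  have "\<not> short_root (root_fin i)" if "i \<noteq> last_ix"
  proof
    assume "short_root (root_fin i)"
    then consider a where "root_fin i = eps a" | a where "root_fin i = - eps a"
      unfolding short_root_def coroots_d_def by (metis imageE uminus_uminus_fun)
    then have "root_fin i i = 0 \<or> root_fin i (next_ix i) = 0"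
      by cases (auto simp: eps_def next_ix_neq[OF that])
    then show False
      using that next_ix_neq[OF that] by (auto simp: root_fin_def eps_def)
  qed
  then show ?thesis by (auto simp: root_fin_def short_root_def coroots_d_def)
qed

lemma short_root_pos_iff:
  assumes "\<beta> \<in> pos_roots"
  shows "short_root \<beta> \<longleftrightarrow> \<beta> \<in> coroots_d"
  using uminus_pos_roots_D[OF assms] by (auto simp: short_root_def pos_roots_def)

lemma coroots_d_s_disjoint:
  assumes "\<beta> \<in> coroots_d"
  shows "\<beta> \<notin> coroots_s"
proof
  assume "\<beta> \<in> coroots_s"
  then obtain a b where "a < b" "\<beta> a \<noteq> 0" "\<beta> b \<noteq> 0"
    by (auto simp: coroots_s_def eps_def)
  moreover obtain c where "\<beta> = eps c" using assms by (auto simp: coroots_d_def)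
  ultimately show False by (auto simp: eps_def split: if_splits)
qed

lemma coroots_s_iff: "\<beta> \<in> coroots_s \<longleftrightarrow> \<beta> \<in> pos_roots \<and> \<not> short_root \<beta>"
  using coroots_d_s_disjoint[of \<beta>] short_root_pos_iff[of \<beta>] by (auto simp: pos_roots_def)

lemma coroots_d_iff: "\<beta> \<in> coroots_d \<longleftrightarrow> \<beta> \<in> pos_roots \<and> short_root \<beta>"
  using short_root_pos_iff[of \<beta>] by (auto simp: pos_roots_def)

text \<open>From here on the negative of a root is kept as one vector, so that the facts on negative
  roots match.\<close>

declare uminus_apply [simp del]

section \<open>Length, reduced words and the word property\<close>

text \<open>Since nu is nonnegative on positive roots, a sum of positive roots is orthogonal to nu
  only if both summands are. Hence the sign of the additive functional \<open>height (w _)\<close>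
  spreads from the simple roots orthogonal to nu to all positive ones. The factor c admits both
  signs: c = 1 serves minimal coset representatives, c = -1 the longest element of a
  stabilizer.\<close>

lemma Wfin_root_combination:
  assumes w: "w \<in> Wfin" and dom: "\<And>i. pairing \<nu> (root_fin i) \<ge> 0"
    and J: "\<And>i. pairing \<nu> (root_fin i) = 0 \<Longrightarrow> 0 < c * height (w (root_fin i))"
    and \<beta>: "\<beta> \<in> pos_roots" "pairing \<nu> \<beta> = 0"
  shows "0 < c * height (w \<beta>)"
proof -
  have nonneg: "pairing \<nu> \<beta> \<ge> 0" if "\<beta> \<in> pos_roots" for \<beta>
    using that by (induction \<beta> rule: pos_roots_induct) (auto simp: dom pairing_linear)
  show ?thesis
    using \<beta>
  proof (induction \<beta> rule: pos_roots_induct)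
    case (simple i)
    then show ?case by (rule J)
  next
    case (step \<beta> i)
    then have "pairing \<nu> \<beta> = 0" "pairing \<nu> (root_fin i) = 0"
      using nonneg[OF step(1)] dom[of i] by (auto simp: pairing_linear)
    then have "0 < c * height (w \<beta>)" "0 < c * height (w (root_fin i))"
      using step J by auto
    moreover have "c * height (w (\<lambda>k. \<beta> k + root_fin i k)) =
        c * height (w \<beta>) + c * height (w (root_fin i))"
      by (simp add: Wfin_add[OF w] height_def pairing_linear distrib_left)
    ultimately show ?case by simp
  qed
qed

lemma pairing_zero [simp]: "pairing (\<lambda>_. 0) \<beta> = 0"
  by (simp add: pairing_def)

lemma Wfin_pos_roots_of_simple:
  assumes "w \<in> Wfin" "\<And>i. w (root_fin i) \<in> pos_roots" "\<beta> \<in> pos_roots"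
  shows "w \<beta> \<in> pos_roots"
  using Wfin_root_combination[of w "\<lambda>_. 0" 1 \<beta>] assms height_pos
  by (simp add: pos_roots_iff_height)

text \<open>The least moved point i is the image of some larger k, whence f i < f k = i. Then f i is
  a smaller point and must be fixed, against injectivity.\<close>

lemma strict_mono_finite_linorder_id:
  fixes f :: "'n::{finite,linorder} \<Rightarrow> 'n"
  assumes "strict_mono f"
  shows "f = id"
proof (rule ccontr)
  assume "f \<noteq> id"
  define i where "i = Min {i. f i \<noteq> i}"
  have "{i. f i \<noteq> i} \<noteq> {}" using \<open>f \<noteq> id\<close> by (auto simp: fun_eq_iff)
  then have i: "f i \<noteq> i" and least: "\<And>k. f k \<noteq> k \<Longrightarrow> i \<le> k"
    using Min_in[of "{i. f i \<noteq> i}"] unfolding i_def by auto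
  have inj: "inj f" using assms by (rule strict_mono_imp_inj_on)
  then obtain k where k: "f k = i" using finite_UNIV_inj_surj[of f] by (metis finite surjD)
  have "i \<noteq> k" using k i by auto
  moreover have "f k \<noteq> k" using k calculation by simp
  ultimately have "i < k" using least[of k] by simp
  then have "f i < i" using assms k by (auto simp: strict_mono_def)
  then have "f (f i) = f i" using least[of "f i"] by force
  then show False using inj i by (auto dest: injD)
qed

section \<open>Inversion sets and descents\<close>

definition inv_set :: "(('n::{finite,linorder} \<Rightarrow> int) \<Rightarrow> 'n \<Rightarrow> int) \<Rightarrow> ('n \<Rightarrow> int) set" where
  "inv_set w = {\<beta> \<in> pos_roots. w \<beta> \<notin> pos_roots}"

lemma inv_set_id [simp]: "inv_set id = {}"
  by (auto simp: inv_set_def)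

lemma finite_inv_set [simp]: "finite (inv_set w)"
  by (simp add: inv_set_def)

lemma inv_set_pos_roots: "inv_set w \<subseteq> pos_roots"
  by (auto simp: inv_set_def)

text \<open>Positivity of the images of the eps forces all signs to be 1, and positivity of the
  images of the differences forces the index permutation to be increasing, hence trivial.\<close>

lemma inv_set_empty:
  assumes "w \<in> Wfin" "inv_set w = {}"
  shows "w = id"
proof -
  have pos: "w \<beta> \<in> pos_roots" if "\<beta> \<in> pos_roots" for \<beta>
    using assms(2) that by (auto simp: inv_set_def)
  obtain \<sigma> \<pi> where sp: "\<forall>j. \<sigma> j = 1 \<or> \<sigma> j = - 1" "bij \<pi>" "w = (\<lambda>v j. \<sigma> j * v (\<pi> j))"
    using Wfin_signed_perm[OF assms(1)] by (auto simp: signed_perm_def)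
  have inj: "\<pi> a = \<pi> b \<longleftrightarrow> a = b" for a b using sp(2) by (auto simp: bij_def inj_eq)
  have img: "w (eps (\<pi> j)) = (\<lambda>k. \<sigma> j * eps j k)" for j
    by (auto simp: sp(3) eps_def inj fun_eq_iff)
  have \<sigma>: "\<sigma> j = 1" for j
  proof (rule ccontr)
    assume "\<sigma> j \<noteq> 1"
    then have "w (eps (\<pi> j)) = - eps j" using sp(1)[rule_format, of j] by (auto simp: img fun_eq_iff uminus_apply)
    then show False using pos[of "eps (\<pi> j)"] uminus_pos_roots_D[of "eps j"] by auto
  qed
  have "strict_mono \<pi>"
  proof (rule strict_monoI, rule ccontr)
    fix a b :: 'a
    assume ab: "a < b" "\<not> \<pi> a < \<pi> b"
    then have "\<pi> b < \<pi> a" using inj[of a b] by auto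
    then have "w (\<lambda>k. eps (\<pi> b) k - eps (\<pi> a) k) \<in> pos_roots" using pos by auto
    also have "w (\<lambda>k. eps (\<pi> b) k - eps (\<pi> a) k) = - (\<lambda>k. eps a k - eps b k)"
      unfolding Wfin_diff[OF assms(1)] img by (simp add: \<sigma> fun_eq_iff uminus_apply)
    finally show False using uminus_pos_roots_D[OF pos_rootsI(3)[OF ab(1)]] by simp
  qed
  then have "\<pi> = id" by (rule strict_mono_finite_linorder_id)
  then show ?thesis by (simp add: sp(3) \<sigma> fun_eq_iff)
qed

text \<open>w u^(-1) keeps every positive root beta positive, as w and u agree on whether the
  positive one of u^(-1) beta and its negative is inverted. So it has no inversions.\<close>

lemma inv_set_eqD:
  assumes "w \<in> Wfin" "u \<in> Wfin" "inv_set w = inv_set u"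
  shows "w = u"
proof -
  have "w (inv u \<beta>) \<in> pos_roots" if \<beta>: "\<beta> \<in> pos_roots" for \<beta>
  proof (cases "inv u \<beta> \<in> pos_roots")
    case True
    then have "inv u \<beta> \<notin> inv_set u" using assms(2) \<beta> by (simp add: inv_set_def)
    then show ?thesis using True assms(3) by (auto simp: inv_set_def)
  next
    case False
    then have neg: "- inv u \<beta> \<in> pos_roots"
      using \<beta> assms(2) by (simp add: uminus_pos_roots_iff)
    have "u (- inv u \<beta>) = - \<beta>" using assms(2) by (simp add: Wfin_uminus)
    then have "- inv u \<beta> \<in> inv_set u" using neg uminus_pos_roots_D[OF \<beta>] by (simp add: inv_set_def)
    then have "w (- inv u \<beta>) \<notin> pos_roots" using assms(3) by (auto simp: inv_set_def)
    then show ?thesis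
      using \<beta> assms uminus_pos_roots_iff[of "w (inv u \<beta>)"] Wfin_uminus[OF assms(1), of "inv u \<beta>"] by auto
  qed
  then have "inv_set (w \<circ> inv u) = {}" by (auto simp: inv_set_def)
  then have "w \<circ> inv u = id" using assms by (intro inv_set_empty) auto
  then have "w \<circ> (inv u \<circ> u) = u" by (metis comp_assoc id_comp)
  then show ?thesis using assms(2) by simp
qed

text \<open>Passing from w to s_i w affects only those beta with w beta = alpha_i or w beta = -
  alpha_i. The second case would make beta the negative of the positive root w^(-1) alpha_i.\<close>

lemma inv_set_refl_fin_up:
  assumes w: "w \<in> Wfin" and up: "inv w (root_fin i) \<in> pos_roots"
  shows "inv_set (refl_fin i \<circ> w) = insert (inv w (root_fin i)) (inv_set w)"
    and "inv w (root_fin i) \<notin> inv_set w"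
proof -
  have "refl_fin i (w \<beta>) \<notin> pos_roots \<longleftrightarrow> \<beta> = inv w (root_fin i) \<or> w \<beta> \<notin> pos_roots"
    if \<beta>: "\<beta> \<in> pos_roots" for \<beta>
  proof (cases "w \<beta> = root_fin i")
    case True
    then have "\<beta> = inv w (root_fin i)" using w by (metis inv_apply_Wfin(1))
    then show ?thesis
      using w uminus_pos_roots_D[OF root_fin_pos, of i] by (simp add: refl_fin_root_fin)
  next
    case False
    have "w \<beta> \<noteq> - root_fin i"
    proof
      assume "w \<beta> = - root_fin i"
      then have "\<beta> = - inv w (root_fin i)" using w by (metis Wfin_uminus inv_Wfin inv_apply_Wfin(1))
      then show False using \<beta> uminus_pos_roots_D[OF up] by simp
    qed
    then have "refl_fin i (w \<beta>) \<in> pos_roots \<longleftrightarrow> w \<beta> \<in> pos_roots"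
      using False w \<beta> by (intro refl_fin_pos_roots_iff) auto
    then show ?thesis using False w by auto
  qed
  then show "inv_set (refl_fin i \<circ> w) = insert (inv w (root_fin i)) (inv_set w)"
    using up by (auto simp: inv_set_def)
  show "inv w (root_fin i) \<notin> inv_set w" using w by (simp add: inv_set_def)
qed

text \<open>Left descents, phrased through roots; the length drop is
  \<open>card_inv_set_down\<close>.\<close>

definition descent :: "'n::{finite,linorder} \<Rightarrow> (('n \<Rightarrow> int) \<Rightarrow> 'n \<Rightarrow> int) \<Rightarrow> bool" where
  "descent i w \<longleftrightarrow> inv w (root_fin i) \<notin> pos_roots"

lemma descent_refl_fin:
  assumes "w \<in> Wfin"
  shows "descent i (refl_fin i \<circ> w) \<longleftrightarrow> \<not> descent i w"
proof -
  have "inv (refl_fin i \<circ> w) (root_fin i) = - inv w (root_fin i)"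
    using assms by (simp add: inv_comp_distrib_Wfin refl_fin_root_fin Wfin_uminus)
  then show ?thesis
    unfolding descent_def using assms by (simp add: uminus_pos_roots_iff)
qed

lemma card_inv_set_up:
  "w \<in> Wfin \<Longrightarrow> \<not> descent i w \<Longrightarrow> card (inv_set (refl_fin i \<circ> w)) = Suc (card (inv_set w))"
  by (simp add: descent_def inv_set_refl_fin_up)

lemma refl_fin_cancel [simp]: "refl_fin i \<circ> (refl_fin i \<circ> w) = w"
  by (simp flip: comp_assoc)

lemma card_inv_set_down:
  "w \<in> Wfin \<Longrightarrow> descent i w \<Longrightarrow> card (inv_set w) = Suc (card (inv_set (refl_fin i \<circ> w)))"
  using card_inv_set_up[of "refl_fin i \<circ> w" i] by (simp add: descent_refl_fin)

text \<open>Without a left descent w^(-1) maps all simple roots, hence all positive roots, to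
  positive ones. Applied to - w beta for an inversion beta this is absurd.\<close>

lemma exists_descent:
  assumes "w \<in> Wfin" "inv_set w \<noteq> {}"
  shows "\<exists>i. descent i w"
proof (rule ccontr)
  assume "\<nexists>i. descent i w"
  then have pos: "inv w \<beta> \<in> pos_roots" if "\<beta> \<in> pos_roots" for \<beta>
    using that assms(1) unfolding descent_def by (intro Wfin_pos_roots_of_simple[of "inv w" \<beta>]) blast+
  obtain \<beta> where \<beta>: "\<beta> \<in> pos_roots" "w \<beta> \<notin> pos_roots" using assms(2) by (auto simp: inv_set_def)
  then have "- w \<beta> \<in> pos_roots" using assms(1) by (simp add: uminus_pos_roots_iff)
  then have "inv w (- w \<beta>) \<in> pos_roots" by (rule pos)
  then show False using assms(1) uminus_pos_roots_D[OF \<beta>(1)] by (simp add: Wfin_uminus)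
qed

text \<open>Defined through the number of inversions, not by minimality among words, so that it can
  be tested letter by letter (\<open>reduced_Cons\<close>); \<open>length_rword\<close> shows that
  minimal words have this length.\<close>

definition reduced :: "'n::{finite,linorder} list \<Rightarrow> bool" where
  "reduced ws \<longleftrightarrow> length ws = card (inv_set (word_act ws))"

lemma word_act_Wfin [simp]: "word_act ws \<in> Wfin"
  by (simp add: Wfin_def)

lemma card_inv_set_word_act_le: "card (inv_set (word_act ws)) \<le> length ws"
proof (induction ws)
  case (Cons i ws)
  show ?case
    using card_inv_set_up[of "word_act ws" i] card_inv_set_down[of "word_act ws" i] Cons
    by (cases "descent i (word_act ws)") (auto simp del: comp_apply)
qed (simp del: id_apply)

lemma reduced_Nil: "reduced []"
  by (simp only: reduced_def word_act_Nil inv_set_id) simp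

lemma reduced_Cons: "reduced (i # ws) \<longleftrightarrow> reduced ws \<and> \<not> descent i (word_act ws)"
  using card_inv_set_up[of "word_act ws" i] card_inv_set_down[of "word_act ws" i]
    card_inv_set_word_act_le[of ws]
  unfolding reduced_def word_act_Cons by (cases "descent i (word_act ws)") auto

lemma exists_reduced:
  assumes "w \<in> Wfin"
  shows "\<exists>ws. word_act ws = w \<and> reduced ws"
  using assms
proof (induction "card (inv_set w)" arbitrary: w)
  case 0
  then have "w = id" using inv_set_empty by auto
  then show ?case using reduced_Nil word_act_Nil by blast
next
  case (Suc n)
  then have "inv_set w \<noteq> {}" by auto
  then obtain i where i: "descent i w" using exists_descent[OF Suc(3)] by blast
  then have "card (inv_set (refl_fin i \<circ> w)) = n" using card_inv_set_down[OF Suc(3) i] Suc(2) by simp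
  then obtain ws where ws: "word_act ws = refl_fin i \<circ> w" "reduced ws"
    using Suc(1)[of "refl_fin i \<circ> w"] Suc(3) by auto
  have "reduced (i # ws)" using ws i Suc(3) by (simp add: reduced_Cons descent_refl_fin)
  moreover have "word_act (i # ws) = w" by (simp add: ws)
  ultimately show ?case by blast
qed

lemma rword_props:
  assumes "w \<in> Wfin"
  shows word_act_rword: "word_act (rword w) = w" and length_rword: "length (rword w) = card (inv_set w)"
    and reduced_rword: "reduced (rword w)"
proof -
  obtain ws where ws: "word_act ws = w" "reduced ws" using exists_reduced[OF assms] by blast
  have 1: "word_act (rword w) = w" unfolding rword_def by (rule arg_min_natI) (rule ws(1))
  have "length (rword w) \<le> length ws" unfolding rword_def by (rule arg_min_nat_le) (rule ws(1))
  then have 2: "length (rword w) = card (inv_set w)"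
    using ws card_inv_set_word_act_le[of "rword w"] by (simp add: 1 reduced_def)
  show "word_act (rword w) = w" "length (rword w) = card (inv_set w)" "reduced (rword w)"
    using 1 2 by (simp_all add: reduced_def)
qed

lemma len_eq: "w \<in> Wfin \<Longrightarrow> len w = card (inv_set w)"
  by (simp add: len_def length_rword)

section \<open>Rank two relations and Matsumoto's theorem\<close>

lemma refl_fin_formula:
  "refl_fin i v = (\<lambda>k. v k - (if i = last_ix then 2 * v i else v i - v (next_ix i)) * root_fin i k)"
  by (auto simp: refl_fin_def root_fin_def eps_def fun_eq_iff next_ix_neq)

text \<open>The Cartan integers of neighbouring nodes. The coefficient 2 occurs because alpha_n is
  short: s_n sends alpha_(n-1) to alpha_(n-1) + 2 alpha_n.\<close>

lemma refl_fin_root_next: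
  assumes "i \<noteq> last_ix"
  shows "refl_fin i (root_fin (next_ix i)) = (\<lambda>k. root_fin i k + root_fin (next_ix i) k)"
    and "refl_fin (next_ix i) (root_fin i) =
      (\<lambda>k. root_fin i k + (if next_ix i = last_ix then 2 else 1) * root_fin (next_ix i) k)"
proof -
  have ne: "next_ix i \<noteq> i" "next_ix i \<noteq> last_ix \<Longrightarrow> next_ix (next_ix i) \<noteq> next_ix i"
    "next_ix i \<noteq> last_ix \<Longrightarrow> next_ix (next_ix i) \<noteq> i"
    using next_ix_neq[OF assms] next_ix_neq[of "next_ix i"] less_trans[OF less_next_ix[OF assms] less_next_ix]
    by (blast, blast, metis less_irrefl)
  show "refl_fin i (root_fin (next_ix i)) = (\<lambda>k. root_fin i k + root_fin (next_ix i) k)"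
  proof -
    have "root_fin (next_ix i) i - root_fin (next_ix i) (next_ix i) = - 1"
      using assms ne by (cases "next_ix i = last_ix") (simp_all add: root_fin_def eps_def)
    then show ?thesis using assms by (simp add: refl_fin_formula[of i] add.commute)
  qed
  show "refl_fin (next_ix i) (root_fin i) =
      (\<lambda>k. root_fin i k + (if next_ix i = last_ix then 2 else 1) * root_fin (next_ix i) k)"
  proof (cases "next_ix i = last_ix")
    case True
    then have "root_fin i last_ix = - 1"
      using assms ne by (auto simp: root_fin_def eps_def)
    then show ?thesis using True by (simp add: refl_fin_formula[of last_ix])
  next
    case False
    have "root_fin i (next_ix i) - root_fin i (next_ix (next_ix i)) = - 1"
      using assms ne False by (auto simp: root_fin_def eps_def)
    then show ?thesis using False by (simp add: refl_fin_formula[of "next_ix i"])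
  qed
qed

definition adjacent :: "'n::{finite,linorder} \<Rightarrow> 'n \<Rightarrow> bool" where
  "adjacent i j \<longleftrightarrow> (i \<noteq> last_ix \<and> j = next_ix i) \<or> (j \<noteq> last_ix \<and> i = next_ix j)"

lemma refl_fin_root_commute:
  assumes "i \<noteq> j" "\<not> adjacent i j"
  shows "refl_fin i (root_fin j) = root_fin j"
proof -
  have "i \<noteq> last_ix \<Longrightarrow> j \<noteq> last_ix \<Longrightarrow> next_ix i \<noteq> next_ix j"
    using assms next_ix_inj by blast
  then have "(if i = last_ix then 2 * root_fin j i else root_fin j i - root_fin j (next_ix i)) = 0"
    using assms next_ix_neq[of i] next_ix_neq[of j]
    by (auto simp: root_fin_def eps_def adjacent_def)
  then show ?thesis by (simp only: refl_fin_formula[of i]) simp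
qed

lemma refl_fin_commute:
  assumes "i \<noteq> j" "\<not> adjacent i j"
  shows "refl_fin i (refl_fin j v) = refl_fin j (refl_fin i v)"
proof -
  have "i \<noteq> last_ix \<Longrightarrow> j \<noteq> last_ix \<Longrightarrow> next_ix i \<noteq> next_ix j"
    using assms next_ix_inj by blast
  moreover have "i \<noteq> last_ix \<Longrightarrow> next_ix i \<noteq> j" "j \<noteq> last_ix \<Longrightarrow> next_ix j \<noteq> i"
    using assms by (auto simp: adjacent_def)
  ultimately show ?thesis
    using assms(1) by (intro ext, cases "i = last_ix"; cases "j = last_ix") (simp_all add: refl_fin_def)
qed

lemma refl_fin_braid3:
  assumes "i \<noteq> last_ix" "next_ix i \<noteq> last_ix"
  shows "refl_fin i (refl_fin (next_ix i) (refl_fin i v)) =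
    refl_fin (next_ix i) (refl_fin i (refl_fin (next_ix i) v))"
proof -
  have ne: "next_ix i \<noteq> i" "next_ix (next_ix i) \<noteq> next_ix i" "next_ix (next_ix i) \<noteq> i"
    using less_next_ix[OF assms(1)] less_next_ix[OF assms(2)] by force+
  then show ?thesis using assms by (intro ext) (simp add: refl_fin_def)
qed

lemma refl_fin_braid4:
  assumes "i \<noteq> last_ix" "next_ix i = last_ix"
  shows "refl_fin i (refl_fin (next_ix i) (refl_fin i (refl_fin (next_ix i) v))) =
    refl_fin (next_ix i) (refl_fin i (refl_fin (next_ix i) (refl_fin i v)))"
  using assms next_ix_neq[OF assms(1)] by (intro ext) (simp add: refl_fin_def)

text \<open>With descents as signs of heights, \<open>height_inv_refl\<close> lets them be followed
  through a rank two word by linear arithmetic.\<close>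

lemma descent_iff_height: "w \<in> Wfin \<Longrightarrow> descent i w \<longleftrightarrow> height (inv w (root_fin i)) < 0"
proof -
  assume w: "w \<in> Wfin"
  let ?b = "inv w (root_fin i)"
  have "?b \<in> pos_roots \<or> - ?b \<in> pos_roots" using w by (auto simp: all_roots_def[symmetric] uminus_pos_roots_iff)
  then show ?thesis using height_pos[of ?b] height_pos[of "- ?b"] uminus_pos_roots_D[of ?b]
    by (auto simp: descent_def height_def pairing_linear)
qed

lemma height_inv_refl:
  assumes "w \<in> Wfin" "refl_fin i v = (\<lambda>k. a * x k + b * y k)"
  shows "height (inv (refl_fin i \<circ> w) v) = a * height (inv w x) + b * height (inv w y)"
proof -
  obtain \<sigma> \<pi> where "inv w = (\<lambda>v j. \<sigma> j * v (\<pi> j))"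
    using Wfin_signed_perm[of "inv w"] assms(1) by (auto simp: signed_perm_def)
  then show ?thesis
    using assms by (simp add: inv_comp_distrib_Wfin height_def pairing_def algebra_simps
        sum.distrib sum_distrib_left)
qed

lemma reduced_of_descent:
  assumes "w \<in> Wfin" "descent i w" "reduced ws" "word_act ws = refl_fin i \<circ> w"
  shows "reduced (i # ws) \<and> word_act (i # ws) = w"
  using assms by (simp_all add: reduced_Cons descent_refl_fin)

text \<open>Matsumoto's theorem. If two letters are left descents of an element, then the longest element of
  the rank two subgroup which they generate splits off on the left, and a braid move connects
  reduced words beginning with the two letters.\<close>

theorem reduced_words_related:
  fixes R :: "'n::{finite,linorder} list \<Rightarrow> 'n list \<Rightarrow> bool"
  assumes refl: "\<And>ws. R ws ws" and sym: "\<And>ws vs. R ws vs \<Longrightarrow> R vs ws"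
    and trans: "\<And>ws vs us. R ws vs \<Longrightarrow> R vs us \<Longrightarrow> R ws us"
    and cons: "\<And>i ws vs. R ws vs \<Longrightarrow> R (i # ws) (i # vs)"
    and commute: "\<And>i j ws. i \<noteq> j \<Longrightarrow> \<not> adjacent i j \<Longrightarrow> R (i # j # ws) (j # i # ws)"
    and braid3: "\<And>i ws. i \<noteq> last_ix \<Longrightarrow> next_ix i \<noteq> last_ix \<Longrightarrow>
      R (i # next_ix i # i # ws) (next_ix i # i # next_ix i # ws)"
    and braid4: "\<And>i ws. i \<noteq> last_ix \<Longrightarrow> next_ix i = last_ix \<Longrightarrow>
      R (i # next_ix i # i # next_ix i # ws) (next_ix i # i # next_ix i # i # ws)"
    and red: "reduced ws" "reduced vs" "word_act ws = word_act vs"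
  shows "R ws vs"
  using red
proof (induction "length ws" arbitrary: ws vs rule: less_induct)
  case less
  define w where "w = word_act ws"
  have w: "w \<in> Wfin" by (simp add: w_def)
  have len: "length vs = length ws" using less by (simp add: reduced_def)
  show ?case
  proof (cases ws)
    case Nil
    then show ?thesis using len refl by simp
  next
    case (Cons i ws')
    then obtain j vs' where vs: "vs = j # vs'" using len by (cases vs) auto
    have red': "reduced ws'" "\<not> descent i (word_act ws')" "reduced vs'" "\<not> descent j (word_act vs')"
      using less.prems by (auto simp: Cons vs reduced_Cons)
    have "w = refl_fin i \<circ> word_act ws'" "w = refl_fin j \<circ> word_act vs'"
      using less.prems(3) unfolding w_def vs Cons by (simp_all only: word_act_Cons)
    then have ws': "word_act ws' = refl_fin i \<circ> w" and vs': "word_act vs' = refl_fin j \<circ> w"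
      by (metis refl_fin_cancel)+
    have desc: "descent i w" "descent j w"
      using red' w by (auto simp: ws' vs' descent_refl_fin)
    have IH: "R (k # us) (k # xs)" if "reduced us" "reduced xs" "word_act us = word_act xs"
      "length us = length ws'" for k us xs
      using less.hyps[of us xs] that Cons cons by simp
    have lens: "length us = length ws'" if "reduced us" "word_act us = refl_fin k \<circ> w" "descent k w" for us k
    proof -
      have "Suc (length us) = card (inv_set w)"
        using that card_inv_set_down[OF w that(3)] by (simp add: reduced_def)
      also have "\<dots> = length ws" using less.prems(1) by (simp add: reduced_def w_def)
      finally show ?thesis by (simp add: Cons)
    qed
    \<comment> \<open>It is enough to connect one pair of reduced words with the two given first
      letters: the induction hypothesis exchanges their tails for the given ones.\<close>
    have link: "R (i # ws') (j # vs')"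
      if "reduced us" "word_act us = refl_fin i \<circ> w" "reduced xs" "word_act xs = refl_fin j \<circ> w"
        "R (i # us) (j # xs)" for us xs
    proof -
      have "R (i # ws') (i # us)" using that red' ws' by (intro IH) auto
      moreover have "R (j # xs) (j # vs')" using that red' vs' lens desc by (intro IH) auto
      ultimately show ?thesis using that(5) trans by blast
    qed
    \<comment> \<open>The case of neighbouring letters, stated for a letter and its successor and
      used in both orders.\<close>
    have adj: "\<exists>us xs. reduced us \<and> word_act us = refl_fin i \<circ> w \<and> reduced xs \<and>
        word_act xs = refl_fin (next_ix i) \<circ> w \<and> R (i # us) (next_ix i # xs)"
      if i: "i \<noteq> last_ix" and di: "descent i w" and dj: "descent (next_ix i) w" for i
    proof -
      define j where "j = next_ix i"
      let ?s = "refl_fin i" and ?r = "refl_fin j"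
      let ?h = "\<lambda>v. height (inv w v)"
      have hi: "?h (root_fin i) < 0" and hj: "?h (root_fin j) < 0"
        using di dj w by (auto simp: descent_iff_height j_def)
      have rij: "?s (root_fin j) = (\<lambda>k. 1 * root_fin i k + 1 * root_fin j k)"
        using refl_fin_root_next(1)[OF i] by (simp add: j_def)
      show ?thesis
      proof (cases "j = last_ix")
        case False
        have rji: "?r (root_fin i) = (\<lambda>k. 1 * root_fin i k + 1 * root_fin j k)"
          using refl_fin_root_next(2)[OF i] False by (simp add: j_def)
        \<comment> \<open>The heights which decide the next descents come out as nonnegative
          combinations of the two negative numbers in \<open>hi\<close> and \<open>hj\<close>. So
          letters split off alternately until the longest element of the rank two subgroup is used
          up.\<close>
        have h1: "height (inv (?s \<circ> w) (root_fin j)) = ?h (root_fin i) + ?h (root_fin j)"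
          using height_inv_refl[OF w rij] by simp
        have h2: "height (inv (?r \<circ> w) (root_fin i)) = ?h (root_fin i) + ?h (root_fin j)"
          using height_inv_refl[OF w rji] by simp
        have h1': "height (inv (?s \<circ> w) (root_fin i)) = - ?h (root_fin i)"
          using height_inv_refl[OF w, of i "root_fin i" "- 1" "root_fin i" 0] by (simp add: refl_fin_root_fin fun_Compl_def)
        have h2': "height (inv (?r \<circ> w) (root_fin j)) = - ?h (root_fin j)"
          using height_inv_refl[OF w, of j "root_fin j" "- 1" "root_fin j" 0] by (simp add: refl_fin_root_fin fun_Compl_def)
        have h3: "height (inv (?r \<circ> (?s \<circ> w)) (root_fin i)) = ?h (root_fin j)"
          using height_inv_refl[OF _ rji, of "?s \<circ> w"] w by (simp add: h1 h1')
        have h4: "height (inv (?s \<circ> (?r \<circ> w)) (root_fin j)) = ?h (root_fin i)"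
          using height_inv_refl[OF _ rij, of "?r \<circ> w"] w by (simp add: h2 h2')
        \<comment> \<open>The common remainder: the braid relation makes it independent of which of
          the two letters is taken off first. Below, both words are rebuilt from a reduced word of
          \<open>u\<close>.\<close>
        define u where "u = ?s \<circ> (?r \<circ> (?s \<circ> w))"
        have u': "u = ?r \<circ> (?s \<circ> (?r \<circ> w))"
          unfolding u_def j_def using refl_fin_braid3[OF i] False by (auto simp: fun_eq_iff j_def)
        have u: "u \<in> Wfin" using w by (auto simp: u_def)
        have ru: "reduced (rword u)" "word_act (rword u) = u" using u by (auto simp: reduced_rword word_act_rword)
        have a1: "reduced (i # rword u) \<and> word_act (i # rword u) = ?r \<circ> (?s \<circ> w)"
          using w ru h3 hj by (intro reduced_of_descent) (auto simp: descent_iff_height u_def)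
        have a2: "reduced (j # i # rword u) \<and> word_act (j # i # rword u) = ?s \<circ> w"
          using w a1 h1 hi hj by (intro reduced_of_descent) (auto simp: descent_iff_height)
        have b1: "reduced (j # rword u) \<and> word_act (j # rword u) = ?s \<circ> (?r \<circ> w)"
          using w ru h4 hi by (intro reduced_of_descent) (auto simp: descent_iff_height u')
        have b2: "reduced (i # j # rword u) \<and> word_act (i # j # rword u) = ?r \<circ> w"
          using w b1 h2 hi hj by (intro reduced_of_descent) (auto simp: descent_iff_height)
        have "R (i # j # i # rword u) (j # i # j # rword u)"
          using braid3[OF i] False by (simp add: j_def)
        then show ?thesis using a2 b2 unfolding j_def by blast
      next
        case True
        have rji: "?r (root_fin i) = (\<lambda>k. 1 * root_fin i k + 2 * root_fin j k)"
          using refl_fin_root_next(2)[OF i] True by (simp add: j_def)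
        have h1: "height (inv (?s \<circ> w) (root_fin j)) = ?h (root_fin i) + ?h (root_fin j)"
          using height_inv_refl[OF w rij] by simp
        have h2: "height (inv (?r \<circ> w) (root_fin i)) = ?h (root_fin i) + 2 * ?h (root_fin j)"
          using height_inv_refl[OF w rji] by simp
        have h1': "height (inv (?s \<circ> v) (root_fin i)) = - height (inv v (root_fin i))" if "v \<in> Wfin" for v
          using height_inv_refl[OF that, of i "root_fin i" "- 1" "root_fin i" 0] by (simp add: refl_fin_root_fin fun_Compl_def)
        have h2': "height (inv (?r \<circ> v) (root_fin j)) = - height (inv v (root_fin j))" if "v \<in> Wfin" for v
          using height_inv_refl[OF that, of j "root_fin j" "- 1" "root_fin j" 0] by (simp add: refl_fin_root_fin fun_Compl_def)
        have h3: "height (inv (?r \<circ> (?s \<circ> w)) (root_fin i)) = ?h (root_fin i) + 2 * ?h (root_fin j)"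
          using height_inv_refl[OF _ rji, of "?s \<circ> w"] w by (simp add: h1 h1')
        have h4: "height (inv (?s \<circ> (?r \<circ> w)) (root_fin j)) = ?h (root_fin i) + ?h (root_fin j)"
          using height_inv_refl[OF _ rij, of "?r \<circ> w"] w by (simp add: h2 h2')
        have h5: "height (inv (?s \<circ> (?r \<circ> (?s \<circ> w))) (root_fin j)) = ?h (root_fin j)"
          using height_inv_refl[OF _ rij, of "?r \<circ> (?s \<circ> w)"] w by (simp add: h3 h2' h1)
        have h6: "height (inv (?r \<circ> (?s \<circ> (?r \<circ> w))) (root_fin i)) = ?h (root_fin i)"
          using height_inv_refl[OF _ rji, of "?s \<circ> (?r \<circ> w)"] w by (simp add: h4 h1' h2)
        define u where "u = ?r \<circ> (?s \<circ> (?r \<circ> (?s \<circ> w)))"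
        have u': "u = ?s \<circ> (?r \<circ> (?s \<circ> (?r \<circ> w)))"
          unfolding u_def j_def using refl_fin_braid4[OF i] True by (auto simp: fun_eq_iff j_def)
        have u: "u \<in> Wfin" using w by (auto simp: u_def)
        have ru: "reduced (rword u)" "word_act (rword u) = u" using u by (auto simp: reduced_rword word_act_rword)
        have a0: "reduced (j # rword u) \<and> word_act (j # rword u) = ?s \<circ> (?r \<circ> (?s \<circ> w))"
          using w ru h5 hj by (intro reduced_of_descent) (auto simp: descent_iff_height u_def)
        have a1: "reduced (i # j # rword u) \<and> word_act (i # j # rword u) = ?r \<circ> (?s \<circ> w)"
          using w a0 h3 hi hj by (intro reduced_of_descent) (auto simp: descent_iff_height)
        have a2: "reduced (j # i # j # rword u) \<and> word_act (j # i # j # rword u) = ?s \<circ> w"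
          using w a1 h1 hi hj by (intro reduced_of_descent) (auto simp: descent_iff_height)
        have b0: "reduced (i # rword u) \<and> word_act (i # rword u) = ?r \<circ> (?s \<circ> (?r \<circ> w))"
          using w ru h6 hi by (intro reduced_of_descent) (auto simp: descent_iff_height u')
        have b1: "reduced (j # i # rword u) \<and> word_act (j # i # rword u) = ?s \<circ> (?r \<circ> w)"
          using w b0 h4 hi hj by (intro reduced_of_descent) (auto simp: descent_iff_height)
        have b2: "reduced (i # j # i # rword u) \<and> word_act (i # j # i # rword u) = ?r \<circ> w"
          using w b1 h2 hi hj by (intro reduced_of_descent) (auto simp: descent_iff_height)
        have "R (i # j # i # j # rword u) (j # i # j # i # rword u)"
          using braid4[OF i] True by (simp add: j_def)
        then show ?thesis using a2 b2 unfolding j_def by blast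
      qed
    qed
    consider "i = j" | "i \<noteq> last_ix" "j = next_ix i" | "j \<noteq> last_ix" "i = next_ix j"
      | "i \<noteq> j" "\<not> adjacent i j" by (auto simp: adjacent_def)
    then have "R (i # ws') (j # vs')"
    proof cases
      case 1
      then show ?thesis using IH[of ws' vs' i] red' ws' vs' by simp
    next
      case 2
      then show ?thesis using adj[of i] desc link by blast
    next
      case 3
      then show ?thesis using adj[of j] desc link sym by blast
    next
      case 4
      \<comment> \<open>For commuting letters each one stays a descent after the other is removed,
        since the reflections fix each other's simple root.\<close>
      define u where "u = refl_fin j \<circ> (refl_fin i \<circ> w)"
      have u': "u = refl_fin i \<circ> (refl_fin j \<circ> w)"
        using refl_fin_commute[OF 4] by (auto simp: u_def fun_eq_iff)
      have u: "u \<in> Wfin" using w by (auto simp: u_def)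
      have ru: "reduced (rword u)" "word_act (rword u) = u" using u by (auto simp: reduced_rword word_act_rword)
      have "adjacent j i = adjacent i j" by (auto simp: adjacent_def)
      then have d: "descent j (refl_fin i \<circ> w)" "descent i (refl_fin j \<circ> w)"
        using 4 w desc by (auto simp: descent_def inv_comp_distrib_Wfin refl_fin_root_commute)
      have "reduced (j # rword u) \<and> word_act (j # rword u) = refl_fin i \<circ> w"
        using w ru d by (intro reduced_of_descent) (auto simp: u_def)
      moreover have "reduced (i # rword u) \<and> word_act (i # rword u) = refl_fin j \<circ> w"
        using w ru d by (intro reduced_of_descent) (auto simp: u')
      ultimately show ?thesis using commute[OF 4] link by blast
    qed
    then show ?thesis by (simp add: Cons vs)
  qed
qed

section \<open>The \<open>\<kappa>\<close>-functions of all roots\<close>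

lemma const_eq_iff [simp]: "const a = const b \<longleftrightarrow> a = b"
  by (auto simp: const_def eq_fract dest: arg_cong[of _ _ "\<lambda>p. Poly_Mapping.lookup p 0"])

lemma const_1 [simp]: "const 1 = 1"
  by (simp only: const_def single_one One_fract_def[symmetric])

lemma const_0 [simp]: "const 0 = 0"
  by (simp only: const_def single_zero Zero_fract_def[symmetric])

lemma const_eq_0_iff [simp]: "const a = 0 \<longleftrightarrow> a = 0"
  using const_eq_iff[of a 0] by simp

lemma const_mult: "const (a * b) = const a * const b"
  by (simp add: const_def mult_single)

lemma const_add: "const (a + b) = const a + const b"
  by (simp add: const_def single_add)

lemma const_uminus: "const (- a) = - const a"
  using const_add[of a "- a"] by (simp add: eq_neg_iff_add_eq_0 add.commute)

lemma const_inverse: "const (inverse a) = inverse (const a)"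
proof (cases "a = 0")
  case False
  then have "const (inverse a) * const a = (1 :: 'a ratfun)" by (simp flip: const_mult)
  then show ?thesis by (metis inverse_unique mult.commute)
qed simp

lemma single_neq_0: "c \<noteq> 0 \<Longrightarrow> Poly_Mapping.single k c \<noteq> 0"
  by (metis lookup_single_eq lookup_zero)

lemma half_neq_0 [simp]: "half p \<noteq> 0"
proof -
  have "Poly_Mapping.single (Poly_Mapping.single p (1 :: nat)) (1 :: complex) \<noteq> 0"
    by (rule single_neq_0) simp
  then show ?thesis by (simp add: half_def Zero_fract_def eq_fract del: One_nat_def)
qed

lemma var_neq_0 [simp]: "var i \<noteq> 0"
proof -
  have "Poly_Mapping.single (Poly_Mapping.single i (1 :: nat)) (1 :: K) \<noteq> 0"
    by (rule single_neq_0) simp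
  then show ?thesis by (simp add: var_def Zero_fract_def eq_fract del: One_nat_def)
qed

definition Yroot :: "('n \<Rightarrow> int) \<Rightarrow> ('n::{finite,linorder}) ratfun" where
  "Yroot \<beta> = Ymon (\<beta>, 0)"

lemma Yroot_prod: "Yroot \<beta> = (\<Prod>i\<in>UNIV. var i powi \<beta> i)"
  by (simp add: Yroot_def Ymon_def monom_at_def)

lemma Yroot_neq_0 [simp]: "Yroot \<beta> \<noteq> 0"
  by (simp add: Yroot_prod)

lemma Yroot_add: "Yroot (\<lambda>k. \<beta> k + \<gamma> k) = Yroot \<beta> * Yroot \<gamma>"
  by (simp add: Yroot_prod power_int_add prod.distrib)

lemma Yroot_uminus: "Yroot (- \<beta>) = inverse (Yroot \<beta>)"
  by (simp add: Yroot_prod power_int_minus uminus_apply prod_inversef[unfolded comp_def])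

lemma Yroot_diff: "Yroot (\<lambda>k. \<beta> k - \<gamma> k) = Yroot \<beta> / Yroot \<gamma>"
  by (simp add: Yroot_prod power_int_diff prod_dividef)

lemma Yroot_eps: "Yroot (eps a) = var a"
proof -
  have "Yroot (eps a) = (\<Prod>i\<in>UNIV. if i = a then var a else 1)"
    unfolding Yroot_prod eps_def by (rule prod.cong) auto
  then show ?thesis by simp
qed

lemma const_var: "const c * var a = Fraction_Field.Fract (Poly_Mapping.single (Poly_Mapping.single a 1) c) 1"
  by (simp add: const_def var_def mult_single)

text \<open>One fact for all nonvanishing statements: c = 1 and c = -1 give the denominators of
  \<open>kap\<close>, the parameters give its numerators. The monomials on the two sides have
  different exponents; for a difference of two eps the claim is c Y_a \<noteq> Y_b, and for negative
  roots one inverts.\<close>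

lemma const_Yroot_neq_1:
  fixes \<beta> :: "'n::{finite,linorder} \<Rightarrow> int"
  assumes "\<beta> \<in> all_roots"
  shows "const c * Yroot \<beta> \<noteq> 1"
proof -
  have ne: "Poly_Mapping.single (e :: 'n \<Rightarrow>\<^sub>0 nat) c \<noteq> Poly_Mapping.single d 1" if "e \<noteq> d" for e d and c :: K
    using that by (metis lookup_single_eq lookup_single_not_eq zero_neq_one)
  have single_ne: "Poly_Mapping.single a (1::nat) \<noteq> Poly_Mapping.single b 1" if "a \<noteq> b" for a b :: 'n
    using that by (metis lookup_single_eq lookup_single_not_eq zero_neq_one)
  have one: "(1 :: 'n ratfun) = Fraction_Field.Fract (Poly_Mapping.single 0 1) 1"
    by (simp only: single_one One_fract_def[symmetric])
  have pos: "const c * Yroot \<beta> \<noteq> 1" if "\<beta> \<in> pos_roots" for \<beta> :: "'n \<Rightarrow> int" and c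
    using that
  proof (cases rule: pos_roots_cases)
    case (1 a)
    have "Poly_Mapping.single a (1::nat) \<noteq> 0" by (simp add: single_neq_0)
    then show ?thesis using ne[of "Poly_Mapping.single a 1" 0 c]
      unfolding 1 Yroot_eps const_var one by (simp add: eq_fract)
  next
    case (2 a b)
    have "Poly_Mapping.lookup (Poly_Mapping.single a (1::nat) + Poly_Mapping.single b 1) a \<noteq> 0"
      by (simp add: lookup_add)
    then have "Poly_Mapping.single a (1::nat) + Poly_Mapping.single b 1 \<noteq> 0" by (metis lookup_zero)
    moreover have "const c * Yroot \<beta> = Fraction_Field.Fract
        (Poly_Mapping.single (Poly_Mapping.single a 1 + Poly_Mapping.single b 1) c) 1"
      by (simp add: 2 Yroot_add Yroot_eps mult_single var_def const_def)
    ultimately show ?thesis using ne[of "Poly_Mapping.single a 1 + Poly_Mapping.single b 1" 0 c]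
      unfolding one by (simp add: eq_fract)
  next
    case (3 a b)
    have "const c * var a \<noteq> var b"
      using ne[OF single_ne[of a b], of c] 3(1) unfolding const_var unfolding var_def
      by (simp add: eq_fract)
    then show ?thesis by (simp add: 3 Yroot_diff Yroot_eps field_simps)
  qed
  show ?thesis
  proof (cases "\<beta> \<in> pos_roots")
    case False
    then have neg: "- \<beta> \<in> pos_roots" using assms by (simp add: uminus_pos_roots_iff)
    have \<beta>: "Yroot \<beta> = inverse (Yroot (- \<beta>))" by (simp add: Yroot_uminus)
    show ?thesis
    proof
      assume "const c * Yroot \<beta> = 1"
      then have *: "const c = Yroot (- \<beta>)" by (simp add: \<beta> field_simps)
      then have "c \<noteq> 0" using const_eq_0_iff[of c] by (metis Yroot_neq_0)
      then have "const (inverse c) * Yroot (- \<beta>) = 1" by (simp add: const_inverse flip: *)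
      then show False using pos[OF neg] by blast
    qed
  qed (rule pos)
qed

definition kap_s :: "'n ratfun \<Rightarrow> ('n::{finite,linorder}) ratfun" where
  "kap_s z = (1 - const ((half Pt)\<^sup>2) * z) / (1 - z)"

definition kap_d :: "'n ratfun \<Rightarrow> ('n::{finite,linorder}) ratfun" where
  "kap_d z = (1 - const (half Ptn * half Pt0) * z) * (1 + const (half Ptn * inverse (half Pt0)) * z)
    / (1 - z\<^sup>2)"

text \<open>Defined on negative roots as well, so that the kappa function with all Y_i inverted is
  simply \<open>kap\<close> at the negative root (\<open>kap_neg_roots\<close>) and the group acts
  on the index.\<close>

definition kap :: "('n \<Rightarrow> int) \<Rightarrow> ('n::{finite,linorder}) ratfun" where
  "kap \<beta> = (if short_root \<beta> then kap_d (Yroot \<beta>) else kap_s (Yroot \<beta>))"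

text \<open>t_n for short coroots and t for the others; \<open>half\<close> denotes the square
  roots.\<close>

definition tau :: "bool \<Rightarrow> K" where
  "tau b = (if b then (half Ptn)\<^sup>2 else (half Pt)\<^sup>2)"

lemma tau_neq_0 [simp]: "tau b \<noteq> 0"
  by (simp add: tau_def)

lemma Yroot_nondegenerate:
  fixes \<beta> :: "'n::{finite,linorder} \<Rightarrow> int"
  assumes "\<beta> \<in> all_roots"
  shows "1 - Yroot \<beta> \<noteq> 0" "1 + Yroot \<beta> \<noteq> 0" "1 - (Yroot \<beta>)\<^sup>2 \<noteq> 0"
proof -
  have 1: "1 - Yroot \<beta> \<noteq> 0" using const_Yroot_neq_1[OF assms, of 1] by auto
  have 2: "1 + Yroot \<beta> \<noteq> 0"
    using const_Yroot_neq_1[OF assms, of "- 1"] by (auto simp: const_uminus add_eq_0_iff)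
  have "1 - (Yroot \<beta>)\<^sup>2 = (1 - Yroot \<beta>) * (1 + Yroot \<beta>)" by (simp add: algebra_simps power2_eq_square)
  then show "1 - (Yroot \<beta>)\<^sup>2 \<noteq> 0" "1 - Yroot \<beta> \<noteq> 0" "1 + Yroot \<beta> \<noteq> 0" using 1 2 by simp_all
qed

lemma kap_neq_0:
  assumes "\<beta> \<in> all_roots"
  shows "kap \<beta> \<noteq> 0"
proof -
  have "1 - const c * Yroot \<beta> \<noteq> 0" for c
    using const_Yroot_neq_1[OF assms, of c] by auto
  moreover have "1 + const c * Yroot \<beta> \<noteq> 0" for c
    using const_Yroot_neq_1[OF assms, of "- c"] by (auto simp: const_uminus add_eq_0_iff)
  ultimately show ?thesis
    using Yroot_nondegenerate[OF assms] by (simp add: kap_def kap_d_def kap_s_def)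
qed

text \<open>The source of the quadratic Hecke relation. For short roots the constants p and m in the
  numerator are (t_n t_0)^(1/2) and (t_n / t_0)^(1/2), and their product is t_n.\<close>

lemma kap_add_uminus:
  assumes "\<beta> \<in> all_roots"
  shows "kap \<beta> + kap (- \<beta>) = 1 + const (tau (short_root \<beta>))"
proof -
  have s: "(1 - t * z) / (1 - z) + (1 - t * inverse z) / (1 - inverse z) = 1 + t"
    if "z \<noteq> 0" "1 - z \<noteq> 0" for t z :: "'a ratfun"
  proof -
    have "(1 - t * inverse z) / (1 - inverse z) = (t - z) / (1 - z)"
      using that by (simp add: divide_simps) (simp add: algebra_simps)
    then show ?thesis using that by (simp add: divide_simps) (simp add: algebra_simps)
  qed
  have d: "(1 - p * z) * (1 + m * z) / (1 - z\<^sup>2) +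
      (1 - p * inverse z) * (1 + m * inverse z) / (1 - (inverse z)\<^sup>2) = 1 + p * m"
    if "z \<noteq> 0" "1 - z\<^sup>2 \<noteq> 0" for p m z :: "'a ratfun"
  proof -
    have "(1 - p * inverse z) * (1 + m * inverse z) / (1 - (inverse z)\<^sup>2) = - (z - p) * (z + m) / (1 - z\<^sup>2)"
    proof -
      have e1: "(1 - p * inverse z) * (1 + m * inverse z) = (z - p) * (z + m) / z\<^sup>2"
        using that by (simp add: field_simps power2_eq_square)
      have e2: "1 - (inverse z)\<^sup>2 = - (1 - z\<^sup>2) / z\<^sup>2"
        using that by (simp add: field_simps power2_eq_square)
      have "a / u / (- b / u) = - a / b" if "u \<noteq> 0" for a b u :: "'a ratfun"
        using that by (cases "b = 0") (simp_all add: field_simps)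
      from this[of "z\<^sup>2" "(z - p) * (z + m)" "1 - z\<^sup>2"] show ?thesis
        unfolding e1 e2 using that by (simp only: power_not_zero not_False_eq_True mult_minus_left)
    qed
    moreover have "(1 - p * z) * (1 + m * z) + - (z - p) * (z + m) = (1 + p * m) * (1 - z\<^sup>2)"
      by (simp add: algebra_simps power2_eq_square)
    ultimately show ?thesis using that by (simp flip: add_divide_distrib)
  qed
  show ?thesis
    using s[of "Yroot \<beta>" "const ((half Pt)\<^sup>2)"] Yroot_nondegenerate[OF assms]
      d[of "Yroot \<beta>" "const (half Ptn * half Pt0)" "const (half Ptn * inverse (half Pt0))"]
    by (simp add: kap_def kap_d_def kap_s_def Yroot_uminus tau_def power2_eq_square mult.assoc flip: const_mult)
qed

lemma kap_uminus:
  "\<beta> \<in> all_roots \<Longrightarrow> kap (- \<beta>) = 1 + const (tau (short_root \<beta>)) - kap \<beta>"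
  using kap_add_uminus[of \<beta>] by (simp add: algebra_simps)

text \<open>What the braid relation of length three amounts to in coordinates: a rational identity
  in two variables for the positive roots beta, gamma, beta + gamma of a system of type A2.\<close>

lemma kap_rank2_A:
  assumes "\<beta> \<in> all_roots" "\<gamma> \<in> all_roots" "(\<lambda>k. \<beta> k + \<gamma> k) \<in> all_roots"
    "\<not> short_root \<beta>" "\<not> short_root \<gamma>" "\<not> short_root (\<lambda>k. \<beta> k + \<gamma> k)"
  shows "kap \<beta> * kap \<gamma> + kap (- \<beta>) * kap (\<lambda>k. \<beta> k + \<gamma> k) - const (tau False) =
    kap \<gamma> * kap (\<lambda>k. \<beta> k + \<gamma> k)"
proof -
  define x y t where "x = Yroot \<beta>" and "y = Yroot \<gamma>" and "t = (const (tau False) :: 'a ratfun)"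
  have nz: "1 - x \<noteq> 0" "1 - y \<noteq> 0" "1 - x * y \<noteq> 0"
    using Yroot_nondegenerate(1)[OF assms(1)] Yroot_nondegenerate(1)[OF assms(2)]
      Yroot_nondegenerate(1)[OF assms(3)] by (simp_all add: x_def y_def Yroot_add)
  have k: "kap \<beta> = (1 - t * x) / (1 - x)" "kap \<gamma> = (1 - t * y) / (1 - y)"
    "kap (\<lambda>k. \<beta> k + \<gamma> k) = (1 - t * (x * y)) / (1 - x * y)"
    using assms by (simp_all add: kap_def kap_s_def x_def y_def t_def tau_def Yroot_add)
  have k': "kap (- \<beta>) = 1 + t - kap \<beta>" using assms by (simp add: kap_uminus t_def)
  have "(1 - t * x) * (1 - t * y) * (1 - x * y) + ((1 + t) * (1 - x) - (1 - t * x)) * (1 - t * (x * y)) * (1 - y)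
      - t * ((1 - x) * (1 - y) * (1 - x * y)) = (1 - t * y) * (1 - t * (x * y)) * (1 - x)"
    by algebra
  \<comment> \<open>The denominators are made atoms before division, since the polynomial identity
    above is already the numerator.\<close>
  moreover define a b c where "a = 1 - x" "b = 1 - y" "c = 1 - x * y"
  ultimately have "(1 - t * x) * (1 - t * y) * c + ((1 + t) * a - (1 - t * x)) * (1 - t * (x * y)) * b
      - t * (a * b * c) = (1 - t * y) * (1 - t * (x * y)) * a" by simp
  moreover have "a \<noteq> 0" "b \<noteq> 0" "c \<noteq> 0" using nz by (simp_all add: a_b_c_def)
  ultimately show ?thesis
    unfolding k' k t_def[symmetric] a_b_c_def[symmetric]
    by (simp add: divide_simps) (simp add: algebra_simps)
qed

text \<open>The counterpart for the braid relation of length four, with the four positive roots of a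
  rank two system with two root lengths.\<close>

lemma kap_rank2_C:
  assumes "\<beta> \<in> all_roots" "\<gamma> \<in> all_roots" "(\<lambda>k. \<beta> k + \<gamma> k) \<in> all_roots"
    "(\<lambda>k. \<beta> k + 2 * \<gamma> k) \<in> all_roots"
    "\<not> short_root \<beta>" "short_root \<gamma>" "short_root (\<lambda>k. \<beta> k + \<gamma> k)" "\<not> short_root (\<lambda>k. \<beta> k + 2 * \<gamma> k)"
  shows "kap \<beta> * kap \<gamma> + kap (- \<beta>) * kap (\<lambda>k. \<beta> k + \<gamma> k) +
      kap (- \<gamma>) * kap (\<lambda>k. \<beta> k + 2 * \<gamma> k) - const (tau False + tau True) =
    kap (\<lambda>k. \<beta> k + \<gamma> k) * kap (\<lambda>k. \<beta> k + 2 * \<gamma> k)"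
proof -
  define x y t where "x = Yroot \<beta>" and "y = Yroot \<gamma>" and "t = (const (tau False) :: 'a ratfun)"
  define p m where "p = (const (half Ptn * half Pt0) :: 'a ratfun)"
    and "m = (const (half Ptn * inverse (half Pt0)) :: 'a ratfun)"
  have Y4: "Yroot (\<lambda>k. \<beta> k + 2 * \<gamma> k) = x * y\<^sup>2"
    using Yroot_add[of "\<lambda>k. \<beta> k + \<gamma> k" \<gamma>] by (simp add: x_def y_def Yroot_add power2_eq_square mult.assoc add.assoc)
  have nz: "1 - x \<noteq> 0" "1 - y\<^sup>2 \<noteq> 0" "1 - (x * y)\<^sup>2 \<noteq> 0" "1 - x * y\<^sup>2 \<noteq> 0"
    using Yroot_nondegenerate[OF assms(1)] Yroot_nondegenerate[OF assms(2)]
      Yroot_nondegenerate[OF assms(3)] Yroot_nondegenerate[OF assms(4)]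
    unfolding Y4 by (simp_all add: x_def y_def Yroot_add)
  have k: "kap \<beta> = (1 - t * x) / (1 - x)" "kap \<gamma> = (1 - p * y) * (1 + m * y) / (1 - y\<^sup>2)"
    "kap (\<lambda>k. \<beta> k + \<gamma> k) = (1 - p * (x * y)) * (1 + m * (x * y)) / (1 - (x * y)\<^sup>2)"
    "kap (\<lambda>k. \<beta> k + 2 * \<gamma> k) = (1 - t * (x * y\<^sup>2)) / (1 - x * y\<^sup>2)"
    using assms unfolding kap_def kap_s_def kap_d_def Y4
    by (simp_all add: x_def y_def t_def p_def m_def tau_def Yroot_add)
  have T: "const (tau True) = p * m"
    by (simp add: tau_def p_def m_def power2_eq_square flip: const_mult)
  have k': "kap (- \<beta>) = 1 + t - kap \<beta>" "kap (- \<gamma>) = 1 + p * m - kap \<gamma>"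
    using assms by (simp_all add: kap_uminus t_def T)
  \<comment> \<open>The claim after clearing denominators; kap(-beta) and kap(-gamma) enter through
    \<open>kap_add_uminus\<close>, so that only four denominators occur.\<close>
  have key: "(1 - t * x) * ((1 - p * y) * (1 + m * y)) * (1 - (x * y)\<^sup>2) * (1 - x * y\<^sup>2)
      + ((1 + t) * (1 - x) - (1 - t * x)) * ((1 - p * (x * y)) * (1 + m * (x * y))) * (1 - y\<^sup>2) * (1 - x * y\<^sup>2)
      + ((1 + p * m) * (1 - y\<^sup>2) - (1 - p * y) * (1 + m * y)) * (1 - t * (x * y\<^sup>2)) * (1 - x) * (1 - (x * y)\<^sup>2)
      - (t + p * m) * ((1 - x) * (1 - y\<^sup>2) * (1 - (x * y)\<^sup>2) * (1 - x * y\<^sup>2))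
      = ((1 - p * (x * y)) * (1 + m * (x * y))) * (1 - t * (x * y\<^sup>2)) * (1 - x) * (1 - y\<^sup>2)"
    by algebra
  define a b c d where "a = 1 - x" and "b = 1 - y\<^sup>2" and "c = 1 - (x * y)\<^sup>2" and "d = 1 - x * y\<^sup>2"
  define A B C D where "A = 1 - t * x" and "B = (1 - p * y) * (1 + m * y)"
    and "C = (1 - p * (x * y)) * (1 + m * (x * y))" and "D = 1 - t * (x * y\<^sup>2)"
  note defs = a_def[symmetric] b_def[symmetric] c_def[symmetric] d_def[symmetric]
    A_def[symmetric] B_def[symmetric] C_def[symmetric] D_def[symmetric]
  have nz': "a \<noteq> 0" "b \<noteq> 0" "c \<noteq> 0" "d \<noteq> 0" using nz by (simp_all add: a_def b_def c_def d_def)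
  have key': "A * B * c * d + ((1 + t) * a - A) * C * b * d + ((1 + p * m) * b - B) * D * a * c
      - (t + p * m) * (a * b * c * d) = C * D * a * b"
    using key unfolding defs .
  have "A / a * (B / b) + (1 + t - A / a) * (C / c) + (1 + p * m - B / b) * (D / d) - (t + p * m) =
    (A * B * c * d + ((1 + t) * a - A) * C * b * d + ((1 + p * m) * b - B) * D * a * c
      - (t + p * m) * (a * b * c * d)) / (a * b * c * d)"
    using nz' by (simp add: divide_simps) (simp add: algebra_simps)
  also have "\<dots> = C / c * (D / d)" unfolding key' using nz' by simp
  finally show ?thesis
    unfolding k' k const_add T t_def[symmetric] defs .
qed

section \<open>The Demazure-Lusztig operators on functions on the Weyl group\<close>

text \<open>A function \<open>f\<close> stands for the element $\sum_w\eta_w f(w^{-1})$; left multiplication by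
  $t_i^{1/2}T_i$ then becomes \<open>DL i\<close>. Indexing by $w^{-1}$ avoids inverses in the formulas.\<close>

type_synonym 'n wfun = "(('n \<Rightarrow> int) \<Rightarrow> 'n \<Rightarrow> int) \<Rightarrow> 'n ratfun"

text \<open>Left multiplication by (1 + eta_i) kap(alpha_i), that is by t_i^(1/2) T_i + 1, in the
  coordinates w^(-1). The value 0 off \<open>Wfin\<close> makes the operator identities hold at
  every argument.\<close>

definition BL :: "'n \<Rightarrow> 'n wfun \<Rightarrow> ('n::{finite,linorder}) wfun" where
  "BL i f v = (if v \<in> Wfin then kap (v (root_fin i)) * f v + kap (- v (root_fin i)) * f (v \<circ> refl_fin i) else 0)"

definition DL :: "'n \<Rightarrow> 'n wfun \<Rightarrow> ('n::{finite,linorder}) wfun" where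
  "DL i f = (\<lambda>v. BL i f v - f v)"

lemma BL_linear:
  "BL i (\<lambda>v. f v - g v) = (\<lambda>v. BL i f v - BL i g v)"
  "BL i (\<lambda>v. f v + g v) = (\<lambda>v. BL i f v + BL i g v)"
  "BL i (\<lambda>v. c * f v) = (\<lambda>v. c * BL i f v)"
  by (auto simp: BL_def fun_eq_iff algebra_simps)

lemma refl_fin_comp_comp [simp]: "v \<circ> refl_fin i \<circ> refl_fin i = v"
  by (simp add: comp_assoc)

text \<open>\<open>BL i f\<close> takes the same value at v and at v s_i, and on such functions the
  operator multiplies by kap(beta) + kap(-beta) with beta = v alpha_i.\<close>

lemma BL_BL: "BL i (BL i f) = (\<lambda>v. (1 + const (tau (i = last_ix))) * BL i f v)"
proof
  fix v
  show "BL i (BL i f) v = (1 + const (tau (i = last_ix))) * BL i f v"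
  proof (cases "v \<in> Wfin")
    case True
    have sum: "kap (v (root_fin i)) + kap (- v (root_fin i)) = 1 + const (tau (i = last_ix))"
      using True kap_add_uminus[of "v (root_fin i)"] by simp
    have "(v \<circ> refl_fin i) (root_fin i) = - v (root_fin i)"
      using True by (simp add: refl_fin_root_fin Wfin_uminus)
    then have BL_v:
      "BL i g v = kap (v (root_fin i)) * g v + kap (- v (root_fin i)) * g (v \<circ> refl_fin i)"
      "BL i g (v \<circ> refl_fin i) = kap (- v (root_fin i)) * g (v \<circ> refl_fin i) + kap (v (root_fin i)) * g v" for g
      using True by (simp_all add: BL_def del: comp_apply)
    show ?thesis unfolding BL_v using sum by algebra
  qed (simp add: BL_def)
qed

lemma DL_DL: "DL i (DL i f) v = (const (tau (i = last_ix)) - 1) * DL i f v + const (tau (i = last_ix)) * f v"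
  by (simp add: DL_def BL_linear BL_BL algebra_simps)

lemma Wfin_lincomb: "w \<in> Wfin \<Longrightarrow> w (\<lambda>k. a * x k + b * y k) = (\<lambda>k. a * w x k + b * w y k)"
  by (drule Wfin_signed_perm) (auto simp: signed_perm_def algebra_simps fun_eq_iff)

lemma BL_eval:
  assumes "v \<in> Wfin" "v (root_fin i) = \<beta>"
  shows "BL i f v = kap \<beta> * f v + kap (- \<beta>) * f (v \<circ> refl_fin i)"
  using assms by (simp add: BL_def)

text \<open>The braid relation for the operators \<open>BL i\<close> - 1: expanding the products and
  using the quadratic relation leaves just the correction t \<open>BL i\<close>.\<close>

lemma BL_braid3:
  assumes i: "i \<noteq> last_ix" "next_ix i \<noteq> last_ix"
  shows "BL i (BL (next_ix i) (BL i f)) v - const (tau False) * BL i f v =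
    BL (next_ix i) (BL i (BL (next_ix i) f)) v - const (tau False) * BL (next_ix i) f v"
proof (cases "v \<in> Wfin")
  case v: True
  define j where "j = next_ix i"
  define \<beta> \<gamma> where "\<beta> = v (root_fin i)" and "\<gamma> = v (root_fin j)"
  define \<delta> where "\<delta> = (\<lambda>k. \<beta> k + \<gamma> k)"
  let ?s = "refl_fin i" and ?r = "refl_fin j"
  have ij: "?s (root_fin j) = (\<lambda>k. root_fin i k + root_fin j k)" "?r (root_fin i) = (\<lambda>k. root_fin i k + root_fin j k)"
    using refl_fin_root_next[OF i(1)] i by (simp_all add: j_def)
  have vij: "v (\<lambda>k. root_fin i k + root_fin j k) = \<delta>"
    using v by (simp add: \<beta>_def \<gamma>_def \<delta>_def Wfin_add)
  have uminus_v: "v (- x) = - v x" for x using v by (rule Wfin_uminus)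
  have mem: "\<And>k. v \<circ> refl_fin k \<in> Wfin" "\<And>k l. v \<circ> refl_fin k \<circ> refl_fin l \<in> Wfin" using v by auto
  have s3: "?s (\<lambda>k. root_fin i k + root_fin j k) = root_fin j" "?r (\<lambda>k. root_fin i k + root_fin j k) = root_fin i"
    using refl_fin_refl_fin[of i "root_fin j"] refl_fin_refl_fin[of j "root_fin i"] unfolding ij by simp_all
  have roots: "\<beta> \<in> all_roots" "\<gamma> \<in> all_roots" "\<delta> \<in> all_roots"
    using v refl_fin_all_roots[of "root_fin j" i] unfolding vij[symmetric] ij[symmetric] by (simp_all add: \<beta>_def \<gamma>_def)
  have long: "\<not> short_root \<beta>" "\<not> short_root \<gamma>" "\<not> short_root \<delta>"
    using v i short_root_refl_fin[of i "root_fin j"] unfolding vij[symmetric] ij[symmetric] by (simp_all add: \<beta>_def \<gamma>_def j_def)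
  \<comment> \<open>The values needed on the coset of v under the rank two subgroup; only the roots
    beta, gamma, delta and their negatives occur.\<close>
  have e: "BL i g v = kap \<beta> * g v + kap (- \<beta>) * g (v \<circ> ?s)"
    "BL j g v = kap \<gamma> * g v + kap (- \<gamma>) * g (v \<circ> ?r)"
    "BL i g (v \<circ> ?s) = kap (- \<beta>) * g (v \<circ> ?s) + kap \<beta> * g v"
    "BL j g (v \<circ> ?r) = kap (- \<gamma>) * g (v \<circ> ?r) + kap \<gamma> * g v"
    "BL j g (v \<circ> ?s) = kap \<delta> * g (v \<circ> ?s) + kap (- \<delta>) * g (v \<circ> ?s \<circ> ?r)"
    "BL i g (v \<circ> ?r) = kap \<delta> * g (v \<circ> ?r) + kap (- \<delta>) * g (v \<circ> ?r \<circ> ?s)"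
    "BL i g (v \<circ> ?s \<circ> ?r) = kap \<gamma> * g (v \<circ> ?s \<circ> ?r) + kap (- \<gamma>) * g (v \<circ> ?s \<circ> ?r \<circ> ?s)"
    "BL j g (v \<circ> ?r \<circ> ?s) = kap \<beta> * g (v \<circ> ?r \<circ> ?s) + kap (- \<beta>) * g (v \<circ> ?r \<circ> ?s \<circ> ?r)" for g
    using BL_eval[OF v \<beta>_def[symmetric], of g] BL_eval[OF v \<gamma>_def[symmetric], of g]
      BL_eval[OF mem(1), of i i "- \<beta>" g] BL_eval[OF mem(1), of j j "- \<gamma>" g]
      BL_eval[OF mem(1), of i j \<delta> g] BL_eval[OF mem(1), of j i \<delta> g]
      BL_eval[OF mem(2), of i j i \<gamma> g] BL_eval[OF mem(2), of j i j \<beta> g]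
    by (simp_all add: refl_fin_root_fin ij vij s3 uminus_v \<beta>_def[symmetric] \<gamma>_def[symmetric])
  have same: "v \<circ> ?s \<circ> ?r \<circ> ?s = v \<circ> ?r \<circ> ?s \<circ> ?r"
    by (rule ext) (simp add: refl_fin_braid3[OF i, folded j_def])
  have R1: "kap \<beta> * kap \<gamma> + kap (- \<beta>) * kap \<delta> - const (tau False) = kap \<gamma> * kap \<delta>"
    using kap_rank2_A[of \<beta> \<gamma>] roots long by (simp add: \<delta>_def)
  have R2: "kap \<gamma> * kap \<beta> + kap (- \<gamma>) * kap \<delta> - const (tau False) = kap \<beta> * kap \<delta>"
    using kap_rank2_A[of \<gamma> \<beta>] roots long by (simp add: \<delta>_def add.commute)
  show ?thesis
    unfolding j_def[symmetric] e same using R1 R2 by algebra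
qed (simp add: BL_def)

text \<open>As for length three. Here the two quadratic relations, with constants t and t_n,
  together contribute (t + t_n) times the product of the two operators.\<close>

lemma BL_braid4:
  assumes i: "i \<noteq> last_ix" "next_ix i = last_ix"
  defines "c \<equiv> const (tau False + tau True)"
  shows "BL i (BL (next_ix i) (BL i (BL (next_ix i) f))) v - c * BL i (BL (next_ix i) f) v =
    BL (next_ix i) (BL i (BL (next_ix i) (BL i f))) v - c * BL (next_ix i) (BL i f) v"
proof (cases "v \<in> Wfin")
  case v: True
  define j where "j = next_ix i"
  let ?s = "refl_fin i" and ?r = "refl_fin j"
  \<comment> \<open>The two remaining positive roots of the rank two system, as functions of the
    group element.\<close>
  let ?\<delta> = "\<lambda>u k. u (root_fin i) k + u (root_fin j) k"
  let ?\<theta> = "\<lambda>u k. u (root_fin i) k + 2 * u (root_fin j) k"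
  have ij: "?s (root_fin j) = (\<lambda>k. root_fin i k + root_fin j k)" "?r (root_fin i) = (\<lambda>k. root_fin i k + 2 * root_fin j k)"
    using refl_fin_root_next[OF i(1)] i by (simp_all add: j_def)
  have step: "(u \<circ> ?s) (root_fin i) = - u (root_fin i)" "(u \<circ> ?s) (root_fin j) = ?\<delta> u"
    "(u \<circ> ?r) (root_fin j) = - u (root_fin j)" "(u \<circ> ?r) (root_fin i) = ?\<theta> u" if "u \<in> Wfin" for u
    using that Wfin_lincomb[OF that, of 1 _ 2] by (simp_all add: refl_fin_root_fin Wfin_uminus ij Wfin_add)
  have rank2: "kap (u (root_fin i)) * kap (u (root_fin j)) + kap (- u (root_fin i)) * kap (?\<delta> u) +
      kap (- u (root_fin j)) * kap (?\<theta> u) - c = kap (?\<delta> u) * kap (?\<theta> u)" if u: "u \<in> Wfin" for u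
    unfolding c_def
  proof (rule kap_rank2_C)
    show "?\<delta> u \<in> all_roots" "?\<theta> u \<in> all_roots" "short_root (?\<delta> u)" "\<not> short_root (?\<theta> u)"
      using u i unfolding step(2,4)[OF u, symmetric] by (auto simp: j_def intro!: refl_fin_all_roots)
  qed (use u i in \<open>auto simp: j_def\<close>)
  define \<beta> \<gamma> \<delta> \<theta> where "\<beta> = v (root_fin i)" and "\<gamma> = v (root_fin j)" and "\<delta> = ?\<delta> v" and "\<theta> = ?\<theta> v"
  have mem: "\<And>k. v \<circ> refl_fin k \<in> Wfin" "\<And>k l. v \<circ> refl_fin k \<circ> refl_fin l \<in> Wfin"
    "\<And>k l m. v \<circ> refl_fin k \<circ> refl_fin l \<circ> refl_fin m \<in> Wfin" using v by auto
  have vs: "(v \<circ> ?s) (root_fin i) = - \<beta>" "(v \<circ> ?s) (root_fin j) = \<delta>"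
    "(v \<circ> ?r) (root_fin i) = \<theta>" "(v \<circ> ?r) (root_fin j) = - \<gamma>"
    using step[OF v] by (simp_all add: \<beta>_def \<gamma>_def \<delta>_def \<theta>_def)
  have d1: "?\<delta> (v \<circ> ?s) = \<gamma>" "?\<theta> (v \<circ> ?s) = \<theta>" "?\<delta> (v \<circ> ?r) = \<delta>" "?\<theta> (v \<circ> ?r) = \<beta>"
    unfolding vs by (auto simp: \<beta>_def \<gamma>_def \<delta>_def \<theta>_def fun_eq_iff uminus_apply)
  have vsr: "(v \<circ> ?s \<circ> ?r) (root_fin i) = \<theta>" "(v \<circ> ?s \<circ> ?r) (root_fin j) = - \<delta>"
    "(v \<circ> ?r \<circ> ?s) (root_fin i) = - \<theta>" "(v \<circ> ?r \<circ> ?s) (root_fin j) = \<delta>"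
    using step[OF mem(1)] by (simp_all only: vs d1[unfolded vs])
  have d2: "?\<delta> (v \<circ> ?s \<circ> ?r) = \<gamma>" "?\<theta> (v \<circ> ?r \<circ> ?s) = \<beta>"
    unfolding vsr by (auto simp: \<beta>_def \<gamma>_def \<delta>_def \<theta>_def fun_eq_iff uminus_apply)
  have vsrs: "(v \<circ> ?s \<circ> ?r \<circ> ?s) (root_fin j) = \<gamma>" "(v \<circ> ?r \<circ> ?s \<circ> ?r) (root_fin i) = \<beta>"
    using step[OF mem(2)] by (simp_all only: vsr d2[unfolded vsr])
  have e: "BL i g v = kap \<beta> * g v + kap (- \<beta>) * g (v \<circ> ?s)"
    "BL j g v = kap \<gamma> * g v + kap (- \<gamma>) * g (v \<circ> ?r)"
    "BL i g (v \<circ> ?s) = kap (- \<beta>) * g (v \<circ> ?s) + kap \<beta> * g v"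
    "BL j g (v \<circ> ?r) = kap (- \<gamma>) * g (v \<circ> ?r) + kap \<gamma> * g v"
    "BL j g (v \<circ> ?s) = kap \<delta> * g (v \<circ> ?s) + kap (- \<delta>) * g (v \<circ> ?s \<circ> ?r)"
    "BL i g (v \<circ> ?r) = kap \<theta> * g (v \<circ> ?r) + kap (- \<theta>) * g (v \<circ> ?r \<circ> ?s)"
    "BL i g (v \<circ> ?s \<circ> ?r) = kap \<theta> * g (v \<circ> ?s \<circ> ?r) + kap (- \<theta>) * g (v \<circ> ?s \<circ> ?r \<circ> ?s)"
    "BL j g (v \<circ> ?r \<circ> ?s) = kap \<delta> * g (v \<circ> ?r \<circ> ?s) + kap (- \<delta>) * g (v \<circ> ?r \<circ> ?s \<circ> ?r)"
    "BL j g (v \<circ> ?s \<circ> ?r) = kap (- \<delta>) * g (v \<circ> ?s \<circ> ?r) + kap \<delta> * g (v \<circ> ?s)"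
    "BL i g (v \<circ> ?r \<circ> ?s) = kap (- \<theta>) * g (v \<circ> ?r \<circ> ?s) + kap \<theta> * g (v \<circ> ?r)"
    "BL j g (v \<circ> ?s \<circ> ?r \<circ> ?s) = kap \<gamma> * g (v \<circ> ?s \<circ> ?r \<circ> ?s) + kap (- \<gamma>) * g (v \<circ> ?s \<circ> ?r \<circ> ?s \<circ> ?r)"
    "BL i g (v \<circ> ?r \<circ> ?s \<circ> ?r) = kap \<beta> * g (v \<circ> ?r \<circ> ?s \<circ> ?r) + kap (- \<beta>) * g (v \<circ> ?r \<circ> ?s \<circ> ?r \<circ> ?s)" for g
    using BL_eval[OF v \<beta>_def[symmetric], of g] BL_eval[OF v \<gamma>_def[symmetric], of g]
      BL_eval[OF mem(1) vs(1), of g] BL_eval[OF mem(1) vs(2), of g]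
      BL_eval[OF mem(1) vs(3), of g] BL_eval[OF mem(1) vs(4), of g]
      BL_eval[OF mem(2) vsr(1), of g] BL_eval[OF mem(2) vsr(2), of g]
      BL_eval[OF mem(2) vsr(3), of g] BL_eval[OF mem(2) vsr(4), of g]
      BL_eval[OF mem(3) vsrs(1), of g] BL_eval[OF mem(3) vsrs(2), of g]
    by (simp_all del: comp_apply)
  have same: "v \<circ> ?s \<circ> ?r \<circ> ?s \<circ> ?r = v \<circ> ?r \<circ> ?s \<circ> ?r \<circ> ?s"
    by (rule ext) (simp add: refl_fin_braid4[OF i, folded j_def])
  \<comment> \<open>The rank two identity at v, v s_i and v s_j; together these match all
    coefficients on the coset.\<close>
  have R: "kap \<beta> * kap \<gamma> + kap (- \<beta>) * kap \<delta> + kap (- \<gamma>) * kap \<theta> - c = kap \<delta> * kap \<theta>"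
    "kap (- \<beta>) * kap \<delta> + kap \<beta> * kap \<gamma> + kap (- \<delta>) * kap \<theta> - c = kap \<gamma> * kap \<theta>"
    "kap \<theta> * kap (- \<gamma>) + kap (- \<theta>) * kap \<delta> + kap \<gamma> * kap \<beta> - c = kap \<delta> * kap \<beta>"
    using rank2[OF v, folded \<beta>_def \<gamma>_def, folded \<delta>_def[folded \<beta>_def \<gamma>_def] \<theta>_def[folded \<beta>_def \<gamma>_def]]
      rank2[OF mem(1), of i, unfolded vs d1[unfolded vs]] rank2[OF mem(1), of j, unfolded vs d1[unfolded vs]]
    by (simp_all only: uminus_uminus_fun)
  show ?thesis
    unfolding j_def[symmetric] e same using R by algebra
qed (simp add: BL_def)

lemma BL_commute:
  assumes ij: "i \<noteq> j" "\<not> adjacent i j"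
  shows "BL i (BL j f) v = BL j (BL i f) v"
proof (cases "v \<in> Wfin")
  case v: True
  have ji: "\<not> adjacent j i" using ij by (auto simp: adjacent_def)
  have same: "v \<circ> refl_fin i \<circ> refl_fin j = v \<circ> refl_fin j \<circ> refl_fin i"
    by (rule ext) (simp only: comp_apply refl_fin_commute[OF ij])
  have "(v \<circ> refl_fin i) (root_fin j) = v (root_fin j)" "(v \<circ> refl_fin j) (root_fin i) = v (root_fin i)"
    using refl_fin_root_commute[OF ij] refl_fin_root_commute[OF ij(1)[symmetric] ji] by simp_all
  then show ?thesis
    using v same unfolding BL_def by (simp add: algebra_simps del: comp_apply)
qed (simp add: BL_def)

lemma DL_commute: "i \<noteq> j \<Longrightarrow> \<not> adjacent i j \<Longrightarrow> DL i (DL j f) = DL j (DL i f)"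
  using BL_commute[of i j f] by (simp add: DL_def BL_linear fun_eq_iff algebra_simps)

lemma DL_braid3:
  assumes "i \<noteq> last_ix" "next_ix i \<noteq> last_ix"
  shows "DL i (DL (next_ix i) (DL i f)) = DL (next_ix i) (DL i (DL (next_ix i) f))"
proof
  fix v
  show "DL i (DL (next_ix i) (DL i f)) v = DL (next_ix i) (DL i (DL (next_ix i) f)) v"
    using BL_braid3[OF assms, of f v] assms by (simp add: DL_def BL_linear BL_BL algebra_simps)
qed

lemma DL_braid4:
  assumes "i \<noteq> last_ix" "next_ix i = last_ix"
  shows "DL i (DL (next_ix i) (DL i (DL (next_ix i) f))) = DL (next_ix i) (DL i (DL (next_ix i) (DL i f)))"
proof
  fix v
  show "DL i (DL (next_ix i) (DL i (DL (next_ix i) f))) v = DL (next_ix i) (DL i (DL (next_ix i) (DL i f))) v"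
    using BL_braid4[OF assms, of f v] assms by (simp add: DL_def BL_linear BL_BL const_add algebra_simps)
qed

section \<open>Eigenfunctions of the Demazure-Lusztig operators\<close>

text \<open>Group elements are from here on composed as wholes, not evaluated at vectors by
  default.\<close>

declare comp_apply [simp del] id_apply [simp del]

lemma rword_id [simp]: "rword id = []"
  using length_rword[OF id_Wfin] by (simp)

text \<open>Induction along a reduced word. Quantities such as T_w satisfy a simple recursion only
  when the length goes up.\<close>

lemma Wfin_up_induct [consumes 1, case_names id step]:
  assumes "w \<in> Wfin" and id: "P id"
    and step: "\<And>i w. w \<in> Wfin \<Longrightarrow> \<not> descent i w \<Longrightarrow> P w \<Longrightarrow> P (refl_fin i \<circ> w)"
  shows "P w"
proof -
  have "P (word_act ws)" if "reduced ws" for ws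
    using that
  proof (induction ws)
    case Nil
    show ?case using id by (simp only: word_act_Nil)
  next
    case (Cons i ws)
    then show ?case unfolding word_act_Cons by (intro step) (auto simp: reduced_Cons)
  qed
  from this[OF reduced_rword[OF assms(1)]] show ?thesis by (simp only: word_act_rword[OF assms(1)])
qed

lemma reduced_Cons_rword:
  assumes "w \<in> Wfin" "\<not> descent i w"
  shows "reduced (i # rword w)" "word_act (i # rword w) = word_act (rword (refl_fin i \<circ> w))"
    "reduced (rword (refl_fin i \<circ> w))"
  using assms by (simp_all add: reduced_Cons reduced_rword word_act_rword)

text \<open>Matsumoto's theorem for an arbitrary family in a monoid with the braid relations; it
  yields the recursions for the Hecke characters, the signs and the eta_w.\<close>

lemma prod_list_rword_up:
  fixes g :: "'n::{finite,linorder} \<Rightarrow> 'a::monoid_mult"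
  assumes comm: "\<And>i j. i \<noteq> j \<Longrightarrow> \<not> adjacent i j \<Longrightarrow> g i * g j = g j * g i"
    and b3: "\<And>i. i \<noteq> last_ix \<Longrightarrow> next_ix i \<noteq> last_ix \<Longrightarrow>
      g i * g (next_ix i) * g i = g (next_ix i) * g i * g (next_ix i)"
    and b4: "\<And>i. i \<noteq> last_ix \<Longrightarrow> next_ix i = last_ix \<Longrightarrow>
      g i * g (next_ix i) * g i * g (next_ix i) = g (next_ix i) * g i * g (next_ix i) * g i"
    and w: "w \<in> Wfin" "\<not> descent i w"
  shows "prod_list (map g (rword (refl_fin i \<circ> w))) = g i * prod_list (map g (rword w))"
proof -
  have "prod_list (map g (i # rword w)) = prod_list (map g (rword (refl_fin i \<circ> w)))"
  proof (rule reduced_words_related[where R = "\<lambda>ws vs. prod_list (map g ws) = prod_list (map g vs)"])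
    fix i j :: 'n and ws assume "i \<noteq> j" "\<not> adjacent i j"
    from comm[OF this] show "prod_list (map g (i # j # ws)) = prod_list (map g (j # i # ws))"
      by (simp flip: mult.assoc)
  next
    fix i :: 'n and ws assume "i \<noteq> last_ix" "next_ix i \<noteq> last_ix"
    from b3[OF this] show "prod_list (map g (i # next_ix i # i # ws)) =
        prod_list (map g (next_ix i # i # next_ix i # ws))"
      by (simp flip: mult.assoc)
  next
    fix i :: 'n and ws assume "i \<noteq> last_ix" "next_ix i = last_ix"
    from b4[OF this] show "prod_list (map g (i # next_ix i # i # next_ix i # ws)) =
        prod_list (map g (next_ix i # i # next_ix i # i # ws))"
      by (simp flip: mult.assoc)
  qed (use reduced_Cons_rword[OF w] in \<open>simp_all del: comp_apply\<close>)
  then show ?thesis by simp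
qed

definition delta_fun :: "('n::{finite,linorder}) wfun" where
  "delta_fun v = (if v = id then 1 else 0)"

text \<open>The coordinates of chi^+(T_w) T_w: each \<open>DL i\<close> brings along its factor
  t_i^(1/2) (see \<open>realize_DLe\<close>).\<close>

definition DLe :: "(('n \<Rightarrow> int) \<Rightarrow> 'n \<Rightarrow> int) \<Rightarrow> ('n::{finite,linorder}) wfun" where
  "DLe w = foldr DL (rword w) delta_fun"

lemma DLe_id: "DLe id = delta_fun"
  unfolding DLe_def rword_id by (simp add: id_apply)

lemma DLe_up:
  assumes "w \<in> Wfin" "\<not> descent i w"
  shows "DLe (refl_fin i \<circ> w) = DL i (DLe w)"
proof -
  have "foldr DL (i # rword w) delta_fun = foldr DL (rword (refl_fin i \<circ> w)) delta_fun"
  proof (rule reduced_words_related[where R = "\<lambda>ws vs. foldr DL ws delta_fun = foldr DL vs delta_fun"])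
    fix i j :: 'a and ws assume "i \<noteq> j" "\<not> adjacent i j"
    from DL_commute[OF this] show "foldr DL (i # j # ws) delta_fun = foldr DL (j # i # ws) delta_fun"
      by (simp add: comp_apply)
  next
    fix i :: 'a and ws assume "i \<noteq> last_ix" "next_ix i \<noteq> last_ix"
    from DL_braid3[OF this] show "foldr DL (i # next_ix i # i # ws) delta_fun =
        foldr DL (next_ix i # i # next_ix i # ws) delta_fun"
      by (simp add: comp_apply)
  next
    fix i :: 'a and ws assume "i \<noteq> last_ix" "next_ix i = last_ix"
    from DL_braid4[OF this] show "foldr DL (i # next_ix i # i # next_ix i # ws) delta_fun =
        foldr DL (next_ix i # i # next_ix i # i # ws) delta_fun"
      by (simp only: foldr_Cons comp_apply)
  qed (use reduced_Cons_rword[OF assms] in \<open>simp_all add: comp_apply\<close>)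
  then show ?thesis by (simp add: DLe_def comp_apply)
qed

text \<open>beta \<mapsto> - w beta matches the inversions of w with those of its inverse.\<close>

lemma card_inv_set_inv:
  assumes "w \<in> Wfin"
  shows "card (inv_set (inv w)) = card (inv_set w)"
proof (rule bij_betw_same_card[symmetric])
  show "bij_betw (\<lambda>\<beta>. - w \<beta>) (inv_set w) (inv_set (inv w))"
    by (rule bij_betw_byWitness[where f' = "\<lambda>\<beta>. - inv w \<beta>"])
      (use assms uminus_pos_roots_D in \<open>auto simp: inv_set_def Wfin_uminus uminus_pos_roots_iff\<close>)
qed

lemma card_inv_set_comp_refl:
  assumes "v \<in> Wfin"
  shows "card (inv_set v) \<le> Suc (card (inv_set (v \<circ> refl_fin i)))"
    and "v (root_fin i) \<in> pos_roots \<Longrightarrow> card (inv_set (v \<circ> refl_fin i)) = Suc (card (inv_set v))"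
proof -
  have eq: "card (inv_set (v \<circ> refl_fin i)) = card (inv_set (refl_fin i \<circ> inv v))"
    using card_inv_set_inv[of "v \<circ> refl_fin i"] assms by (simp add: inv_comp_distrib_Wfin)
  show "card (inv_set v) \<le> Suc (card (inv_set (v \<circ> refl_fin i)))"
    unfolding eq card_inv_set_inv[OF assms, symmetric]
    using card_inv_set_up[of "inv v" i] card_inv_set_down[of "inv v" i] assms
    by (cases "descent i (inv v)") auto
  show "v (root_fin i) \<in> pos_roots \<Longrightarrow> card (inv_set (v \<circ> refl_fin i)) = Suc (card (inv_set v))"
    unfolding eq card_inv_set_inv[OF assms, symmetric]
    using assms by (intro card_inv_set_up) (auto simp: descent_def)
qed

lemma DL_eval:
  "v \<in> Wfin \<Longrightarrow> DL i f v = (kap (v (root_fin i)) - 1) * f v + kap (- v (root_fin i)) * f (v \<circ> refl_fin i)"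
  by (simp add: DL_def BL_def algebra_simps)

text \<open>Triangularity: T_w involves only eta_u with u no longer than w. Left multiplication by
  T_i reaches only neighbours under v \<mapsto> v s_i, and these differ in length by one.\<close>

lemma DLe_support:
  assumes "w \<in> Wfin" "v \<in> Wfin" "card (inv_set w) < card (inv_set v)"
  shows "DLe w v = 0"
  using assms
proof (induction w arbitrary: v rule: Wfin_up_induct)
  case id
  then show ?case by (auto simp: DLe_id delta_fun_def)
next
  case (step i w)
  have "Suc (card (inv_set w)) < card (inv_set v)" using step card_inv_set_up[of w i] by simp
  then have "card (inv_set w) < card (inv_set v)" "card (inv_set w) < card (inv_set (v \<circ> refl_fin i))"
    using card_inv_set_comp_refl(1)[OF step.prems(1), of i] by linarith+
  then show ?case using step by (simp add: DLe_up DL_eval)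
qed

text \<open>The leading coefficient of T_w. At the new top element the diagonal term of
  \<open>DL i\<close> vanishes by triangularity, so each step contributes one factor, at the new
  inversion w^(-1) alpha_i.\<close>

lemma DLe_top: "w \<in> Wfin \<Longrightarrow> DLe w (inv w) = (\<Prod>\<beta>\<in>inv_set w. kap \<beta>)"
proof (induction w rule: Wfin_up_induct)
  case id
  show ?case unfolding inv_set_id DLe_id by (simp add: delta_fun_def)
next
  case (step i w)
  let ?v = "inv w \<circ> refl_fin i"
  have pos: "inv w (root_fin i) \<in> pos_roots" using step by (simp add: descent_def)
  have "card (inv_set w) < card (inv_set ?v)"
    using card_inv_set_comp_refl(2)[of "inv w" i] pos step.hyps(1) by (simp add: card_inv_set_inv)
  then have "DLe w ?v = 0" using step by (intro DLe_support) auto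
  moreover have "- ?v (root_fin i) = inv w (root_fin i)"
    using step by (simp add: comp_apply refl_fin_root_fin Wfin_uminus)
  ultimately have "DL i (DLe w) ?v = kap (inv w (root_fin i)) * DLe w (inv w)"
    using step by (subst DL_eval) (simp_all)
  then show ?case
    using step inv_set_refl_fin_up[OF step.hyps(1) pos] by (simp add: DLe_up inv_comp_distrib_Wfin)
qed

section \<open>The four characters and their signs\<close>

definition plus_on :: "character \<Rightarrow> bool \<Rightarrow> bool" where
  "plus_on \<Xi> b \<longleftrightarrow> (if b then \<Xi> \<in> {PP, MP} else \<Xi> \<in> {PP, PM})"

definition half_simple :: "'n::{finite,linorder} \<Rightarrow> K" where
  "half_simple i = (if i = last_ix then half Ptn else half Pt)"

lemma half_simple_neq_0 [simp]: "half_simple i \<noteq> 0"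
  by (simp add: half_simple_def)

lemma half_simple_sq: "(half_simple i)\<^sup>2 = tau (i = last_ix)"
  by (simp add: half_simple_def tau_def)

lemma chi_eq: "chi \<Xi> i = (if plus_on \<Xi> (i = last_ix) then half_simple i else - inverse (half_simple i))"
  by (simp add: chi_def plus_on_def half_simple_def)

lemma plus_on_PP [simp]: "plus_on PP b"
  by (simp add: plus_on_def)

lemma chi_neq_0 [simp]: "chi \<Xi> i \<noteq> 0"
  by (simp add: chi_eq)

lemma chi_T_neq_0 [simp]: "chi_T \<Xi> w \<noteq> 0"
  by (simp add: chi_T_def prod_list_zero_iff image_iff)

lemma chi_T_up:
  "w \<in> Wfin \<Longrightarrow> \<not> descent i w \<Longrightarrow> chi_T \<Xi> (refl_fin i \<circ> w) = chi \<Xi> i * chi_T \<Xi> w"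
  unfolding chi_T_def by (rule prod_list_rword_up) (auto simp: chi_def)

definition sign_simple :: "character \<Rightarrow> 'n::{finite,linorder} \<Rightarrow> K" where
  "sign_simple \<Xi> i = (if plus_on \<Xi> (i = last_ix) then 1 else - 1)"

text \<open>The character of the Weyl group to which chi^Xi specializes when t and t_n become
  1.\<close>

definition sign_W :: "character \<Rightarrow> (('n::{finite,linorder} \<Rightarrow> int) \<Rightarrow> 'n \<Rightarrow> int) \<Rightarrow> K" where
  "sign_W \<Xi> w = prod_list (map (sign_simple \<Xi>) (rword w))"

lemma sign_simple_sq [simp]: "sign_simple \<Xi> i * sign_simple \<Xi> i = 1" "sign_simple \<Xi> i * (sign_simple \<Xi> i * x) = x"
  by (simp_all add: sign_simple_def)

lemma sign_W_refl:
  assumes "w \<in> Wfin"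
  shows "sign_W \<Xi> (refl_fin i \<circ> w) = sign_simple \<Xi> i * sign_W \<Xi> w"
proof -
  have up: "sign_W \<Xi> (refl_fin i \<circ> w) = sign_simple \<Xi> i * sign_W \<Xi> w"
    if "w \<in> Wfin" "\<not> descent i w" for w
    unfolding sign_W_def using that by (intro prod_list_rword_up) (auto simp: sign_simple_def)
  show ?thesis
  proof (cases "descent i w")
    case True
    have "sign_W \<Xi> (refl_fin i \<circ> (refl_fin i \<circ> w)) = sign_simple \<Xi> i * sign_W \<Xi> (refl_fin i \<circ> w)"
      using assms True by (intro up) (auto simp: descent_refl_fin)
    then show ?thesis by simp
  qed (rule up[OF assms])
qed

lemma sign_W_id [simp]: "sign_W \<Xi> id = 1"
  unfolding sign_W_def rword_id by simp

lemma sign_W_comp: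
  assumes "w \<in> Wfin" "u \<in> Wfin"
  shows "sign_W \<Xi> (w \<circ> u) = sign_W \<Xi> w * sign_W \<Xi> u"
  using assms
proof (induction w rule: Wfin_induct)
  case id
  then show ?case by (simp)
next
  case (step i w)
  then show ?case by (simp add: comp_assoc sign_W_refl)
qed

lemma sign_W_sq: "w \<in> Wfin \<Longrightarrow> sign_W \<Xi> w * sign_W \<Xi> w = 1"
  by (induction w rule: Wfin_induct) (simp_all add: sign_W_refl mult.assoc mult.left_commute)

text \<open>The stabilizer of a dominant weight as a parabolic subgroup. The weight 0 gives the full
  group, so the results below apply to both symmetrizers.\<close>

locale dominant =
  fixes \<nu> :: "'n::{finite,linorder} \<Rightarrow> int"
  assumes dominant: "\<And>i. pairing \<nu> (root_fin i) \<ge> 0"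
begin

abbreviation "W \<equiv> Wstab \<nu>"

definition "roots_stab = {\<beta> \<in> pos_roots. pairing \<nu> \<beta> = 0}"

lemma pairing_pos_roots: "\<beta> \<in> pos_roots \<Longrightarrow> pairing \<nu> \<beta> \<ge> 0"
  by (induction \<beta> rule: pos_roots_induct) (auto simp: dominant pairing_linear)

lemma W_Wfin: "w \<in> W \<Longrightarrow> w \<in> Wfin"
  by (simp add: Wstab_def)

lemma finite_W [simp]: "finite W"
  by (rule finite_subset[OF _ finite_Wfin]) (auto simp: Wstab_def)

lemma finite_roots_stab [simp]: "finite roots_stab"
  by (simp add: roots_stab_def)

lemma id_W: "id \<in> W"
  by (simp add: id_apply Wstab_def)

lemma comp_W: "w \<in> W \<Longrightarrow> u \<in> W \<Longrightarrow> w \<circ> u \<in> W"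
  by (auto simp: comp_apply Wstab_def)

lemma inv_W: "w \<in> W \<Longrightarrow> inv w \<in> W"
  unfolding Wstab_def using inv_apply_Wfin(1)[of w \<nu>] by auto

lemma refl_W: "refl_fin i \<in> W \<longleftrightarrow> pairing \<nu> (root_fin i) = 0"
  by (simp add: Wstab_def refl_fin_fix_iff)

lemma pairing_W: "w \<in> W \<Longrightarrow> pairing \<nu> (w \<beta>) = pairing \<nu> \<beta>"
  using pairing_Wfin[of w \<nu> \<beta>] by (simp add: Wstab_def)

text \<open>- w^(-1) alpha_i is positive, so its product with nu is nonnegative; by invariance this
  product is minus that of alpha_i, hence both vanish. Thus reduced words of stabilizer elements
  stay in the stabilizer.\<close>

lemma descent_W:
  assumes "w \<in> W" "descent i w"
  shows "refl_fin i \<in> W"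
proof -
  have "- inv w (root_fin i) \<in> pos_roots"
    using assms W_Wfin[OF assms(1)] by (simp add: descent_def uminus_pos_roots_iff)
  then have "pairing \<nu> (- inv w (root_fin i)) \<ge> 0" by (rule pairing_pos_roots)
  then show ?thesis
    using pairing_W[OF inv_W[OF assms(1)], of "root_fin i"] dominant[of i] by (simp add: pairing_linear refl_W)
qed

lemma W_up_induct [consumes 1, case_names id step]:
  assumes "w \<in> W" and id: "P id"
    and step: "\<And>i w. w \<in> W \<Longrightarrow> refl_fin i \<in> W \<Longrightarrow> \<not> descent i w \<Longrightarrow> P w \<Longrightarrow> P (refl_fin i \<circ> w)"
  shows "P w"
proof -
  have "w \<in> W \<longrightarrow> P w" using W_Wfin[OF assms(1)]
  proof (induction w rule: Wfin_up_induct)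
    case id
    show ?case using assms(2) by blast
  next
    case (step i w)
    show ?case
    proof
      assume W: "refl_fin i \<circ> w \<in> W"
      then have "refl_fin i \<in> W" using step by (intro descent_W) (auto simp: descent_refl_fin)
      moreover from comp_W[OF this W] have "w \<in> W" by simp
      ultimately show "P (refl_fin i \<circ> w)" using step assms(3) by blast
    qed
  qed
  then show ?thesis using assms(1) by blast
qed

lemma inv_set_W: "w \<in> W \<Longrightarrow> inv_set w \<subseteq> roots_stab"
proof
  fix \<beta> assume w: "w \<in> W" and "\<beta> \<in> inv_set w"
  then have \<beta>: "\<beta> \<in> pos_roots" "w \<beta> \<notin> pos_roots" by (auto simp: inv_set_def)
  then have "- w \<beta> \<in> pos_roots" using W_Wfin[OF w] by (simp add: uminus_pos_roots_iff)
  then have "pairing \<nu> (- w \<beta>) \<ge> 0" by (rule pairing_pos_roots)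
  then show "\<beta> \<in> roots_stab"
    using \<beta>(1) pairing_pos_roots[OF \<beta>(1)] pairing_W[OF w, of \<beta>] by (simp add: roots_stab_def pairing_linear)
qed

end

lemma longest_props:
  assumes "finite S" "S \<noteq> {}"
  shows "longest S \<in> S" and "w \<in> S \<Longrightarrow> len w \<le> len (longest S)"
proof -
  obtain k where k: "k \<in> S" using assms by blast
  have bound: "\<forall>y. y \<in> S \<longrightarrow> len y < Suc (Max (len ` S))" using assms by (auto simp: less_Suc_eq_le)
  from arg_max_nat_lemma[of "\<lambda>x. x \<in> S", OF k bound]
  show "longest S \<in> S" "w \<in> S \<Longrightarrow> len w \<le> len (longest S)"
    unfolding longest_def arg_max_on_def by auto
qed

context dominant
begin

definition "wl = longest W"

lemma wl_W: "wl \<in> W"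
  unfolding wl_def using id_W by (intro longest_props) auto

lemma wl_Wfin [simp]: "wl \<in> Wfin"
  by (rule W_Wfin[OF wl_W])

text \<open>If \<open>wl\<close> kept a simple root of the stabilizer positive, right multiplication
  by its reflection would give a longer element. So all these simple roots become negative, and with
  them every positive root orthogonal to nu.\<close>

lemma inv_set_wl: "inv_set wl = roots_stab"
proof
  show "inv_set wl \<subseteq> roots_stab" by (rule inv_set_W[OF wl_W])
  show "roots_stab \<subseteq> inv_set wl"
  proof
    fix \<beta> assume \<beta>: "\<beta> \<in> roots_stab"
    have "0 < - 1 * height (wl (root_fin i))" if i: "pairing \<nu> (root_fin i) = 0" for i
    proof -
      have W: "wl \<circ> refl_fin i \<in> W" using i wl_W by (simp add: comp_W refl_W)
      have "wl (root_fin i) \<notin> pos_roots"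
      proof
        assume "wl (root_fin i) \<in> pos_roots"
        then have "len wl < len (wl \<circ> refl_fin i)"
          using W by (simp add: len_eq card_inv_set_comp_refl(2))
        moreover have "len (wl \<circ> refl_fin i) \<le> len wl"
          using longest_props(2)[OF finite_W _ W] W by (auto simp: wl_def)
        ultimately show False by simp
      qed
      then have "- wl (root_fin i) \<in> pos_roots" by (simp add: uminus_pos_roots_iff)
      from height_pos[OF this] show ?thesis by (simp add: height_def pairing_linear)
    qed
    then have "0 < - 1 * height (wl \<beta>)"
      using \<beta> dominant by (rule_tac Wfin_root_combination[where \<nu> = \<nu>]) (auto simp: roots_stab_def)
    then show "\<beta> \<in> inv_set wl"
      using \<beta> height_pos[of "wl \<beta>"] by (auto simp: inv_set_def roots_stab_def)
  qed
qed

lemma W_eq_wl: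
  assumes "w \<in> W" "card (inv_set w) \<ge> card roots_stab"
  shows "w = wl"
proof (rule inv_set_eqD)
  show "inv_set w = inv_set wl"
    unfolding inv_set_wl using assms by (intro card_seteq inv_set_W) auto
qed (use assms W_Wfin in auto)

lemma DLe_outside: "w \<in> W \<Longrightarrow> v \<in> Wfin \<Longrightarrow> v \<notin> W \<Longrightarrow> DLe w v = 0"
proof (induction w arbitrary: v rule: W_up_induct)
  case id
  then show ?case using id_W by (auto simp: DLe_id delta_fun_def)
next
  case (step i w)
  have "v \<circ> refl_fin i \<notin> W"
  proof
    assume "v \<circ> refl_fin i \<in> W"
    from comp_W[OF this step(2)] show False using step by simp
  qed
  then show ?case using step W_Wfin by (simp add: DLe_up DL_eval)
qed

text \<open>\<open>DLe w\<close> already carries chi^+(T_w); this is the weight that turns it into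
  the term chi^Xi(T_w) T_w of the symmetrizer.\<close>

definition ratio :: "character \<Rightarrow> (('n \<Rightarrow> int) \<Rightarrow> 'n \<Rightarrow> int) \<Rightarrow> K" where
  "ratio \<Xi> w = chi_T \<Xi> w / chi_T PP w"

definition sym_fun :: "character \<Rightarrow> 'n wfun" where
  "sym_fun \<Xi> v = (\<Sum>w\<in>W. const (ratio \<Xi> w) * DLe w v)"

text \<open>Sums over the pairs w, s_i w, indexed by the shorter element, so that the recursions for
  increasing length apply.\<close>

lemma sum_W_pairs:
  fixes g :: "_ \<Rightarrow> 'a::comm_monoid_add"
  assumes i: "refl_fin i \<in> W"
  shows "(\<Sum>w\<in>W. g w) = (\<Sum>w\<in>{w \<in> W. \<not> descent i w}. g w + g (refl_fin i \<circ> w))"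
proof -
  let ?U = "{w \<in> W. \<not> descent i w}" and ?D = "{w \<in> W. descent i w}"
  have "(\<Sum>w\<in>W. g w) = (\<Sum>w\<in>?U. g w) + (\<Sum>w\<in>?D. g w)"
    by (subst sum.union_disjoint[symmetric]) (auto intro!: sum.cong)
  also have "(\<Sum>w\<in>?D. g w) = (\<Sum>w\<in>?U. g (refl_fin i \<circ> w))"
    by (rule sum.reindex_bij_witness[where i = "\<lambda>w. refl_fin i \<circ> w" and j = "\<lambda>w. refl_fin i \<circ> w"])
      (use i comp_W W_Wfin in \<open>auto simp: descent_refl_fin\<close>)
  finally show ?thesis by (simp add: sum.distrib)
qed

lemma ratio_up:
  assumes "w \<in> Wfin" "\<not> descent i w"
  shows "ratio \<Xi> (refl_fin i \<circ> w) =
    (if plus_on \<Xi> (i = last_ix) then 1 else - inverse (tau (i = last_ix))) * ratio \<Xi> w"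
  using assms by (simp add: ratio_def chi_T_up chi_eq divide_simps power2_eq_square flip: half_simple_sq)

lemma DL_sum: "DL i (\<lambda>v. \<Sum>w\<in>A. c w * f w v) v = (\<Sum>w\<in>A. c w * DL i (f w) v)"
proof (cases "v \<in> Wfin")
  case True
  then show ?thesis
    by (simp add: DL_eval sum_distrib_left sum.distrib[symmetric] algebra_simps)
next
  case False
  then show ?thesis by (simp add: DL_def BL_def sum_negf)
qed

text \<open>\<open>DL i\<close> maps the span of each pair T_w, T_(s_i w) to itself by the quadratic
  relation, and the weights chi^Xi make the combination an eigenvector. The eigenvalue is t_i^(1/2)
  chi^Xi(T_i).\<close>

lemma DL_sym_fun:
  assumes i: "refl_fin i \<in> W"
  shows "DL i (sym_fun \<Xi>) v =
    (if plus_on \<Xi> (i = last_ix) then const (tau (i = last_ix)) else - 1) * sym_fun \<Xi> v"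
proof -
  let ?th = "if plus_on \<Xi> (i = last_ix) then const (tau (i = last_ix)) else - 1 :: 'n ratfun"
  have "DL i (sym_fun \<Xi>) v = (\<Sum>w\<in>W. const (ratio \<Xi> w) * DL i (DLe w) v)"
    unfolding sym_fun_def[abs_def] by (rule DL_sum)
  also have "\<dots> = (\<Sum>w\<in>{w \<in> W. \<not> descent i w}.
      const (ratio \<Xi> w) * DL i (DLe w) v + const (ratio \<Xi> (refl_fin i \<circ> w)) * DL i (DLe (refl_fin i \<circ> w)) v)"
    by (rule sum_W_pairs[OF i])
  also have "\<dots> = (\<Sum>w\<in>{w \<in> W. \<not> descent i w}.
      ?th * (const (ratio \<Xi> w) * DLe w v + const (ratio \<Xi> (refl_fin i \<circ> w)) * DLe (refl_fin i \<circ> w) v))"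
  proof (rule sum.cong[OF refl])
    fix w assume "w \<in> {w \<in> W. \<not> descent i w}"
    then have w: "w \<in> Wfin" "\<not> descent i w" using W_Wfin by auto
    have nz: "const (tau (i = last_ix)) \<noteq> (0 :: 'n ratfun)" by simp
    show "const (ratio \<Xi> w) * DL i (DLe w) v + const (ratio \<Xi> (refl_fin i \<circ> w)) * DL i (DLe (refl_fin i \<circ> w)) v
      = ?th * (const (ratio \<Xi> w) * DLe w v + const (ratio \<Xi> (refl_fin i \<circ> w)) * DLe (refl_fin i \<circ> w) v)"
      unfolding ratio_up[OF w] DLe_up[OF w] DL_DL using nz
      by (simp add: const_mult const_uminus const_inverse) (simp add: field_simps)
  qed
  also have "\<dots> = ?th * sym_fun \<Xi> v"
    unfolding sym_fun_def sum_W_pairs[OF i] by (simp add: sum_distrib_left)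
  finally show ?thesis .
qed

definition minus_roots :: "character \<Rightarrow> ('n \<Rightarrow> int) set" where
  "minus_roots \<Xi> = {\<beta> \<in> roots_stab. \<not> plus_on \<Xi> (short_root \<beta>)}"

text \<open>The coordinates of the product of the kap(-beta), beta of minus type, times the signed
  sum of the eta_w: moving the product through eta_w yields kap(-v beta) with v = w^(-1). The sign
  is taken at w, hence the inverse.\<close>

definition eigen_fun :: "character \<Rightarrow> 'n wfun" where
  "eigen_fun \<Xi> v = const (sign_W \<Xi> (inv v)) * (\<Prod>\<beta>\<in>minus_roots \<Xi>. kap (- v \<beta>))"

lemma refl_fin_roots_stab:
  assumes "refl_fin i \<in> W" "\<beta> \<in> roots_stab" "\<beta> \<noteq> root_fin i"
  shows "refl_fin i \<beta> \<in> roots_stab" "refl_fin i \<beta> \<noteq> root_fin i"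
proof -
  show "refl_fin i \<beta> \<in> roots_stab"
    using assms refl_fin_pos_roots[of \<beta> i] pairing_W[OF assms(1), of \<beta>] by (simp add: roots_stab_def)
  show "refl_fin i \<beta> \<noteq> root_fin i"
  proof
    assume "refl_fin i \<beta> = root_fin i"
    then have "\<beta> = - root_fin i" by (metis refl_fin_refl_fin refl_fin_root_fin)
    then show False using assms(2) uminus_pos_roots_D[OF root_fin_pos, of i] by (simp add: roots_stab_def)
  qed
qed

text \<open>Right multiplication by s_i permutes all factors except the one of alpha_i. That factor
  is absent for plus type; for minus type it changes from kap(-v alpha_i) to kap(v alpha_i), and the
  sign flips.\<close>

lemma eigen_fun_refl:
  assumes v: "v \<in> Wfin" and i: "refl_fin i \<in> W"
  shows "plus_on \<Xi> (i = last_ix) \<Longrightarrow> eigen_fun \<Xi> (v \<circ> refl_fin i) = eigen_fun \<Xi> v"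
    and "\<not> plus_on \<Xi> (i = last_ix) \<Longrightarrow>
      kap (v (root_fin i)) * eigen_fun \<Xi> v + kap (- v (root_fin i)) * eigen_fun \<Xi> (v \<circ> refl_fin i) = 0"
proof -
  let ?R = "minus_roots \<Xi> - {root_fin i}"
  have perm: "(\<Prod>\<beta>\<in>?R. kap (- v (refl_fin i \<beta>))) = (\<Prod>\<beta>\<in>?R. kap (- v \<beta>))"
    by (rule prod.reindex_bij_witness[where i = "refl_fin i" and j = "refl_fin i"])
      (use refl_fin_roots_stab[OF i] in \<open>auto simp: minus_roots_def\<close>)
  have sg: "sign_W \<Xi> (inv (v \<circ> refl_fin i)) = sign_simple \<Xi> i * sign_W \<Xi> (inv v)"
    using v by (simp add: inv_comp_distrib_Wfin sign_W_refl)
  {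
    assume pl: "plus_on \<Xi> (i = last_ix)"
    then have "root_fin i \<notin> minus_roots \<Xi>" by (simp add: minus_roots_def)
    then have "?R = minus_roots \<Xi>" by simp
    then show "eigen_fun \<Xi> (v \<circ> refl_fin i) = eigen_fun \<Xi> v"
      using perm pl unfolding eigen_fun_def sg by (simp add: comp_apply sign_simple_def)
  next
    assume pl: "\<not> plus_on \<Xi> (i = last_ix)"
    have "root_fin i \<in> minus_roots \<Xi>"
      using i pl by (simp add: minus_roots_def roots_stab_def refl_W)
    moreover have "finite (minus_roots \<Xi>)" by (simp add: minus_roots_def)
    ultimately have split: "(\<Prod>\<beta>\<in>minus_roots \<Xi>. g \<beta>) = g (root_fin i) * (\<Prod>\<beta>\<in>?R. g \<beta>)" for g :: "_ \<Rightarrow> 'n ratfun"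
      by (rule prod.remove[rotated])
    have "v (refl_fin i (root_fin i)) = - v (root_fin i)"
      using v by (simp add: refl_fin_root_fin Wfin_uminus)
    then show "kap (v (root_fin i)) * eigen_fun \<Xi> v + kap (- v (root_fin i)) * eigen_fun \<Xi> (v \<circ> refl_fin i) = 0"
      using perm pl unfolding eigen_fun_def sg split by (simp add: comp_apply sign_simple_def const_mult const_uminus)
  }
qed

text \<open>The eigenvalue equation read at v. For eigenvalue t_i, inserting kap(beta) + kap(-beta)
  = 1 + t_i leaves a multiple of the nonzero kap(-beta), which cancels.\<close>

lemma sym_fun_refl:
  assumes v: "v \<in> Wfin" and i: "refl_fin i \<in> W"
  shows "plus_on \<Xi> (i = last_ix) \<Longrightarrow> sym_fun \<Xi> (v \<circ> refl_fin i) = sym_fun \<Xi> v"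
    and "\<not> plus_on \<Xi> (i = last_ix) \<Longrightarrow>
      kap (v (root_fin i)) * sym_fun \<Xi> v + kap (- v (root_fin i)) * sym_fun \<Xi> (v \<circ> refl_fin i) = 0"
proof -
  have DL: "(kap (v (root_fin i)) - 1) * sym_fun \<Xi> v + kap (- v (root_fin i)) * sym_fun \<Xi> (v \<circ> refl_fin i) =
      (if plus_on \<Xi> (i = last_ix) then const (tau (i = last_ix)) else - 1) * sym_fun \<Xi> v"
    using DL_sym_fun[OF i, of \<Xi> v] v by (simp only: DL_eval)
  have root: "v (root_fin i) \<in> all_roots" using v by simp
  have kap: "kap (v (root_fin i)) + kap (- v (root_fin i)) = 1 + const (tau (i = last_ix))"
    using kap_add_uminus[OF root] v by simp
  {
    assume "plus_on \<Xi> (i = last_ix)"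
    then have "(kap (v (root_fin i)) - 1) * sym_fun \<Xi> v + kap (- v (root_fin i)) * sym_fun \<Xi> (v \<circ> refl_fin i) =
        const (tau (i = last_ix)) * sym_fun \<Xi> v" using DL by simp
    then have "kap (- v (root_fin i)) * sym_fun \<Xi> (v \<circ> refl_fin i) = kap (- v (root_fin i)) * sym_fun \<Xi> v"
      using kap by algebra
    then show "sym_fun \<Xi> (v \<circ> refl_fin i) = sym_fun \<Xi> v"
      using kap_neq_0[of "- v (root_fin i)"] root by simp
  next
    assume "\<not> plus_on \<Xi> (i = last_ix)"
    then show "kap (v (root_fin i)) * sym_fun \<Xi> v + kap (- v (root_fin i)) * sym_fun \<Xi> (v \<circ> refl_fin i) = 0"
      using DL by (simp add: algebra_simps)
  }
qed

text \<open>Both functions satisfy the same relation between v and v s_i, which determines either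
  from its value at the identity. The cross-multiplied form survives the induction.\<close>

lemma sym_fun_proportional:
  assumes "w \<in> W"
  shows "sym_fun \<Xi> (inv w) * eigen_fun \<Xi> id = sym_fun \<Xi> id * eigen_fun \<Xi> (inv w)"
  using assms
proof (induction w rule: W_up_induct)
  case id
  show ?case by (simp add: inv_id[unfolded id_def])
next
  case (step i w)
  let ?v = "inv w"
  have v: "?v \<in> Wfin" using W_Wfin step by auto
  have inv: "inv (refl_fin i \<circ> w) = ?v \<circ> refl_fin i"
    using W_Wfin step by (simp add: inv_comp_distrib_Wfin)
  show ?case
  proof (cases "plus_on \<Xi> (i = last_ix)")
    case True
    then show ?thesis
      unfolding inv using step sym_fun_refl(1)[OF v step(2)] eigen_fun_refl(1)[OF v step(2)] by simp
  next
    case False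
    have "kap (- ?v (root_fin i)) * (sym_fun \<Xi> (?v \<circ> refl_fin i) * eigen_fun \<Xi> id) =
      kap (- ?v (root_fin i)) * (sym_fun \<Xi> id * eigen_fun \<Xi> (?v \<circ> refl_fin i))"
      using sym_fun_refl(2)[OF v step(2) False] eigen_fun_refl(2)[OF v step(2) False] step(4) by algebra
    then show ?thesis
      unfolding inv using kap_neq_0[of "- ?v (root_fin i)"] v by simp
  qed
qed

text \<open>By triangularity the longest element is the only one whose term reaches this
  argument.\<close>

lemma sym_fun_top: "sym_fun \<Xi> (inv wl) = const (ratio \<Xi> wl) * (\<Prod>\<beta>\<in>roots_stab. kap \<beta>)"
proof -
  have "const (ratio \<Xi> w) * DLe w (inv wl) = 0" if "w \<in> W - {wl}" for w
  proof -
    have "card (inv_set w) < card (inv_set (inv wl))"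
      using that W_eq_wl[of w] by (force simp: card_inv_set_inv inv_set_wl)
    then show ?thesis using that W_Wfin by (simp add: DLe_support)
  qed
  then have "sym_fun \<Xi> (inv wl) = const (ratio \<Xi> wl) * DLe wl (inv wl)"
    unfolding sym_fun_def by (subst sum.remove[OF finite_W wl_W]) (simp add: sum.neutral)
  then show ?thesis by (simp add: DLe_top inv_set_wl)
qed

text \<open>beta \<mapsto> - wl^(-1) beta permutes the positive roots of the stabilizer and
  preserves their type.\<close>

lemma eigen_fun_top: "eigen_fun \<Xi> (inv wl) = const (sign_W \<Xi> wl) * (\<Prod>\<beta>\<in>minus_roots \<Xi>. kap \<beta>)"
proof -
  have neg: "- inv wl \<beta> \<in> roots_stab" if \<beta>: "\<beta> \<in> roots_stab" for \<beta>
  proof -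
    have z: "pairing \<nu> (inv wl \<beta>) = 0" using \<beta> pairing_W[OF inv_W[OF wl_W]] by (simp add: roots_stab_def)
    have "inv wl \<beta> \<notin> roots_stab"
    proof
      assume "inv wl \<beta> \<in> roots_stab"
      then have "wl (inv wl \<beta>) \<notin> pos_roots" unfolding inv_set_wl[symmetric] by (simp add: inv_set_def)
      then show False using \<beta> by (simp add: roots_stab_def)
    qed
    then show ?thesis using \<beta> z by (simp add: roots_stab_def pairing_linear uminus_pos_roots_iff)
  qed
  have neg': "- wl \<beta> \<in> roots_stab" if \<beta>: "\<beta> \<in> roots_stab" for \<beta>
  proof -
    have "wl \<beta> \<notin> pos_roots" using \<beta> unfolding inv_set_wl[symmetric] by (simp add: inv_set_def)
    then show ?thesis
      using \<beta> pairing_W[OF wl_W, of \<beta>] by (simp add: roots_stab_def pairing_linear uminus_pos_roots_iff)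
  qed
  have "(\<Prod>\<beta>\<in>minus_roots \<Xi>. kap (- inv wl \<beta>)) = (\<Prod>\<beta>\<in>minus_roots \<Xi>. kap \<beta>)"
    by (rule prod.reindex_bij_witness[where i = "\<lambda>\<beta>. - wl \<beta>" and j = "\<lambda>\<beta>. - inv wl \<beta>"])
      (use neg neg' in \<open>auto simp: minus_roots_def Wfin_uminus\<close>)
  then show ?thesis by (simp add: eigen_fun_def)
qed

lemma eigen_fun_neq_0:
  assumes "v \<in> Wfin"
  shows "eigen_fun \<Xi> v \<noteq> 0"
proof -
  have "kap (- v \<beta>) \<noteq> 0" if "\<beta> \<in> minus_roots \<Xi>" for \<beta>
    using that assms by (intro kap_neq_0) (auto simp: minus_roots_def roots_stab_def)
  moreover have "sign_W \<Xi> (inv v) \<noteq> 0" using sign_W_sq[of "inv v" \<Xi>] assms by auto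
  ultimately show ?thesis by (auto simp: eigen_fun_def minus_roots_def)
qed

theorem sym_fun_eq:
  assumes "w \<in> W"
  shows "sym_fun \<Xi> (inv w) = const (ratio \<Xi> wl * sign_W \<Xi> wl * sign_W \<Xi> w) *
    (\<Prod>\<beta>\<in>roots_stab. if plus_on \<Xi> (short_root \<beta>) then kap \<beta> else kap (- inv w \<beta>))"
proof -
  let ?P = "\<Prod>\<beta>\<in>{\<beta> \<in> roots_stab. plus_on \<Xi> (short_root \<beta>)}. kap \<beta>"
  have split: "(\<Prod>\<beta>\<in>roots_stab. if plus_on \<Xi> (short_root \<beta>) then kap \<beta> else f \<beta>) = ?P * (\<Prod>\<beta>\<in>minus_roots \<Xi>. f \<beta>)" for f
    unfolding minus_roots_def by (subst prod.If_cases) (auto simp: Int_def)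
  \<comment> \<open>This fixes the scalar. At the longest element the sum has all factors of
    \<open>roots_stab\<close>, the closed form only those of minus type and a sign, which changes
    sides because its square is 1.\<close>
  have top: "sym_fun \<Xi> (inv wl) = const (ratio \<Xi> wl * sign_W \<Xi> wl) * ?P * eigen_fun \<Xi> (inv wl)"
  proof -
    have "(\<Prod>\<beta>\<in>roots_stab. kap \<beta>) = ?P * (\<Prod>\<beta>\<in>minus_roots \<Xi>. kap \<beta>)" using split[of kap] by simp
    moreover have "const (sign_W \<Xi> wl) * const (sign_W \<Xi> wl) = (1 :: 'n ratfun)"
      using sign_W_sq[OF wl_Wfin, of \<Xi>] by (simp flip: const_mult)
    ultimately show ?thesis unfolding sym_fun_top eigen_fun_top const_mult by algebra
  qed
  have nz: "eigen_fun \<Xi> id \<noteq> 0" "eigen_fun \<Xi> (inv wl) \<noteq> 0"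
    by (auto intro!: eigen_fun_neq_0)
  \<comment> \<open>Eliminates the common values at the identity, leaving a proportion between the
    values at w and at \<open>wl\<close>.\<close>
  have cancel: "a * d = b * c" if "a * e = x * c" "b * e = x * d" "e \<noteq> 0" for a b c d e x :: "'n ratfun"
  proof -
    have "e * (a * d) = e * (b * c)" using that(1,2) by algebra
    then show ?thesis using that(3) by simp
  qed
  have "sym_fun \<Xi> (inv w) * eigen_fun \<Xi> (inv wl) = sym_fun \<Xi> (inv wl) * eigen_fun \<Xi> (inv w)"
    by (rule cancel[OF sym_fun_proportional[OF assms] sym_fun_proportional[OF wl_W] nz(1)])
  then have "sym_fun \<Xi> (inv w) = const (ratio \<Xi> wl * sign_W \<Xi> wl) * ?P * eigen_fun \<Xi> (inv w)"
    using nz(2) unfolding top by (simp add: mult.assoc mult.left_commute)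
  then show ?thesis
    using assms W_Wfin unfolding split eigen_fun_def by (simp add: const_mult mult_ac)
qed

end

section \<open>The localized algebra\<close>

lemma hrel_eq: "hrel a b \<Longrightarrow> abs_Hloc a = abs_Hloc b"
  by (simp add: Hloc.abs_eq_iff hcong_def hideal.rel)

lemmas abs_Hloc_simps =
  times_Hloc.abs_eq[symmetric] plus_Hloc.abs_eq[symmetric] of_gen.abs_eq[symmetric]
  ofK.abs_eq[symmetric] one_Hloc.abs_eq[symmetric]

lemma abs_Hloc_prod_list: "abs_Hloc (prod_list (map (\<lambda>k. gen (g k)) ws)) = prod_list (map (\<lambda>k. of_gen (g k)) ws)"
  by (induction ws) (simp_all add: abs_Hloc_simps)

lemma ofY_add: "ofY (f + g) = ofY f + ofY g"
  using hrel_eq[OF Y_add[of f g]] by (simp add: ofY_def abs_Hloc_simps)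

lemma ofY_mult: "ofY (f * g) = ofY f * ofY g"
  using hrel_eq[OF Y_mult[of f g]] by (simp add: ofY_def abs_Hloc_simps)

lemma ofY_const: "ofY (const c) = ofK c"
  using hrel_eq[OF Y_const[of c]] by (simp add: ofY_def abs_Hloc_simps)

lemma ofK_1 [simp]: "ofK 1 = 1"
  by (simp add: ofK.abs_eq scal_def one_Hloc.abs_eq)

lemma ofY_1 [simp]: "ofY 1 = 1"
  using ofY_const[of 1] by simp

lemma ofY_0 [simp]: "ofY 0 = 0"
  using ofY_add[of 0 0] by simp

lemma ofY_diff: "ofY (f - g) = ofY f - ofY g"
  using ofY_add[of "f - g" g] by (simp add: eq_diff_eq)

lemma ofK_mult: "ofK (a * b) = ofK a * ofK b"
  unfolding ofY_const[symmetric] const_mult by (rule ofY_mult)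

text \<open>Scalars are supported on the empty word, so they commute with every single word; the
  induction adds one word of the support at a time.\<close>

lemma scal_commute: "scal c * p = p * scal c"
proof (induction p rule: update_induct)
  case (update f k v)
  have "Poly_Mapping.update k v f = f + Poly_Mapping.single k v"
    using update by (intro poly_mapping_eqI) (auto simp: lookup_update lookup_add lookup_single when_def in_keys_iff)
  then show ?case using update by (simp add: distrib_left distrib_right scal_def mult_single mult.commute)
qed (simp add: scal_def)

lemma ofK_commute: "ofK c * x = x * ofK c"
  by (induction x) (simp add: ofK.abs_eq times_Hloc.abs_eq scal_commute)

lemma ofK_left_commute: "x * (ofK c * y) = ofK c * (x * y)"
  by (metis ofK_commute mult.assoc)

section \<open>The elements eta_w\<close>

abbreviation eta :: "'n \<Rightarrow> ('n::{finite,linorder}) Hloc" where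
  "eta i \<equiv> of_gen (Geta (Some i))"

lemma eta_eta [simp]: "eta i * eta i = 1" "eta i * (eta i * x) = x"
proof -
  show *: "eta i * eta i = 1"
    using hrel_eq[OF eta_invol[of "Some i"]] by (simp add: abs_Hloc_simps)
  show "eta i * (eta i * x) = x" by (simp add: * flip: mult.assoc)
qed

lemma eta_alternating:
  assumes "i \<noteq> j"
  shows "prod_list (map eta (alternating (coxeter (Some i) (Some j)) i j)) =
    prod_list (map eta (alternating (coxeter (Some i) (Some j)) j i))"
proof -
  have "map (\<lambda>k. of_gen (Geta k)) (alternating m (Some i) (Some j)) = map eta (alternating m i j)"
    for m and i j :: 'a
    by (simp add: alternating_def comp_apply)
  moreover have "prod_list (map (\<lambda>k. of_gen (Geta k)) (alternating m (Some i) (Some j))) =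
      prod_list (map (\<lambda>k. of_gen (Geta k)) (alternating m (Some j) (Some i)))"
    if "m = coxeter (Some i) (Some j)" for m
    using hrel_eq[OF eta_braid[of "Some i" "Some j"]] assms
    unfolding abs_Hloc_prod_list[where g = Geta] that by blast
  ultimately show ?thesis by metis
qed

lemma card_atMost_next_ix:
  assumes "i \<noteq> last_ix"
  shows "card {..next_ix i} = Suc (card {..i})"
proof -
  have "{..next_ix i} = insert (next_ix i) {..i}"
    using less_next_ix_iff[OF assms] order.order_iff_strict[of _ "next_ix i"] by blast
  then show ?thesis using less_next_ix[OF assms] by (simp add: not_le)
qed

text \<open>The Coxeter matrix speaks of node numbers; this translates consecutive numbers back to
  \<open>next_ix\<close>.\<close>

lemma card_atMost_eq_Suc:
  fixes i j :: "'n::{finite,linorder}"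
  assumes "card {..j} = Suc (card {..i})"
  shows "i \<noteq> last_ix" "j = next_ix i"
proof -
  have "\<not> j \<le> i" using assms card_mono[of "{..i}" "{..j}"] by force
  then have ij: "i < j" by simp
  then show i: "i \<noteq> last_ix" using le_last_ix[of j] by auto
  have "\<not> next_ix i < j"
  proof
    assume "next_ix i < j"
    then have "{..next_ix i} \<subset> {..j}" by auto
    then have "card {..next_ix i} < card {..j}" by (simp add: psubset_card_mono)
    then show False using assms card_atMost_next_ix[OF i] by simp
  qed
  then show "j = next_ix i" using next_ix_le[OF i ij] by simp
qed

lemma card_atMost_last: "card {..last_ix :: 'n::{finite,linorder}} = card (UNIV :: 'n set)"
proof -
  have "{..last_ix :: 'n} = UNIV" using le_last_ix by auto
  then show ?thesis by simp
qed

lemma coxeter_commute: "i \<noteq> j \<Longrightarrow> \<not> adjacent i j \<Longrightarrow> coxeter (Some i) (Some j) = 2"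
  using card_atMost_eq_Suc[of i j] card_atMost_eq_Suc[of j i] by (auto simp: coxeter_def adjacent_def)

lemma coxeter_next:
  assumes "i \<noteq> (last_ix :: 'n::{finite,linorder})"
  shows "coxeter (Some i) (Some (next_ix i)) = (if next_ix i = last_ix then 4 else 3)"
proof -
  have pos: "0 < card {..k}" for k :: 'n by (auto simp: card_gt_0_iff)
  have less: "card {..k} = card (UNIV :: 'n set) \<longleftrightarrow> k = last_ix" for k :: 'n
  proof -
    have "card {..k} \<noteq> card (UNIV :: 'n set)" if "k \<noteq> last_ix"
    proof -
      have "{..k} \<subset> {..last_ix}" using that le_last_ix[of k] by auto
      from psubset_card_mono[OF finite this] have "card {..k} < card {..last_ix :: 'n}" .
      then show ?thesis using card_atMost_last[where 'n = 'n] by simp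
    qed
    then show ?thesis using card_atMost_last[where 'n = 'n] by auto
  qed
  \<comment> \<open>Two distinct finite nodes exclude n = 1, where the Coxeter matrix has its entry
    for infinity.\<close>
  have "card (UNIV :: 'n set) \<noteq> 1"
    using less_next_ix[OF assms] by (metis UNIV_I card_1_singletonE less_irrefl singletonD)
  then show ?thesis
    using assms less[of i] less[of "next_ix i"] pos[of i] pos[of "next_ix i"]
    by (auto simp: coxeter_def card_atMost_next_ix)
qed

lemma alternating_simps:
  "alternating 2 i j = [i, j]" "alternating 3 i j = [i, j, i]" "alternating 4 i j = [i, j, i, j]"
  by (simp_all add: alternating_def upt_rec)

lemma eta_w_up: "w \<in> Wfin \<Longrightarrow> \<not> descent i w \<Longrightarrow> eta_w (refl_fin i \<circ> w) = eta i * eta_w w"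
  unfolding eta_w_def
proof (rule prod_list_rword_up)
  fix i j :: 'a assume "i \<noteq> j" "\<not> adjacent i j"
  then show "eta i * eta j = eta j * eta i"
    using eta_alternating[of i j] by (simp add: coxeter_commute alternating_simps)
next
  fix i :: 'a assume "i \<noteq> last_ix" "next_ix i \<noteq> last_ix"
  then show "eta i * eta (next_ix i) * eta i = eta (next_ix i) * eta i * eta (next_ix i)"
    using eta_alternating[of i "next_ix i"] next_ix_neq[of i]
    by (simp add: coxeter_next alternating_simps mult.assoc)
next
  fix i :: 'a assume i: "i \<noteq> last_ix" "next_ix i = last_ix"
  then have "coxeter (Some i) (Some (next_ix i)) = 4" using coxeter_next[of i] by simp
  with i show "eta i * eta (next_ix i) * eta i * eta (next_ix i) =
      eta (next_ix i) * eta i * eta (next_ix i) * eta i"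
    using eta_alternating[of i "next_ix i"]
    by (simp add: alternating_simps mult.assoc)
qed

text \<open>Unlike the T_i the eta_i are involutions, so the recursion also holds at descents and w
  \<mapsto> \<open>eta_w w\<close> is multiplicative.\<close>

lemma eta_w_refl:
  assumes "w \<in> Wfin"
  shows "eta_w (refl_fin i \<circ> w) = eta i * eta_w w"
proof (cases "descent i w")
  case True
  have "eta_w (refl_fin i \<circ> (refl_fin i \<circ> w)) = eta i * eta_w (refl_fin i \<circ> w)"
    using assms True by (intro eta_w_up) (auto simp: descent_refl_fin)
  then show ?thesis by simp
qed (rule eta_w_up[OF assms])

lemma eta_w_id [simp]: "eta_w id = 1"
  unfolding eta_w_def rword_id by simp

lemma eta_w_comp: "w \<in> Wfin \<Longrightarrow> u \<in> Wfin \<Longrightarrow> eta_w (w \<circ> u) = eta_w w * eta_w u"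
  by (induction w rule: Wfin_induct) (simp_all add: comp_assoc eta_w_refl mult.assoc)

text \<open>The defining relation moves eta_i past monomials only. A relation closed under the field
  operations extends this to the kappa functions.\<close>

definition intertwines :: "'n \<Rightarrow> 'n ratfun \<Rightarrow> ('n::{finite,linorder}) ratfun \<Rightarrow> bool" where
  "intertwines i f g \<longleftrightarrow> eta i * ofY f = ofY g * eta i"

lemma intertwines_Yroot: "intertwines i (Yroot \<beta>) (Yroot (refl_fin i \<beta>))"
  using hrel_eq[OF eta_Y[of "Some i" "(\<beta>, 0)"]]
  by (simp add: intertwines_def Yroot_def ofY_def abs_Hloc_simps)

lemma intertwines_const: "intertwines i (const c) (const c)"
  by (simp add: intertwines_def ofY_const ofK_commute)

lemma intertwines_1: "intertwines i 1 1"
  by (simp add: intertwines_def)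

lemma intertwines_add: "intertwines i f g \<Longrightarrow> intertwines i f' g' \<Longrightarrow> intertwines i (f + f') (g + g')"
  by (simp add: intertwines_def ofY_add distrib_left distrib_right)

lemma intertwines_diff: "intertwines i f g \<Longrightarrow> intertwines i f' g' \<Longrightarrow> intertwines i (f - f') (g - g')"
  by (simp add: intertwines_def ofY_diff left_diff_distrib right_diff_distrib)

lemma intertwines_mult: "intertwines i f g \<Longrightarrow> intertwines i f' g' \<Longrightarrow> intertwines i (f * f') (g * g')"
  unfolding intertwines_def ofY_mult by (metis mult.assoc)

lemma intertwines_inverse:
  assumes "intertwines i f g" "f \<noteq> 0" "g \<noteq> 0"
  shows "intertwines i (inverse f) (inverse g)"
proof -
  have f: "ofY f * ofY (inverse f) = 1" and g: "ofY (inverse g) * ofY g = 1"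
    using assms by (simp_all flip: ofY_mult)
  have "eta i * ofY (inverse f) = ofY (inverse g) * (ofY g * eta i) * ofY (inverse f)"
    using g by (simp flip: mult.assoc)
  also have "\<dots> = ofY (inverse g) * (eta i * (ofY f * ofY (inverse f)))"
    unfolding assms(1)[unfolded intertwines_def, symmetric] by (simp only: mult.assoc)
  finally show ?thesis using f by (simp add: intertwines_def)
qed

lemma intertwines_divide:
  "intertwines i f g \<Longrightarrow> intertwines i f' g' \<Longrightarrow> f' \<noteq> 0 \<Longrightarrow> g' \<noteq> 0 \<Longrightarrow> intertwines i (f / f') (g / g')"
  unfolding divide_inverse by (intro intertwines_mult intertwines_inverse)

lemma intertwines_kap:
  assumes "\<beta> \<in> all_roots"
  shows "intertwines i (kap \<beta>) (kap (refl_fin i \<beta>))"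
  using Yroot_nondegenerate[OF assms] Yroot_nondegenerate[OF refl_fin_all_roots[OF assms], of i]
  unfolding kap_def kap_d_def kap_s_def short_root_refl_fin power2_eq_square[of "Yroot _"]
  by (auto intro!: intertwines_divide intertwines_mult intertwines_add intertwines_diff
      intertwines_const intertwines_1 intertwines_Yroot)

lemma eta_w_kap:
  assumes "w \<in> Wfin" "\<beta> \<in> all_roots"
  shows "eta_w w * ofY (kap \<beta>) = ofY (kap (w \<beta>)) * eta_w w"
  using assms
proof (induction w rule: Wfin_induct)
  case id
  then show ?case by (simp add: id_apply[of \<beta>])
next
  case (step i w)
  have "eta i * ofY (kap (w \<beta>)) = ofY (kap (refl_fin i (w \<beta>))) * eta i"
    using step intertwines_kap[of "w \<beta>" i] by (simp add: intertwines_def)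
  then show ?case using step by (simp add: eta_w_refl comp_apply[of "refl_fin i" w \<beta>] mult.assoc) (simp flip: mult.assoc)
qed

lemma eta_w_prod_kap:
  assumes "w \<in> Wfin" "\<And>x. x \<in> A \<Longrightarrow> h x \<in> all_roots"
  shows "eta_w w * ofY (\<Prod>x\<in>A. kap (h x)) = ofY (\<Prod>x\<in>A. kap (w (h x))) * eta_w w"
  using assms(2)
proof (induction A rule: infinite_finite_induct)
  case (insert x A)
  have "a * (b * c) = b' * c' * a" if "a * b = b' * a" "a * c = c' * a" for a b c b' c' :: "'a Hloc"
    by (metis that mult.assoc)
  then show ?case
    using insert eta_w_kap[OF assms(1), of "h x"] by (simp add: ofY_mult)
qed auto

text \<open>For i < n both parameters equal t, so the second factor of the numerator is 1 + z and
  cancels against 1 - z^2; what remains is t^(-1/2) \<open>kap_s\<close>. At i = n it is t_n^(-1/2)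
  \<open>kap_d\<close> directly.\<close>

lemma cY_Some: "cY (Some i) = const (inverse (half_simple i)) * kap (root_fin i)"
proof -
  have all: "root_fin i \<in> all_roots" by simp
  note nz = Yroot_nondegenerate[OF all]
  have Y: "Ymon (simple_root (Some i)) = Yroot (root_fin i)" by (simp add: Yroot_def)
  show ?thesis
  proof (cases "i = last_ix")
    case True
    then show ?thesis
      unfolding cY_def c_fun_def Y
      by (simp add: t_coroot_def u_coroot_def half_simple_def kap_def kap_d_def const_mult const_inverse)
  next
    case False
    have sq: "1 - (Yroot (root_fin i))\<^sup>2 = (1 - Yroot (root_fin i)) * (1 + Yroot (root_fin i))"
      by (simp add: algebra_simps power2_eq_square)
    show ?thesis
      using False nz unfolding cY_def c_fun_def Y sq
      by (simp add: t_coroot_def u_coroot_def half_simple_def kap_def kap_s_def const_mult const_inverse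
          power2_eq_square)
  qed
qed

lemma T_simple: "ofK (half_simple i) * of_gen (GT (Some i)) + 1 = (1 + eta i) * ofY (kap (root_fin i))"
proof -
  let ?h = "half_simple i"
  have t: "t_coroot (Some i) = ?h" by (simp add: t_coroot_def half_simple_def)
  have T: "of_gen (GT (Some i)) = of_gen (GTv (Some i))"
    using hrel_eq[OF T_eq[of i]] by (simp add: abs_Hloc_simps)
  have h: "ofK ?h * ofK (inverse ?h) = 1" "ofK ?h * (ofK (inverse ?h) * x) = x" for x
  proof -
    show *: "ofK ?h * ofK (inverse ?h) = 1" by (simp flip: ofK_mult)
    show "ofK ?h * (ofK (inverse ?h) * x) = x" by (simp add: * flip: mult.assoc)
  qed
  have "of_gen (GTv (Some i)) + ofK (inverse ?h) = (1 + eta i) * ofY (cY (Some i))"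
    using hrel_eq[OF Tv_eta[of "Some i"]] unfolding t by (simp add: ofY_def abs_Hloc_simps)
  also have "\<dots> = ofK (inverse ?h) * ((1 + eta i) * ofY (kap (root_fin i)))"
    by (simp add: cY_Some ofY_mult ofY_const ofK_left_commute)
  finally have "ofK ?h * (of_gen (GTv (Some i)) + ofK (inverse ?h)) =
      ofK ?h * (ofK (inverse ?h) * ((1 + eta i) * ofY (kap (root_fin i))))" by simp
  then show ?thesis unfolding T distrib_left[of "ofK ?h"] h .
qed

section \<open>From functions on the Weyl group to the algebra\<close>

definition realize :: "'n wfun \<Rightarrow> ('n::{finite,linorder}) Hloc" where
  "realize f = (\<Sum>w\<in>Wfin. eta_w w * ofY (f (inv w)))"

lemma realize_diff: "realize (\<lambda>v. f v - g v) = realize f - realize g"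
  by (simp add: realize_def ofY_diff right_diff_distrib sum_subtractf)

lemma realize_const: "realize (\<lambda>v. const c * f v) = ofK c * realize f"
  by (simp add: realize_def ofY_mult ofY_const ofK_left_commute sum_distrib_left)

lemma realize_zero: "realize (\<lambda>v. 0) = 0"
  by (simp add: realize_def)

lemma realize_add: "realize (\<lambda>v. f v + g v) = realize f + realize g"
  by (simp add: realize_def ofY_add distrib_left sum.distrib)

lemma realize_sum: "realize (\<lambda>v. \<Sum>x\<in>A. f x v) = (\<Sum>x\<in>A. realize (f x))"
  by (induction A rule: infinite_finite_induct) (simp_all add: realize_zero realize_add)

text \<open>Moving kap(alpha_i) past eta_w gives kap(w^(-1) alpha_i). In the part with eta_i the
  substitution of s_i w for w changes the sign of this root and shifts the argument of f.\<close>

lemma realize_BL: "realize (BL i f) = (1 + eta i) * ofY (kap (root_fin i)) * realize f"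
proof -
  have "(1 + eta i) * ofY (kap (root_fin i)) * (eta_w w * ofY (f (inv w))) =
      eta_w w * ofY (kap (inv w (root_fin i)) * f (inv w)) +
      eta_w (refl_fin i \<circ> w) * ofY (kap (inv w (root_fin i)) * f (inv w))" if w: "w \<in> Wfin" for w
  proof -
    have "ofY (kap (root_fin i)) * eta_w w = eta_w w * ofY (kap (inv w (root_fin i)))"
      using eta_w_kap[OF w, of "inv w (root_fin i)"] w by simp
    then have "ofY (kap (root_fin i)) * (eta_w w * ofY (f (inv w))) =
        eta_w w * ofY (kap (inv w (root_fin i)) * f (inv w))"
      by (simp add: ofY_mult flip: mult.assoc)
    then show ?thesis by (simp add: mult.assoc distrib_right eta_w_refl[OF w])
  qed
  then have "(1 + eta i) * ofY (kap (root_fin i)) * realize f =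
      (\<Sum>w\<in>Wfin. eta_w w * ofY (kap (inv w (root_fin i)) * f (inv w))) +
      (\<Sum>w\<in>Wfin. eta_w (refl_fin i \<circ> w) * ofY (kap (inv w (root_fin i)) * f (inv w)))"
    by (simp add: realize_def sum_distrib_left sum.distrib)
  also have "(\<Sum>w\<in>Wfin. eta_w (refl_fin i \<circ> w) * ofY (kap (inv w (root_fin i)) * f (inv w))) =
      (\<Sum>w\<in>Wfin. eta_w w * ofY (kap (- inv w (root_fin i)) * f (inv w \<circ> refl_fin i)))"
    by (rule sum.reindex_bij_witness[where i = "\<lambda>w. refl_fin i \<circ> w" and j = "\<lambda>w. refl_fin i \<circ> w"])
      (auto simp: inv_comp_distrib_Wfin comp_apply refl_fin_root_fin Wfin_uminus)
  also have "(\<Sum>w\<in>Wfin. eta_w w * ofY (kap (inv w (root_fin i)) * f (inv w))) + \<dots> = realize (BL i f)"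
    by (simp add: realize_def BL_def ofY_add distrib_left sum.distrib)
  finally show ?thesis by simp
qed

lemma realize_DL: "realize (DL i f) = ofK (half_simple i) * of_gen (GT (Some i)) * realize f"
proof -
  have "realize (DL i f) = ((1 + eta i) * ofY (kap (root_fin i)) - 1) * realize f"
    by (simp add: DL_def realize_diff realize_BL left_diff_distrib)
  then show ?thesis by (simp flip: T_simple)
qed

lemma realize_delta: "realize (delta_fun :: 'n::{finite,linorder} wfun) = 1"
proof -
  have "realize (delta_fun :: 'n wfun) = (\<Sum>w\<in>(Wfin :: (('n \<Rightarrow> int) \<Rightarrow> 'n \<Rightarrow> int) set). if w = id then 1 else 0)"
    unfolding realize_def
  proof (rule sum.cong[OF refl])
    fix w :: "('n \<Rightarrow> int) \<Rightarrow> 'n \<Rightarrow> int" assume w: "w \<in> Wfin"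
    have "inv w = id \<longleftrightarrow> w = id" using inv_inv_Wfin[OF w] inv_id by metis
    then show "eta_w w * ofY (delta_fun (inv w)) = (if w = id then 1 else 0)"
      by (auto simp: delta_fun_def)
  qed
  then show ?thesis by simp
qed

lemma realize_DLe: "realize (DLe w) = ofK (chi_T PP w) * T_w w"
proof -
  \<comment> \<open>Proved for every word; all three quantities of the claim are then taken along
    the same word \<open>rword w\<close>.\<close>
  have "realize (foldr DL ws delta_fun) =
      ofK (prod_list (map (chi PP) ws)) * prod_list (map (\<lambda>i. of_gen (GT (Some i))) ws)" for ws :: "'a list"
    by (induction ws)
      (simp_all add: realize_delta comp_apply realize_DL chi_eq ofK_mult mult.assoc ofK_left_commute[of "of_gen _"] id_apply)
  then show ?thesis by (simp add: DLe_def chi_T_def T_w_def)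
qed

context dominant
begin

lemma symmetrizer_eq:
  "ofK (chi_T PP wl) * symmetrizer \<Xi> W = (\<Sum>w\<in>W. eta_w w * ofY (const (sign_W \<Xi> wl * sign_W \<Xi> w) *
    (\<Prod>\<beta>\<in>roots_stab. if plus_on \<Xi> (short_root \<beta>) then kap \<beta> else kap (- inv w \<beta>))))"
proof -
  have "realize (sym_fun \<Xi>) = (\<Sum>w\<in>W. ofK (ratio \<Xi> w) * (ofK (chi_T PP w) * T_w w))"
    unfolding sym_fun_def[abs_def] realize_sum realize_const realize_DLe ..
  also have "\<dots> = (\<Sum>w\<in>W. ofK (chi_T \<Xi> w) * T_w w)"
    by (simp add: ratio_def flip: ofK_mult mult.assoc)
  finally have real: "(\<Sum>w\<in>W. ofK (chi_T \<Xi> w) * T_w w) = realize (sym_fun \<Xi>)" ..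
  have rat: "ratio \<Xi> wl \<noteq> 0" by (simp add: ratio_def)
  \<comment> \<open>Multiplying by chi^+(T_wl) and dividing by chi^Xi(T_wl) is division by the
    ratio, which cancels the one in \<open>sym_fun_eq\<close>.\<close>
  have "ofK (chi_T PP wl) * symmetrizer \<Xi> W = ofK (inverse (ratio \<Xi> wl)) * realize (sym_fun \<Xi>)"
    unfolding symmetrizer_def wl_def[symmetric] real
    by (simp add: ratio_def divide_inverse mult.commute flip: ofK_mult mult.assoc)
  also have "realize (sym_fun \<Xi>) = (\<Sum>w\<in>W. eta_w w * ofY (sym_fun \<Xi> (inv w)))"
    unfolding realize_def
  proof (rule sum.mono_neutral_right)
    show "\<forall>w\<in>Wfin - W. eta_w w * ofY (sym_fun \<Xi> (inv w)) = 0"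
    proof
      fix w assume w: "w \<in> Wfin - W"
      have "inv w \<notin> W" using w inv_W[of "inv w"] by auto
      then have "sym_fun \<Xi> (inv w) = 0"
        using w by (auto simp: sym_fun_def DLe_outside intro!: sum.neutral)
      then show "eta_w w * ofY (sym_fun \<Xi> (inv w)) = 0" by simp
    qed
  qed (auto intro: W_Wfin)
  also have "ofK (inverse (ratio \<Xi> wl)) * \<dots> = (\<Sum>w\<in>W. eta_w w * ofY (const (sign_W \<Xi> wl * sign_W \<Xi> w) *
    (\<Prod>\<beta>\<in>roots_stab. if plus_on \<Xi> (short_root \<beta>) then kap \<beta> else kap (- inv w \<beta>))))"
    unfolding sum_distrib_left
  proof (rule sum.cong[OF refl])
    fix w assume w: "w \<in> W"
    let ?P = "\<Prod>\<beta>\<in>roots_stab. if plus_on \<Xi> (short_root \<beta>) then kap \<beta> else kap (- inv w \<beta>)"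
    have "const (inverse (ratio \<Xi> wl)) * sym_fun \<Xi> (inv w) = const (sign_W \<Xi> wl * sign_W \<Xi> w) * ?P"
      unfolding sym_fun_eq[OF w] using rat by (simp add: mult.assoc const_inverse const_mult)
    then have "ofK (inverse (ratio \<Xi> wl)) * ofY (sym_fun \<Xi> (inv w)) = ofY (const (sign_W \<Xi> wl * sign_W \<Xi> w) * ?P)"
      by (simp flip: ofY_const ofY_mult)
    then show "ofK (inverse (ratio \<Xi> wl)) * (eta_w w * ofY (sym_fun \<Xi> (inv w))) =
        eta_w w * ofY (const (sign_W \<Xi> wl * sign_W \<Xi> w) * ?P)"
      by (simp flip: ofK_left_commute)
  qed
  finally show ?thesis .
qed

end

section \<open>Minimal coset representatives and the expansion\<close>

text \<open>Along a reduced word, index 0 contributes w^(-1) alpha_i for the first letter i and the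
  rest w, and the indices k + 1 give the set of the rest: the recursion of
  \<open>inv_set_refl_fin_up\<close>.\<close>

lemma Inv_eq: "w \<in> Wfin \<Longrightarrow> Inv w = inv_set w"
proof -
  have "{word_act (rev (drop (Suc k) ws)) (root_fin (ws ! k)) | k. k < length ws} = inv_set (word_act ws)"
    if "reduced ws" for ws :: "'a list"
    using that
  proof (induction ws)
    case Nil
    show ?case by (simp only: word_act_Nil inv_set_id) simp
  next
    case (Cons i ws)
    let ?f = "\<lambda>ws k. word_act (rev (drop (Suc k) ws)) (root_fin (ws ! k))"
    have red: "reduced ws" "inv (word_act ws) (root_fin i) \<in> pos_roots"
      using Cons.prems by (auto simp: reduced_Cons descent_def)
    have "{?f (i # ws) k | k. k < length (i # ws)} = insert (?f (i # ws) 0) {?f (i # ws) (Suc k) | k. k < length ws}"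
    proof (intro set_eqI iffI)
      fix x assume "x \<in> {?f (i # ws) k | k. k < length (i # ws)}"
      then obtain k where k: "k < Suc (length ws)" "x = ?f (i # ws) k" by auto
      then show "x \<in> insert (?f (i # ws) 0) {?f (i # ws) (Suc k) | k. k < length ws}"
        by (cases k) auto
    next
      fix x assume "x \<in> insert (?f (i # ws) 0) {?f (i # ws) (Suc k) | k. k < length ws}"
      then consider "x = ?f (i # ws) 0" | k where "k < length ws" "x = ?f (i # ws) (Suc k)" by blast
      then show "x \<in> {?f (i # ws) k | k. k < length (i # ws)}"
      proof cases
        case 1
        then show ?thesis by (intro CollectI exI[of _ 0]) simp
      next
        case (2 k)
        then show ?thesis by (intro CollectI exI[of _ "Suc k"]) simp
      qed
    qed
    also have "\<dots> = insert (inv (word_act ws) (root_fin i)) (inv_set (word_act ws))"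
      using Cons.IH[OF red(1)] by (simp add: inv_word_act)
    also have "\<dots> = inv_set (word_act (i # ws))"
      using inv_set_refl_fin_up(1)[OF word_act_Wfin red(2)] by simp
    finally show ?case .
  qed
  from this[OF reduced_rword] show "w \<in> Wfin \<Longrightarrow> Inv w = inv_set w"
    by (simp add: Inv_def word_act_rword)
qed

lemma kap_pos_roots: "\<beta> \<in> pos_roots \<Longrightarrow> kappaY \<beta> = kap \<beta>"
  by (simp add: kappaY_def kappa_fun_def kap_def kap_d_def kap_s_def Yroot_def short_root_pos_iff)

lemma kap_neg_roots: "\<beta> \<in> pos_roots \<Longrightarrow> kappaYinv \<beta> = kap (- \<beta>)"
  using Yroot_uminus[of \<beta>]
  by (simp add: kappaYinv_def kappa_fun_def kap_def kap_d_def kap_s_def Yroot_def short_root_pos_iff)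

text \<open>Puts the choice between kappa and inverted kappa into the sign of the root; as the type
  is invariant, this commutes with the group.\<close>

definition twist :: "character \<Rightarrow> ('n \<Rightarrow> int) \<Rightarrow> ('n::{finite,linorder} \<Rightarrow> int)" where
  "twist \<Xi> \<beta> = (if plus_on \<Xi> (short_root \<beta>) then \<beta> else - \<beta>)"

lemma twist_all_roots [simp]: "twist \<Xi> \<beta> \<in> all_roots \<longleftrightarrow> \<beta> \<in> all_roots"
  by (simp add: twist_def)

lemma twist_Wfin: "w \<in> Wfin \<Longrightarrow> twist \<Xi> (w \<beta>) = w (twist \<Xi> \<beta>)"
  by (simp add: twist_def Wfin_uminus)

lemma kappaY_w_eq: "w \<in> Wfin \<Longrightarrow> kappaY_w w = (\<Prod>\<beta>\<in>inv_set w. kap \<beta>)"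
  unfolding kappaY_w_def Inv_eq using inv_set_pos_roots by (auto intro!: prod.cong kap_pos_roots)

lemma kappa_char_eq:
  assumes w: "w \<in> Wfin"
  shows "kappa_char \<Xi> w = (\<Prod>\<beta>\<in>inv_set w. kap (twist \<Xi> \<beta>))"
proof -
  have pos: "\<beta> \<in> pos_roots" if "\<beta> \<in> inv_set w" for \<beta> using that inv_set_pos_roots by auto
  have s: "(\<Prod>\<beta>\<in>Inv w \<inter> coroots_s. if \<Xi> \<in> {PP, PM} then kappaY \<beta> else kappaYinv \<beta>) =
      (\<Prod>\<beta>\<in>{\<beta> \<in> inv_set w. \<not> short_root \<beta>}. kap (twist \<Xi> \<beta>))"
    using pos by (intro prod.cong)
      (auto simp: Inv_eq[OF w] coroots_s_iff twist_def plus_on_def kap_pos_roots kap_neg_roots)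
  have d: "(\<Prod>\<beta>\<in>Inv w \<inter> coroots_d. if \<Xi> \<in> {PP, MP} then kappaY \<beta> else kappaYinv \<beta>) =
      (\<Prod>\<beta>\<in>{\<beta> \<in> inv_set w. short_root \<beta>}. kap (twist \<Xi> \<beta>))"
    using pos by (intro prod.cong)
      (auto simp: Inv_eq[OF w] coroots_d_iff twist_def plus_on_def kap_pos_roots kap_neg_roots)
  have "(\<Prod>\<beta>\<in>inv_set w. kap (twist \<Xi> \<beta>)) =
      (\<Prod>\<beta>\<in>{\<beta> \<in> inv_set w. \<not> short_root \<beta>} \<union> {\<beta> \<in> inv_set w. short_root \<beta>}. kap (twist \<Xi> \<beta>))"
    by (rule prod.cong) auto
  then show ?thesis
    unfolding kappa_char_def s d by (subst (asm) prod.union_disjoint) auto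
qed

section \<open>Minimal coset representatives of the stabilizer\<close>

context dominant
begin

lemma Wmin_Wfin: "z \<in> Wmin \<nu> \<Longrightarrow> z \<in> Wfin"
  by (simp add: Wmin_def)

text \<open>Minimality against s_i gives positivity on each simple root of the stabilizer, and
  additivity of the height spreads it.\<close>

lemma Wmin_pos:
  assumes z: "z \<in> Wmin \<nu>" and \<beta>: "\<beta> \<in> roots_stab"
  shows "z \<beta> \<in> pos_roots"
proof -
  have zW: "z \<in> Wfin" by (rule Wmin_Wfin[OF z])
  have "0 < 1 * height (z (root_fin i))" if "pairing \<nu> (root_fin i) = 0" for i
  proof -
    have "refl_fin i \<in> W" using that by (simp add: refl_W)
    then have le: "len z \<le> len (z \<circ> refl_fin i)" using z by (simp add: Wmin_def)
    have "z (root_fin i) \<in> pos_roots"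
    proof (rule ccontr)
      assume "z (root_fin i) \<notin> pos_roots"
      then have "(z \<circ> refl_fin i) (root_fin i) \<in> pos_roots"
        using zW by (simp add: comp_apply refl_fin_root_fin Wfin_uminus uminus_pos_roots_iff)
      then have "card (inv_set z) = Suc (card (inv_set (z \<circ> refl_fin i)))"
        using card_inv_set_comp_refl(2)[of "z \<circ> refl_fin i" i] zW by simp
      then show False using le zW by (simp add: len_eq)
    qed
    then show ?thesis using height_pos by simp
  qed
  then have "0 < 1 * height (z \<beta>)"
    using \<beta> dominant zW by (rule_tac Wfin_root_combination[where \<nu> = \<nu>]) (auto simp: roots_stab_def)
  then show ?thesis using zW \<beta> by (simp add: pos_roots_iff_height roots_stab_def)
qed

lemma exists_Wmin:
  assumes w: "w \<in> Wfin"
  shows "\<exists>z\<in>Wmin \<nu>. \<exists>u\<in>W. w = z \<circ> u"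
proof -
  define u where "u = arg_min len (\<lambda>x. x \<in> (\<lambda>u. w \<circ> u) ` W)"
  have "w \<circ> id \<in> (\<lambda>u. w \<circ> u) ` W" using id_W by blast
  from arg_min_natI[of "\<lambda>x. x \<in> (\<lambda>u. w \<circ> u) ` W", OF this] obtain y where y: "y \<in> W" "u = w \<circ> y"
    unfolding u_def by blast
  have le: "len u \<le> len x" if "x \<in> (\<lambda>u. w \<circ> u) ` W" for x
    unfolding u_def by (rule arg_min_nat_le[where P = "\<lambda>x. x \<in> (\<lambda>u. w \<circ> u) ` W" and m = len, OF that])
  have "len u \<le> len (u \<circ> x)" if "x \<in> W" for x
  proof -
    have "u \<circ> x \<in> (\<lambda>u. w \<circ> u) ` W" using that y comp_W by (auto simp: comp_assoc)
    then show ?thesis by (rule le)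
  qed
  then have "u \<in> Wmin \<nu>" using y w W_Wfin by (auto simp: Wmin_def)
  moreover have "w = u \<circ> inv y" using y W_Wfin by (simp add: comp_assoc)
  ultimately show ?thesis using inv_W[OF y(1)] by blast
qed

text \<open>An inversion beta of u would make - u beta a positive root of the stabilizer, which z
  keeps positive, against the positivity of z u beta.\<close>

lemma Wmin_comp_pos:
  assumes z: "z \<in> Wmin \<nu>" and u: "u \<in> W" and pos: "\<And>\<beta>. \<beta> \<in> roots_stab \<Longrightarrow> (z \<circ> u) \<beta> \<in> pos_roots"
  shows "u = id"
proof (rule inv_set_empty[OF W_Wfin[OF u]], rule ccontr)
  assume "inv_set u \<noteq> {}"
  then obtain \<beta> where \<beta>: "\<beta> \<in> inv_set u" by blast
  then have R: "\<beta> \<in> roots_stab" using inv_set_W[OF u] by blast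
  have "- u \<beta> \<in> roots_stab"
    using \<beta> R pairing_W[OF u, of \<beta>] W_Wfin[OF u]
    by (simp add: inv_set_def roots_stab_def pairing_linear uminus_pos_roots_iff)
  then have "z (- u \<beta>) \<in> pos_roots" by (rule Wmin_pos[OF z])
  then show False
    using pos[OF R] uminus_pos_roots_D Wmin_Wfin[OF z] by (auto simp: comp_apply Wfin_uminus)
qed

lemma WminI:
  assumes "z \<in> Wfin" "\<And>\<beta>. \<beta> \<in> roots_stab \<Longrightarrow> z \<beta> \<in> pos_roots"
  shows "z \<in> Wmin \<nu>"
proof -
  obtain y u where y: "y \<in> Wmin \<nu>" "u \<in> W" "z = y \<circ> u" using exists_Wmin[OF assms(1)] by blast
  then have "u = id" using Wmin_comp_pos[OF y(1,2)] assms(2) by blast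
  then show ?thesis using y by simp
qed

text \<open>Two factorizations of one element give representatives that differ by a stabilizer
  element. As both keep \<open>roots_stab\<close> positive, that element is trivial.\<close>

lemma bij_Wmin_W: "bij_betw (\<lambda>(z, u). z \<circ> u) (Wmin \<nu> \<times> W) Wfin"
proof (rule bij_betw_imageI)
  show "inj_on (\<lambda>(z, u). z \<circ> u) (Wmin \<nu> \<times> W)"
  proof (rule inj_onI, clarify)
    fix z u y x
    assume *: "z \<in> Wmin \<nu>" "u \<in> W" "y \<in> Wmin \<nu>" "x \<in> W" "z \<circ> u = y \<circ> x"
    have "z \<circ> (u \<circ> inv x) = y \<circ> (x \<circ> inv x)" using *(5) by (simp only: comp_assoc[symmetric])
    then have y: "y = z \<circ> (u \<circ> inv x)" using W_Wfin[OF *(4)] by simp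
    have ux: "u \<circ> inv x = id"
      using Wmin_comp_pos[OF *(1) comp_W[OF *(2) inv_W[OF *(4)]]] Wmin_pos[OF *(3)] by (simp add: y)
    then have "u \<circ> (inv x \<circ> x) = x" by (simp flip: comp_assoc)
    then show "z = y \<and> u = x" using y ux W_Wfin[OF *(4)] by simp
  qed
  show "(\<lambda>(z, u). z \<circ> u) ` (Wmin \<nu> \<times> W) = Wfin"
    using exists_Wmin Wmin_Wfin W_Wfin by (force simp: image_iff)
qed

end

interpretation zero: dominant "\<lambda>_. 0 :: int"
  by unfold_locales simp

lemma Wstab_zero: "Wstab (\<lambda>_. 0) = Wfin"
proof -
  have "w (\<lambda>_. 0) = (\<lambda>_. 0)" if "w \<in> Wfin" for w :: "('a \<Rightarrow> int) \<Rightarrow> 'a \<Rightarrow> int"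
    using Wfin_signed_perm[OF that] by (auto simp: signed_perm_def)
  then show ?thesis by (auto simp: Wstab_def)
qed

lemma roots_stab_zero: "zero.roots_stab = pos_roots"
  by (simp add: zero.roots_stab_def)

lemma wl_zero: "zero.wl = longest Wfin"
  by (simp add: zero.wl_def Wstab_zero)

lemma inv_set_longest_Wfin: "inv_set (longest Wfin) = pos_roots"
  using zero.inv_set_wl by (simp add: wl_zero roots_stab_zero)

lemma longest_Wfin [simp]: "longest Wfin \<in> Wfin"
  using zero.wl_Wfin by (simp add: wl_zero)

context dominant
begin

lemma W_complement_pos:
  assumes "u \<in> W" "\<beta> \<in> pos_roots - roots_stab"
  shows "u \<beta> \<in> pos_roots - roots_stab"
  using assms inv_set_W[OF assms(1)] pairing_W[OF assms(1), of \<beta>]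
  by (auto simp: inv_set_def roots_stab_def)

lemma inv_set_Wmin: "z \<in> Wmin \<nu> \<Longrightarrow> inv_set z \<subseteq> pos_roots - roots_stab"
  using Wmin_pos by (auto simp: inv_set_def)

text \<open>A representative can invert only roots outside the stabilizer. The product of the two
  longest elements is a representative which inverts all of these, so the longest one must do so
  too.\<close>

lemma vmax_Wmin: "vmax \<nu> \<in> Wmin \<nu>" and inv_set_vmax: "inv_set (vmax \<nu>) = pos_roots - roots_stab"
proof -
  let ?w0 = "longest Wfin :: ('n \<Rightarrow> int) \<Rightarrow> 'n \<Rightarrow> int"
  let ?c = "?w0 \<circ> wl"
  have w0: "?w0 \<beta> \<notin> pos_roots" if "\<beta> \<in> pos_roots" for \<beta>
    using that inv_set_longest_Wfin unfolding inv_set_def by blast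
  have c: "?c \<in> Wmin \<nu>"
  proof (rule WminI)
    fix \<beta> assume \<beta>: "\<beta> \<in> roots_stab"
    then have "wl \<beta> \<notin> pos_roots" unfolding inv_set_wl[symmetric] by (simp add: inv_set_def)
    then have "- wl \<beta> \<in> pos_roots" using \<beta> by (simp add: roots_stab_def uminus_pos_roots_iff)
    then have "?w0 (- wl \<beta>) \<notin> pos_roots" by (rule w0)
    then show "?c \<beta> \<in> pos_roots"
      using \<beta> by (simp add: comp_apply Wfin_uminus uminus_pos_roots_iff roots_stab_def)
  qed simp
  have "pos_roots - roots_stab \<subseteq> inv_set ?c"
    using W_complement_pos[OF wl_W] w0 by (auto simp: inv_set_def comp_apply)
  then have c_card: "card (pos_roots - roots_stab) \<le> card (inv_set ?c)" by (simp add: card_mono)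
  have "finite (Wmin \<nu>)" by (rule finite_subset[OF _ finite_Wfin]) (auto simp: Wmin_def)
  then have v: "vmax \<nu> \<in> Wmin \<nu>" and "len ?c \<le> len (vmax \<nu>)"
    using c unfolding vmax_def by (auto intro: longest_props)
  then have "card (pos_roots - roots_stab) \<le> card (inv_set (vmax \<nu>))"
    using c_card Wmin_Wfin[OF v] by (simp add: len_eq)
  then show "inv_set (vmax \<nu>) = pos_roots - roots_stab"
    using inv_set_Wmin[OF v] by (intro card_seteq) auto
  show "vmax \<nu> \<in> Wmin \<nu>" by (rule v)
qed

text \<open>Here the inverse of z enters. Write beta = z gamma: \<open>vmax\<close> negates exactly
  the positive roots outside the stabilizer. If gamma is negative with z gamma positive, then -
  gamma is outside the stabilizer, so \<open>vmax\<close> makes gamma positive and beta is no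
  inversion.\<close>

lemma inv_set_vmax_inv:
  assumes z: "z \<in> Wmin \<nu>"
  shows "inv_set (vmax \<nu> \<circ> inv z) = z ` {\<gamma> \<in> pos_roots - roots_stab. z \<gamma> \<in> pos_roots}"
proof -
  have zW: "z \<in> Wfin" and vW: "vmax \<nu> \<in> Wfin" using z vmax_Wmin Wmin_Wfin by auto
  have "vmax \<nu> \<gamma> \<notin> pos_roots \<longleftrightarrow> \<gamma> \<in> pos_roots - roots_stab"
    if \<gamma>: "\<gamma> \<in> all_roots" and z\<gamma>: "z \<gamma> \<in> pos_roots" for \<gamma>
  proof (cases "\<gamma> \<in> pos_roots")
    case True
    then show ?thesis using inv_set_vmax by (auto simp: inv_set_def)
  next
    case False
    then have neg: "- \<gamma> \<in> pos_roots" using \<gamma> by (simp add: uminus_pos_roots_iff)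
    have "- \<gamma> \<notin> roots_stab"
      using Wmin_pos[OF z, of "- \<gamma>"] z\<gamma> uminus_pos_roots_D[OF z\<gamma>] zW by (auto simp: Wfin_uminus)
    then have "- \<gamma> \<in> inv_set (vmax \<nu>)" using neg by (simp add: inv_set_vmax)
    then have "vmax \<nu> \<gamma> \<in> pos_roots"
      using vW \<gamma> by (simp add: inv_set_def Wfin_uminus uminus_pos_roots_iff)
    then show ?thesis using False by simp
  qed
  note key = this
  show ?thesis
  proof (intro set_eqI iffI)
    fix \<beta> assume "\<beta> \<in> inv_set (vmax \<nu> \<circ> inv z)"
    then have \<beta>: "\<beta> \<in> pos_roots" "vmax \<nu> (inv z \<beta>) \<notin> pos_roots" by (auto simp: inv_set_def comp_apply)
    then have "inv z \<beta> \<in> pos_roots - roots_stab" using key[of "inv z \<beta>"] zW by simp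
    then show "\<beta> \<in> z ` {\<gamma> \<in> pos_roots - roots_stab. z \<gamma> \<in> pos_roots}"
      using \<beta> zW by (intro image_eqI[of _ _ "inv z \<beta>"]) auto
  next
    fix \<beta> assume "\<beta> \<in> z ` {\<gamma> \<in> pos_roots - roots_stab. z \<gamma> \<in> pos_roots}"
    then obtain \<gamma> where "\<beta> = z \<gamma>" "\<gamma> \<in> pos_roots - roots_stab" "z \<gamma> \<in> pos_roots" by blast
    then show "\<beta> \<in> inv_set (vmax \<nu> \<circ> inv z)" using key[of \<gamma>] zW by (simp add: inv_set_def comp_apply)
  qed
qed

text \<open>The term of z in the expansion times the term of u in the stabilizer symmetrizer is, up
  to signs, the term of z u in the full symmetrizer.\<close>

lemma coset_term:
  assumes z: "z \<in> Wmin \<nu>" and u: "u \<in> W"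
    and pl: "\<And>\<beta>. \<beta> \<in> roots_stab \<Longrightarrow> plus_on \<Xi> (short_root \<beta>)"
  shows "ofY (kappa_char \<Xi> (vmax \<nu> \<circ> inv z)) * eta_w z * ofY (kappaY_w z) *
      (eta_w u * ofY (\<Prod>\<beta>\<in>roots_stab. kap \<beta>)) =
    eta_w (z \<circ> u) * ofY (\<Prod>\<beta>\<in>pos_roots. if plus_on \<Xi> (short_root \<beta>) then kap \<beta> else kap (- inv (z \<circ> u) \<beta>))"
proof -
  have zW: "z \<in> Wfin" and vW: "vmax \<nu> \<in> Wfin" and uW: "u \<in> Wfin"
    using z vmax_Wmin Wmin_Wfin u W_Wfin by auto
  let ?C = "pos_roots - roots_stab"
  let ?N = "{\<gamma> \<in> ?C. z \<gamma> \<in> pos_roots}"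
  \<comment> \<open>With eta_z moved to the left, every positive root outside the stabilizer
    contributes one factor: a twisted one from \<open>kappa_char\<close> if z keeps it positive, an
    untwisted one from \<open>kappaY_w\<close> otherwise.\<close>
  define q where "q \<gamma> = (if z \<gamma> \<in> pos_roots then twist \<Xi> \<gamma> else \<gamma>)" for \<gamma>
  have "inj_on z A" for A using bij_Wfin[OF zW] by (auto simp: bij_def inj_on_def)
  then have "(\<Prod>\<beta>\<in>z ` ?N. kap (twist \<Xi> \<beta>)) = (\<Prod>\<gamma>\<in>?N. kap (z (twist \<Xi> \<gamma>)))"
    using zW by (simp add: prod.reindex comp_def twist_Wfin)
  then have "kappa_char \<Xi> (vmax \<nu> \<circ> inv z) = (\<Prod>\<gamma>\<in>?N. kap (z (twist \<Xi> \<gamma>)))"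
    using zW vW by (simp add: kappa_char_eq inv_set_vmax_inv[OF z])
  then have "ofY (kappa_char \<Xi> (vmax \<nu> \<circ> inv z)) * eta_w z = eta_w z * ofY (\<Prod>\<gamma>\<in>?N. kap (twist \<Xi> \<gamma>))"
    using eta_w_prod_kap[OF zW, of ?N "twist \<Xi>"] by simp
  moreover have "(\<Prod>\<gamma>\<in>?N. kap (twist \<Xi> \<gamma>)) * kappaY_w z = (\<Prod>\<gamma>\<in>?C. kap (q \<gamma>))"
  proof -
    have "inv_set z = {\<gamma> \<in> ?C. z \<gamma> \<notin> pos_roots}" using inv_set_Wmin[OF z] by (auto simp: inv_set_def)
    then have "kappaY_w z = (\<Prod>\<gamma>\<in>{\<gamma> \<in> ?C. z \<gamma> \<notin> pos_roots}. kap (q \<gamma>))"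
      using zW by (simp add: kappaY_w_eq q_def)
    moreover have "(\<Prod>\<gamma>\<in>?N. kap (twist \<Xi> \<gamma>)) = (\<Prod>\<gamma>\<in>?N. kap (q \<gamma>))"
      by (rule prod.cong) (auto simp: q_def)
    ultimately have "(\<Prod>\<gamma>\<in>?N. kap (twist \<Xi> \<gamma>)) * kappaY_w z =
        (\<Prod>\<gamma>\<in>?N \<union> {\<gamma> \<in> ?C. z \<gamma> \<notin> pos_roots}. kap (q \<gamma>))"
      by (subst prod.union_disjoint) auto
    also have "?N \<union> {\<gamma> \<in> ?C. z \<gamma> \<notin> pos_roots} = ?C" by auto
    finally show ?thesis .
  qed
  ultimately have 1: "ofY (kappa_char \<Xi> (vmax \<nu> \<circ> inv z)) * eta_w z * ofY (kappaY_w z) =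
      eta_w z * ofY (\<Prod>\<gamma>\<in>?C. kap (q \<gamma>))"
    by (simp add: mult.assoc flip: ofY_mult)
  have q_root: "q \<gamma> \<in> all_roots" if "\<gamma> \<in> ?C" for \<gamma> using that by (simp add: q_def)
  have comm: "eta_w u * ofY (\<Prod>\<gamma>\<in>?C. kap (inv u (q \<gamma>))) = ofY (\<Prod>\<gamma>\<in>?C. kap (q \<gamma>)) * eta_w u"
    using eta_w_prod_kap[OF uW, of ?C "\<lambda>\<gamma>. inv u (q \<gamma>)"] q_root uW by simp
  have move: "a * c * (b * r) = a * b * (c' * r)" if "b * c' = c * b" for a b c c' r :: "'n Hloc"
  proof -
    have "a * c * (b * r) = a * (c * b) * r" by (simp only: mult.assoc)
    also have "\<dots> = a * b * (c' * r)" by (simp only: that[symmetric] mult.assoc)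
    finally show ?thesis .
  qed
  have 2: "ofY (kappa_char \<Xi> (vmax \<nu> \<circ> inv z)) * eta_w z * ofY (kappaY_w z) *
      (eta_w u * ofY (\<Prod>\<beta>\<in>roots_stab. kap \<beta>)) =
      eta_w (z \<circ> u) * ofY ((\<Prod>\<gamma>\<in>?C. kap (inv u (q \<gamma>))) * (\<Prod>\<beta>\<in>roots_stab. kap \<beta>))"
    unfolding 1 eta_w_comp[OF zW uW] ofY_mult by (rule move[OF comm])
  \<comment> \<open>By \<open>pl\<close> all positive roots of minus type lie outside the
    stabilizer, so the second set may range over all of \<open>pos_roots\<close>.\<close>
  let ?P = "{\<beta> \<in> ?C. plus_on \<Xi> (short_root \<beta>)}" and ?M = "{\<beta> :: 'n \<Rightarrow> int. \<beta> \<in> pos_roots \<and> \<not> plus_on \<Xi> (short_root \<beta>)}"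
  have C: "?C = ?P \<union> ?M" using pl by auto
  have split_C: "(\<Prod>\<gamma>\<in>?C. f \<gamma>) = (\<Prod>\<gamma>\<in>?P. f \<gamma>) * (\<Prod>\<gamma>\<in>?M. f \<gamma>)" for f :: "_ \<Rightarrow> 'n ratfun"
    by (rule trans[OF prod.cong[OF C refl] prod.union_disjoint]) auto
  \<comment> \<open>On plus type q is the identity, and u permutes the positive roots outside the
    stabilizer.\<close>
  have P: "(\<Prod>\<gamma>\<in>?P. kap (inv u (q \<gamma>))) = (\<Prod>\<gamma>\<in>?P. kap \<gamma>)"
    by (rule prod.reindex_bij_witness[where i = u and j = "inv u"])
      (use W_complement_pos[OF u] W_complement_pos[OF inv_W[OF u]] uW in \<open>auto simp: q_def twist_def\<close>)
  \<comment> \<open>The positive one of x beta and its negative. The map for z permutes the positive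
    roots of minus type, and the sign it chooses is the one recorded in q, since q beta = - beta
    exactly when z beta is positive.\<close>
  let ?a = "\<lambda>(x :: ('n \<Rightarrow> int) \<Rightarrow> 'n \<Rightarrow> int) \<beta>. if x \<beta> \<in> pos_roots then x \<beta> else - x \<beta>"
  have M: "(\<Prod>\<gamma>\<in>?M. kap (inv u (q \<gamma>))) = (\<Prod>\<beta>\<in>?M. kap (- inv (z \<circ> u) \<beta>))"
  proof (rule prod.reindex_bij_witness[where i = "?a (inv z)" and j = "?a z"])
    fix \<beta> assume \<beta>: "\<beta> \<in> ?M"
    then show "?a (inv z) (?a z \<beta>) = \<beta>" "?a z (?a (inv z) \<beta>) = \<beta>" "?a z \<beta> \<in> ?M" "?a (inv z) \<beta> \<in> ?M"
      using zW uminus_pos_roots_D[of \<beta>] by (auto simp: Wfin_uminus uminus_pos_roots_iff)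
    show "kap (- inv (z \<circ> u) (?a z \<beta>)) = kap (inv u (q \<beta>))"
      using \<beta> zW uW by (auto simp: q_def twist_def inv_comp_distrib_Wfin comp_apply Wfin_uminus)
  qed
  have "(\<Prod>\<beta>\<in>pos_roots. if plus_on \<Xi> (short_root \<beta>) then kap \<beta> else kap (- inv (z \<circ> u) \<beta>)) =
      (\<Prod>\<beta>\<in>?P \<union> roots_stab. kap \<beta>) * (\<Prod>\<beta>\<in>?M. kap (- inv (z \<circ> u) \<beta>))"
  proof -
    have "pos_roots \<inter> {\<beta>. plus_on \<Xi> (short_root \<beta>)} = ?P \<union> roots_stab"
      "pos_roots \<inter> - {\<beta>. plus_on \<Xi> (short_root \<beta>)} = ?M"
      using pl by (auto simp: roots_stab_def)
    then show ?thesis by (simp only: prod.If_cases[OF finite_pos_roots])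
  qed
  also have "(\<Prod>\<beta>\<in>?P \<union> roots_stab. kap \<beta>) = (\<Prod>\<beta>\<in>?P. kap \<beta>) * (\<Prod>\<beta>\<in>roots_stab. kap \<beta>)"
    by (rule prod.union_disjoint) auto
  finally show ?thesis unfolding 2 split_C P M by (simp add: mult_ac)
qed

theorem hecke_sym_expansion:
  assumes pl: "\<And>\<beta>. \<beta> \<in> roots_stab \<Longrightarrow> plus_on \<Xi> (short_root \<beta>)"
  defines "w0 \<equiv> longest Wfin :: ('n \<Rightarrow> int) \<Rightarrow> 'n \<Rightarrow> int"
  shows "ofK (chi_T PP w0) * hecke_sym \<Xi> =
    ofK (sign_W \<Xi> w0) * ofK (chi_T PP (longest W)) *
    (\<Sum>z\<in>Wmin \<nu>. ofK (sign_W \<Xi> z) * ofY (kappa_char \<Xi> (vmax \<nu> \<circ> inv z)) * eta_w z * ofY (kappaY_w z)) *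
    hecke_sym_stab \<nu>"
proof -
  let ?G = "\<lambda>w :: ('n \<Rightarrow> int) \<Rightarrow> 'n \<Rightarrow> int. ofY (\<Prod>\<beta>\<in>pos_roots. if plus_on \<Xi> (short_root \<beta>) then kap \<beta> else kap (- inv w \<beta>))"
  let ?A = "\<lambda>z. ofY (kappa_char \<Xi> (vmax \<nu> \<circ> inv z)) * eta_w z * ofY (kappaY_w z)"
  let ?s0 = "sign_W \<Xi> w0"
  \<comment> \<open>Reduced words in the stabilizer use only simple reflections of plus type; hence
    the sign of z u is that of z.\<close>
  have sign_u: "sign_W \<Xi> u = 1" if "u \<in> W" for u
    using that
  proof (induction u rule: W_up_induct)
    case (step i w)
    then have "root_fin i \<in> roots_stab" by (simp add: refl_W roots_stab_def)
    then have "sign_simple \<Xi> i = 1" using pl[of "root_fin i"] by (simp add: sign_simple_def)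
    then show ?case using step W_Wfin by (simp add: sign_W_refl)
  qed simp
  have sign_PP: "sign_W PP w = 1" for w :: "('n \<Rightarrow> int) \<Rightarrow> 'n \<Rightarrow> int"
  proof -
    have "prod_list (map (sign_simple PP) ws) = 1" for ws :: "'n list"
      by (induction ws) (simp_all add: sign_simple_def)
    then show ?thesis by (simp add: sign_W_def)
  qed
  have stab: "ofK (chi_T PP (longest W)) * hecke_sym_stab \<nu> = (\<Sum>u\<in>W. eta_w u * ofY (\<Prod>\<beta>\<in>roots_stab. kap \<beta>))"
    using symmetrizer_eq[of PP] by (simp add: hecke_sym_stab_def wl_def sign_PP)
  have "ofK (chi_T PP w0) * hecke_sym \<Xi> =
      (\<Sum>w\<in>Wfin. ofK (?s0 * sign_W \<Xi> w) * (eta_w w * ?G w))"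
    \<comment> \<open>The expansion of the stabilizer symmetrizer at the weight 0, where all
      positive roots are roots of the stabilizer.\<close>
    using zero.symmetrizer_eq[of \<Xi>, where 'a = 'n]
    by (simp add: hecke_sym_def w0_def wl_zero Wstab_zero roots_stab_zero ofY_mult ofY_const ofK_left_commute[of "eta_w _"])
  also have "\<dots> = (\<Sum>(z, u)\<in>Wmin \<nu> \<times> W. ofK (?s0 * sign_W \<Xi> (z \<circ> u)) * (eta_w (z \<circ> u) * ?G (z \<circ> u)))"
    using sum.reindex_bij_betw[OF bij_Wmin_W, of "\<lambda>w. ofK (?s0 * sign_W \<Xi> w) * (eta_w w * ?G w)"]
    unfolding case_prod_unfold by (rule sym)
  also have "\<dots> = (\<Sum>(z, u)\<in>Wmin \<nu> \<times> W.
      ofK ?s0 * (ofK (sign_W \<Xi> z) * (?A z * (eta_w u * ofY (\<Prod>\<beta>\<in>roots_stab. kap \<beta>)))))"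
  proof (rule sum.cong[OF refl], clarify)
    fix z u assume "z \<in> Wmin \<nu>" "u \<in> W"
    then show "ofK (?s0 * sign_W \<Xi> (z \<circ> u)) * (eta_w (z \<circ> u) * ?G (z \<circ> u)) =
        ofK ?s0 * (ofK (sign_W \<Xi> z) * (?A z * (eta_w u * ofY (\<Prod>\<beta>\<in>roots_stab. kap \<beta>))))"
      using coset_term[of z u \<Xi>] pl Wmin_Wfin W_Wfin
      by (simp add: sign_W_comp sign_u ofK_mult mult.assoc)
  qed
  also have "\<dots> = ofK ?s0 * ((\<Sum>z\<in>Wmin \<nu>. ofK (sign_W \<Xi> z) * ?A z) *
      (\<Sum>u\<in>W. eta_w u * ofY (\<Prod>\<beta>\<in>roots_stab. kap \<beta>)))"
    by (simp only: sum_product sum.cartesian_product)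
      (auto simp: sum_distrib_left mult.assoc intro!: sum.cong)
  also have "\<dots> = ofK ?s0 * ofK (chi_T PP (longest W)) * (\<Sum>z\<in>Wmin \<nu>. ofK (sign_W \<Xi> z) * ?A z) * hecke_sym_stab \<nu>"
    unfolding stab[symmetric] by (simp add: mult.assoc ofK_left_commute[of "sum _ _"])
  finally show ?thesis by (simp add: mult.assoc)
qed

end

text \<open>Each upward step by s_i adds one inversion of the same type as alpha_i, since types are
  invariant. This reduces the sign of the longest element to counting positive roots.\<close>

lemma sign_W_card:
  "w \<in> Wfin \<Longrightarrow> sign_W \<Xi> w = (- 1) ^ card {\<beta> \<in> inv_set w. \<not> plus_on \<Xi> (short_root \<beta>)}"
proof (induction w rule: Wfin_up_induct)
  case id
  then show ?case by simp
next
  case (step i w)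
  have pos: "inv w (root_fin i) \<in> pos_roots" using step by (simp add: descent_def)
  note up = inv_set_refl_fin_up[OF step(1) pos]
  let ?A = "{\<beta> \<in> inv_set w. \<not> plus_on \<Xi> (short_root \<beta>)}"
  have "{\<beta> \<in> inv_set (refl_fin i \<circ> w). \<not> plus_on \<Xi> (short_root \<beta>)} =
      (if plus_on \<Xi> (i = last_ix) then ?A else insert (inv w (root_fin i)) ?A)"
    using step by (auto simp: up(1))
  then show ?case
    using step up(2) by (simp add: sign_W_refl sign_simple_def)
qed

lemma even_card_coroots_s: "even (card (coroots_s :: ('n::{finite,linorder} \<Rightarrow> int) set))"
proof -
  let ?S = "{(a, b). a < b} :: ('n \<times> 'n) set"
  let ?f = "\<lambda>(a, b) k. eps a k + eps b k :: int" and ?g = "\<lambda>(a, b) k. eps a k - eps b k :: int"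
  have supp: "a = c \<and> b = d" if "a < b" "c < d" "\<And>k. k = a \<or> k = b \<longleftrightarrow> k = c \<or> k = d" for a b c d :: 'n
    using that(1,2) that(3)[of a] that(3)[of b] that(3)[of c] by auto
  have f: "inj_on ?f ?S" and g: "inj_on ?g ?S"
  proof -
    have sf: "?f (a, b) k \<noteq> 0 \<longleftrightarrow> k = a \<or> k = b" "?g (a, b) k \<noteq> 0 \<longleftrightarrow> k = a \<or> k = b" if "a < b" for a b k :: 'n
      using that by (auto simp: eps_def)
    show "inj_on ?f ?S"
    proof (rule inj_onI, clarify)
      fix a b c d :: 'n assume *: "a < b" "c < d" "(\<lambda>k. eps a k + eps b k) = (\<lambda>k. eps c k + eps d k)"
      show "a = c \<and> b = d"
        by (rule supp[OF *(1,2)]) (use sf(1)[OF *(1)] sf(1)[OF *(2)] fun_cong[OF *(3)] in auto)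
    qed
    show "inj_on ?g ?S"
    proof (rule inj_onI, clarify)
      fix a b c d :: 'n assume *: "a < b" "c < d" "(\<lambda>k. eps a k - eps b k) = (\<lambda>k. eps c k - eps d k)"
      show "a = c \<and> b = d"
        by (rule supp[OF *(1,2)]) (use sf(2)[OF *(1)] sf(2)[OF *(2)] fun_cong[OF *(3)] in auto)
    qed
  qed
  have "coroots_s = ?f ` ?S \<union> ?g ` ?S" unfolding coroots_s_def by auto
  moreover have "?f ` ?S \<inter> ?g ` ?S = {}"
  proof -
    \<comment> \<open>The sum of the coordinates separates sums of two eps from differences.\<close>
    have "pairing (\<lambda>_. 1) (?f p) = 2" "pairing (\<lambda>_. 1) (?g p) = 0" for p :: "'n \<times> 'n"
      by (cases p; simp add: pairing_linear pairing_eps)+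
    then show ?thesis by (metis (no_types, lifting) disjoint_iff imageE zero_neq_numeral)
  qed
  ultimately have "card (coroots_s :: ('n \<Rightarrow> int) set) = card ?S + card ?S"
    using card_Un_disjoint[of "?f ` ?S" "?g ` ?S"] card_image[OF f] card_image[OF g] by simp
  then show ?thesis by simp
qed

lemma sign_W_MP_longest: "sign_W MP (longest Wfin :: ('n::{finite,linorder} \<Rightarrow> int) \<Rightarrow> 'n \<Rightarrow> int) = 1"
proof -
  have "{\<beta> \<in> pos_roots. \<not> plus_on MP (short_root \<beta>)} = (coroots_s :: ('n \<Rightarrow> int) set)"
    by (auto simp: plus_on_def coroots_s_iff)
  then show ?thesis
    using even_card_coroots_s[where 'n = 'n] by (simp add: sign_W_card inv_set_longest_Wfin)
qed

lemma sign_W_eq: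
  "sign_W PP w = 1" "sign_W PM w = (- 1) ^ len_d w"
  "sign_W MP w = (- 1) ^ len_s w" "sign_W MM w = (- 1) ^ len w"
proof -
  have *: "prod_list (map (sign_simple \<Xi>) ws) = (- 1) ^ length (filter (\<lambda>i. \<not> plus_on \<Xi> (i = last_ix)) ws)" for \<Xi> ws
    by (induction ws) (simp_all add: sign_simple_def)
  then show "sign_W PP w = 1" "sign_W PM w = (- 1) ^ len_d w"
    "sign_W MP w = (- 1) ^ len_s w" "sign_W MM w = (- 1) ^ len w"
    unfolding sign_W_def len_d_def len_s_def len_def * by (simp_all add: plus_on_def)
qed

lemma antimono_dominant:
  fixes \<nu> :: "'n::{finite,linorder} \<Rightarrow> int"
  assumes "antimono \<nu>" "\<nu> last_ix \<ge> 0"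
  shows "dominant \<nu>"
proof
  fix i :: 'n
  show "pairing \<nu> (root_fin i) \<ge> 0"
    using assms antimonoD[OF assms(1), of i "next_ix i"] less_next_ix[of i]
    by (auto simp: pairing_root_fin)
qed

lemma antimono_add:
  fixes f g :: "'n::{finite,linorder} \<Rightarrow> int"
  assumes "antimono f" "antimono g"
  shows "antimono (\<lambda>i. f i + g i)"
  using assms by (auto intro!: antimonoI add_mono dest: antimonoD)

theorem proposition2p4:
  fixes lam :: "'n::{finite,linorder} \<Rightarrow> int"
  assumes "antimono lam" and "lam last_ix \<ge> 0"
  shows
    "let w0 = (longest Wfin :: ('n \<Rightarrow> int) \<Rightarrow> 'n \<Rightarrow> int) in
     ofK (chi_T PP w0) * hecke_sym PP =
       ofK (chi_T PP (longest (Wstab lam))) *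
       (\<Sum>z\<in>Wmin lam.
          ofY (kappa_char PP (vmax lam \<circ> inv z)) * eta_w z * ofY (kappaY_w z)) *
       hecke_sym_stab lam \<and>
     (let \<nu> = (\<lambda>i. lam i + omega i) in
      ofK (chi_T PP w0) * hecke_sym PM =
       ofK ((- 1) ^ len_d w0) *
       ofK (chi_T PP (longest (Wstab \<nu>))) *
       (\<Sum>z\<in>Wmin \<nu>. ofK ((- 1) ^ len_d z) *
          ofY (kappa_char PM (vmax \<nu> \<circ> inv z)) * eta_w z * ofY (kappaY_w z)) *
       hecke_sym_stab \<nu>) \<and>
     (let \<nu> = (\<lambda>i. lam i + pi_vec i) in
      ofK (chi_T PP w0) * hecke_sym MP =
       ofK (chi_T PP (longest (Wstab \<nu>))) *
       (\<Sum>z\<in>Wmin \<nu>. ofK ((- 1) ^ len_s z) *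
          ofY (kappa_char MP (vmax \<nu> \<circ> inv z)) * eta_w z * ofY (kappaY_w z)) *
       hecke_sym_stab \<nu>) \<and>
     (let \<nu> = (\<lambda>i. lam i + rho i) in
      ofK (chi_T PP w0) * hecke_sym MM =
       ofK ((- 1) ^ len w0) *
       ofK (chi_T PP (longest (Wstab \<nu>))) *
       (\<Sum>z\<in>Wmin \<nu>. ofK ((- 1) ^ len z) *
          ofY (kappa_char MM (vmax \<nu> \<circ> inv z)) * eta_w z * ofY (kappaY_w z)) *
       hecke_sym_stab \<nu>)"
proof -
  have nonneg: "lam i \<ge> 0" for i using antimonoD[OF assms(1) le_last_ix[of i]] assms(2) by simp
  have mono: "lam b \<le> lam a" if "a < b" for a b using antimonoD[OF assms(1), of a b] that by simp
  have pi_less: "pi_vec b < pi_vec a" if "a < b" for a b :: 'n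
    unfolding pi_vec_def using that by (auto intro!: psubset_card_mono)
  have pi_nonneg: "pi_vec a \<ge> 0" for a :: 'n by (simp add: pi_vec_def)
  have anti: "antimono (rho :: 'n \<Rightarrow> int)" "antimono (pi_vec :: 'n \<Rightarrow> int)" "antimono (omega :: 'n \<Rightarrow> int)"
    by (auto intro!: antimonoI simp: rho_def pi_vec_def omega_def card_mono)
  interpret lam: dominant lam using assms by (rule antimono_dominant)
  interpret om: dominant "\<lambda>i. lam i + omega i"
    using assms anti by (intro antimono_dominant antimono_add) (auto simp: omega_def[of last_ix])
  interpret pi: dominant "\<lambda>i. lam i + pi_vec i"
    using assms anti by (intro antimono_dominant antimono_add) (auto simp: pi_vec_def[of last_ix])
  interpret rho: dominant "\<lambda>i. lam i + rho i"
    using assms anti by (intro antimono_dominant antimono_add) (auto simp: rho_def[of last_ix])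
  \<comment> \<open>All entries of the weight are positive, so it is orthogonal to no eps_a; only
    roots of plus type for PM remain.\<close>
  have om_long: "\<not> short_root \<beta>" if "\<beta> \<in> om.roots_stab" for \<beta>
  proof
    assume "short_root \<beta>"
    moreover have "\<beta> \<in> pos_roots" using that by (simp add: om.roots_stab_def)
    ultimately obtain a where "\<beta> = eps a"
      using short_root_pos_iff[of \<beta>] by (auto simp: coroots_d_def)
    then show False using that nonneg[of a] by (simp add: om.roots_stab_def pairing_eps omega_def[of a])
  qed
  \<comment> \<open>The weight is strictly decreasing and nonnegative, so it pairs positively with
    all eps_a + eps_b and eps_a - eps_b for a < b.\<close>
  have pi_short: "short_root \<beta>" if "\<beta> \<in> pi.roots_stab" for \<beta>
  proof (rule ccontr)
    assume "\<not> short_root \<beta>"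
    then have "\<beta> \<in> coroots_s" using that by (simp add: coroots_s_iff pi.roots_stab_def)
    then obtain a b where "a < b" "\<beta> = (\<lambda>k. eps a k + eps b k) \<or> \<beta> = (\<lambda>k. eps a k - eps b k)"
      by (auto simp: coroots_s_def)
    then show False
      using that mono[of a b] pi_less[of a b] nonneg[of a] nonneg[of b] pi_nonneg[of b]
      by (auto simp: pi.roots_stab_def pairing_eps pairing_linear)
  qed
  \<comment> \<open>The shift adds the height, which is positive on every positive root; the
    stabilizer has no roots left.\<close>
  have rho_empty: "\<beta> \<notin> rho.roots_stab" for \<beta>
  proof
    assume \<beta>: "\<beta> \<in> rho.roots_stab"
    then have "\<beta> \<in> pos_roots" by (simp add: rho.roots_stab_def)
    moreover have "pairing (\<lambda>i. lam i + rho i) \<beta> = pairing lam \<beta> + height \<beta>"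
      by (simp add: pairing_def height_def distrib_right sum.distrib)
    ultimately show False
      using \<beta> height_pos[of \<beta>] lam.pairing_pos_roots[of \<beta>] by (simp add: rho.roots_stab_def)
  qed
  have "ofK (sign_W MP (longest Wfin :: ('n \<Rightarrow> int) \<Rightarrow> 'n \<Rightarrow> int)) = (1 :: 'n Hloc)"
    by (simp add: sign_W_MP_longest)
  then show ?thesis
    unfolding Let_def sign_W_eq[symmetric]
    using lam.hecke_sym_expansion[of PP] om.hecke_sym_expansion[of PM] pi.hecke_sym_expansion[of MP]
      rho.hecke_sym_expansion[of MM] om_long pi_short rho_empty
    by (simp add: plus_on_def sign_W_eq(1))
qed

end
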